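(* Let $d\in\mathbb{N}$, $\alpha\in(0,2)$, $m\ge 0$, $a,v>0$, and suppose that $H_{m,\alpha}=L_{m,\alpha}-v\mathbf{1}_{\mathcal{B}_a}$ has a ground state $\varphi_0$, with eigenvalue $\lambda_0$. Let $\mathbf{a}=(a,0,\ldots,0)\in\mathbb{R}^d$. Then there exists a constant $C\ge 1$, depending on $d,m,\alpha,a,v,\lambda_0$, such that $$\frac1C\,\varphi_0(\mathbf{a})\,\mathbb{E}^x\big[e^{(v-|\lambda_0|)\tau_a}\big]\le\varphi_0(x)\le C\,\varphi_0(\mathbf{a})\,\mathbb{E}^x\big[e^{(v-|\lambda_0|)\tau_a}\big]\qquad\text{if } |x|\le a,$$ $$\frac1C\,\varphi_0(\mathbf{a})\,\mathbb{E}^x\big[e^{-|\lambda_0|T_a}\big]\le\varphi_0(x)\le C\,\varphi_0(\mathbf{a})\,\mathbb{E}^x\big[e^{-|\lambda_0|T_a}\big]\qquad\text{if } |x|\ge a.$$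
   Context: For $z\ge 0$ let $\Phi_{m,\alpha}(z)=(z+m^{2/\alpha})^{\alpha/2}-m$, and let $L_{m,\alpha}=\Phi_{m,\alpha}(-\Delta)$ be the self-adjoint operator on $L^2(\mathbb{R}^d)$ given by the Fourier multiplier $\Phi_{m,\alpha}(|y|^2)$. $(X_t)_{t\ge 0}$ is the c\`adl\`ag L\'evy process in $\mathbb{R}^d$ with generator $-L_{m,\alpha}$, i.e. $\mathbb{E}^x[f(X_t)]=(e^{-tL_{m,\alpha}}f)(x)$, where $\mathbb{E}^x$ is expectation for the process started at $x$. $\mathcal{B}_a$ is the open ball of radius $a$ centred at $0$, $\tau_a=\inf\{t>0:X_t\notin\mathcal{B}_a\}$ and $T_a=\inf\{t>0:X_t\in\mathcal{B}_a\}$, with $e^{-|\lambda_0|T_a}=0$ on $\{T_a=\infty\}$. A ground state of $H_{m,\alpha}$ is a nonzero $\varphi_0\in\mathrm{Dom}(H_{m,\alpha})$ with $H_{m,\alpha}\varphi_0=\lambda_0\varphi_0$, where $\lambda_0=\inf\mathrm{Spec}\,H_{m,\alpha}\in(-v,0)$. If it exists it is unique up to a scalar multiple, bounded and continuous, and it is always chosen strictly positive with $\|\varphi_0\|_{L^2}=1$. *)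

theory Defs
  imports "HOL-Probability.Probability"
begin

section \<open>Operators on \<open>L\<^sup>2\<close>\<close>

text \<open>
  Elements of \<open>L\<^sup>2(\<real>\<^sup>d)\<close> are represented by complex-valued Borel functions on \<open>real ^ 'n\<close>,
  with \<open>d = CARD('n)\<close>. Unbounded operators are represented by their graphs: \<open>A f g\<close> means that
  \<open>f\<close> lies in the domain and \<open>A f = g\<close>. All graphs below are closed under changing \<open>f\<close> or \<open>g\<close> on
  a Lebesgue null set.
\<close>

definition L2 :: "(real ^ 'n \<Rightarrow> complex) set" where
  "L2 = {f. f \<in> borel_measurable lborel \<and> integrable lborel (\<lambda>x. (norm (f x))\<^sup>2)}"

definition L2_norm :: "(real ^ 'n \<Rightarrow> complex) \<Rightarrow> real" where
  "L2_norm f = sqrt (LINT x|lborel. (norm (f x))\<^sup>2)"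

definition truncated_fourier :: "real \<Rightarrow> (real ^ 'n \<Rightarrow> complex) \<Rightarrow> real ^ 'n \<Rightarrow> complex" where
  "truncated_fourier R f y =
     of_real ((2 * pi) powr (- real CARD('n) / 2)) * (LINT x:ball 0 R|lborel. cis (- (y \<bullet> x)) * f x)"

text \<open>The unitary Fourier transform on \<open>L\<^sup>2\<close>, as the \<open>L\<^sup>2\<close>-limit of the transforms of the
  truncations of \<open>f\<close> to balls (which are integrable); with this normalisation \<open>-\<Delta>\<close> is
  multiplication by \<open>|y|\<^sup>2\<close>.\<close>

definition L2_fourier :: "(real ^ 'n \<Rightarrow> complex) \<Rightarrow> (real ^ 'n \<Rightarrow> complex) \<Rightarrow> bool" where
  "L2_fourier f F \<longleftrightarrow> f \<in> L2 \<and> F \<in> L2 \<and>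
     ((\<lambda>R. \<integral>\<^sup>+ y. ennreal ((norm (truncated_fourier R f y - F y))\<^sup>2) \<partial>lborel) \<longlongrightarrow> 0) at_top"

definition fourier_multiplier ::
    "(real ^ 'n \<Rightarrow> real) \<Rightarrow> (real ^ 'n \<Rightarrow> complex) \<Rightarrow> (real ^ 'n \<Rightarrow> complex) \<Rightarrow> bool" where
  "fourier_multiplier \<mu> f g \<longleftrightarrow>
     (\<exists>F G. L2_fourier f F \<and> L2_fourier g G \<and> (AE y in lborel. G y = of_real (\<mu> y) * F y))"

text \<open>The resolvent set consists of the \<open>z\<close> for which \<open>A - z\<close> maps the domain of \<open>A\<close> onto \<open>L\<^sup>2\<close>
  and has a bounded inverse; the norm estimate contains injectivity, since \<open>A\<close> is linear.\<close>

definition resolvent_set ::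
    "((real ^ 'n \<Rightarrow> complex) \<Rightarrow> (real ^ 'n \<Rightarrow> complex) \<Rightarrow> bool) \<Rightarrow> complex set" where
  "resolvent_set A = {z.
     (\<forall>g\<in>L2. \<exists>f h. A f h \<and> (AE x in lborel. h x - z * f x = g x)) \<and>
     (\<exists>K. \<forall>f h. A f h \<longrightarrow> L2_norm f \<le> K * L2_norm (\<lambda>x. h x - z * f x))}"

definition spectrum ::
    "((real ^ 'n \<Rightarrow> complex) \<Rightarrow> (real ^ 'n \<Rightarrow> complex) \<Rightarrow> bool) \<Rightarrow> complex set" where
  "spectrum A = - resolvent_set A"


section \<open>The Schroedinger operator and its ground state\<close>

definition Phi :: "real \<Rightarrow> real \<Rightarrow> real \<Rightarrow> real" where
  "Phi m \<alpha> z = (z + m powr (2 / \<alpha>)) powr (\<alpha> / 2) - m"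

definition L_op ::
    "real \<Rightarrow> real \<Rightarrow> (real ^ 'n \<Rightarrow> complex) \<Rightarrow> (real ^ 'n \<Rightarrow> complex) \<Rightarrow> bool" where
  "L_op m \<alpha> = fourier_multiplier (\<lambda>y. Phi m \<alpha> ((norm y)\<^sup>2))"

text \<open>The semigroup \<open>e\<^bsup>-tL\<^esup>\<close>: functional calculus for a Fourier multiplier operator is
  composition with its symbol.\<close>

definition L_semigroup ::
    "real \<Rightarrow> real \<Rightarrow> real \<Rightarrow> (real ^ 'n \<Rightarrow> complex) \<Rightarrow> (real ^ 'n \<Rightarrow> complex) \<Rightarrow> bool" where
  "L_semigroup m \<alpha> t = fourier_multiplier (\<lambda>y. exp (- t * Phi m \<alpha> ((norm y)\<^sup>2)))"

text \<open>The potential is bounded, so the domain of \<open>H\<close> is that of \<open>L\<close>.\<close>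

definition H_op ::
    "real \<Rightarrow> real \<Rightarrow> real \<Rightarrow> real \<Rightarrow> (real ^ 'n \<Rightarrow> complex) \<Rightarrow> (real ^ 'n \<Rightarrow> complex) \<Rightarrow> bool" where
  "H_op m \<alpha> a v f g \<longleftrightarrow> g \<in> L2 \<and>
     (\<exists>h. L_op m \<alpha> f h \<and> (AE x in lborel. g x = h x - of_real (v * indicator (ball 0 a) x) * f x))"

text \<open>The spectrum of the self-adjoint operator \<open>H\<close> is real, so its infimum is taken in the reals.
  The ground state is the representative and scalar multiple that is bounded, continuous, strictly
  positive and \<open>L\<^sup>2\<close>-normalised.\<close>

definition ground_state ::
    "real \<Rightarrow> real \<Rightarrow> real \<Rightarrow> real \<Rightarrow> real \<Rightarrow> (real ^ 'n \<Rightarrow> real) \<Rightarrow> bool" where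
  "ground_state m \<alpha> a v l \<phi> \<longleftrightarrow>
     l = Inf {r. complex_of_real r
                   \<in> spectrum (H_op m \<alpha> a v :: (real ^ 'n \<Rightarrow> complex) \<Rightarrow> (real ^ 'n \<Rightarrow> complex) \<Rightarrow> bool)} \<and>
     - v < l \<and> l < 0 \<and>
     H_op m \<alpha> a v (\<lambda>x. of_real (\<phi> x)) (\<lambda>x. of_real (l * \<phi> x)) \<and>
     continuous_on UNIV \<phi> \<and> bounded (range \<phi>) \<and> (\<forall>x. 0 < \<phi> x) \<and>
     L2_norm (\<lambda>x. of_real (\<phi> x)) = 1"


section \<open>The Levy process\<close>

definition cadlag :: "(real \<Rightarrow> real ^ 'n) \<Rightarrow> bool" where
  "cadlag \<omega> \<longleftrightarrow> (\<forall>t\<ge>0. (\<omega> \<longlongrightarrow> \<omega> t) (at_right t)) \<and> (\<forall>t>0. \<exists>l. (\<omega> \<longlongrightarrow> l) (at_left t))"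

definition levy_process :: "'w measure \<Rightarrow> (real \<Rightarrow> 'w \<Rightarrow> real ^ 'n) \<Rightarrow> bool" where
  "levy_process M X \<longleftrightarrow>
     prob_space M \<and>
     (\<forall>t\<ge>0. X t \<in> borel_measurable M) \<and>
     (AE \<omega> in M. X 0 \<omega> = 0) \<and>
     (\<forall>(n::nat) (t :: nat \<Rightarrow> real). 0 \<le> t 0 \<longrightarrow> mono t \<longrightarrow>
        prob_space.indep_vars M (\<lambda>_. borel) (\<lambda>i \<omega>. X (t (Suc i)) \<omega> - X (t i) \<omega>) {..<n}) \<and>
     (\<forall>s\<ge>0. \<forall>t\<ge>0. distr M borel (\<lambda>\<omega>. X (s + t) \<omega> - X s \<omega>) = distr M borel (X t)) \<and>
     (AE \<omega> in M. cadlag (\<lambda>t. X t \<omega>))"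

text \<open>\<open>X\<close> starts at \<open>0\<close>; by spatial homogeneity the process under the law started at \<open>x\<close> is
  \<open>x + X\<close>. Hence the equation below says that \<open>x \<mapsto> E\<^sup>x[f(X\<^sub>t)]\<close> is a representative of
  \<open>e\<^bsup>-tL\<^esup>f\<close>.\<close>

definition shifted :: "real ^ 'n \<Rightarrow> (real \<Rightarrow> 'w \<Rightarrow> real ^ 'n) \<Rightarrow> real \<Rightarrow> 'w \<Rightarrow> real ^ 'n" where
  "shifted x X = (\<lambda>t \<omega>. x + X t \<omega>)"

definition levy_process_generated_by_minus_L ::
    "real \<Rightarrow> real \<Rightarrow> 'w measure \<Rightarrow> (real \<Rightarrow> 'w \<Rightarrow> real ^ 'n) \<Rightarrow> bool" where
  "levy_process_generated_by_minus_L m \<alpha> M X \<longleftrightarrow>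
     levy_process M X \<and>
     (\<forall>t\<ge>0. \<forall>f g. L_semigroup m \<alpha> t f g \<longrightarrow>
        (AE x in lborel. (LINT \<omega>|M. f (shifted x X t \<omega>)) = g x))"

definition exit_time :: "real \<Rightarrow> (real \<Rightarrow> 'w \<Rightarrow> real ^ 'n) \<Rightarrow> 'w \<Rightarrow> ereal" where
  "exit_time a Y \<omega> = Inf {ereal t | t. 0 < t \<and> Y t \<omega> \<notin> ball 0 a}"

definition entry_time :: "real \<Rightarrow> (real \<Rightarrow> 'w \<Rightarrow> real ^ 'n) \<Rightarrow> 'w \<Rightarrow> ereal" where
  "entry_time a Y \<omega> = Inf {ereal t | t. 0 < t \<and> Y t \<omega> \<in> ball 0 a}"

fun exp_ereal :: "ereal \<Rightarrow> ennreal" where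
  "exp_ereal (ereal r) = ennreal (exp r)"
| "exp_ereal PInfty = \<infinity>"
| "exp_ereal MInfty = 0"

text \<open>The moments \<open>E\<^sup>x[e\<^bsup>c \<tau>\<^sub>a\<^esup>]\<close> and \<open>E\<^sup>x[e\<^bsup>c T\<^sub>a\<^esup>]\<close>, possibly infinite for
  \<open>c > 0\<close>. The times are in general measurable only up to null sets, to which \<open>nn_integral\<close> is
  insensitive. For \<open>c < 0\<close> the integrand vanishes where the time is infinite.\<close>

definition exit_moment ::
    "'w measure \<Rightarrow> (real \<Rightarrow> 'w \<Rightarrow> real ^ 'n) \<Rightarrow> real \<Rightarrow> real \<Rightarrow> real ^ 'n \<Rightarrow> ennreal" where
  "exit_moment M X a c x = (\<integral>\<^sup>+ \<omega>. exp_ereal (ereal c * exit_time a (shifted x X) \<omega>) \<partial>M)"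

definition entry_moment ::
    "'w measure \<Rightarrow> (real \<Rightarrow> 'w \<Rightarrow> real ^ 'n) \<Rightarrow> real \<Rightarrow> real \<Rightarrow> real ^ 'n \<Rightarrow> ennreal" where
  "entry_moment M X a c x = (\<integral>\<^sup>+ \<omega>. exp_ereal (ereal c * entry_time a (shifted x X) \<omega>) \<partial>M)"

end

theory Submission
  imports Defs
begin

text \<open>
  Write \<open>\<lambda> = |\<lambda>\<^sub>0|\<close>. The eigenvalue equation \<open>(L + \<lambda>)\<phi> = v 1\<^sub>B \<phi>\<close> says that
  \<open>\<phi>(x) = v E\<^sup>x \<integral>\<^sub>0\<^sup>\<infinity> e\<^bsup>-\<lambda>s\<^esup> 1\<^sub>B(X\<^sub>s) \<phi>(X\<^sub>s) ds\<close>; both sides are bounded and continuous with the same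
  \<open>L\<^sup>2\<close> Fourier transform, hence have the same Gaussian averages and agree at every point.

  Outside the ball, the integrand vanishes before the entry time \<open>T\<close>, which bounds \<open>\<phi>\<close> from above by
  a multiple of \<open>E\<^sup>x e\<^bsup>-\<lambda>T\<^esup>\<close>; conversely \<open>e\<^bsup>-\<lambda>t\<^esup> \<phi>(X\<^sub>t)\<close> is a supermartingale, so stopping at the first
  entry along a time grid and refining the grid gives the lower bound.

  Inside the ball \<open>\<phi>\<close> is comparable to a constant and \<open>E\<^sup>x e\<^bsup>(v-\<lambda>)\<tau>\<^esup> \<ge> 1\<close>, so only a uniform upper bound
  for the exit moment is needed. Killing the process on exit makes the above integral smaller by
  a fixed amount, so the killed potential satisfies \<open>v G \<phi> \<le> \<theta> \<lambda> \<phi>\<close> with \<open>\<theta> < 1\<close>; by the renewal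
  identity for \<open>e\<^bsup>(v-\<lambda>)s\<^esup>\<close> this contraction bounds the exit moment.

  The constant does not depend on \<open>\<phi>\<close> and \<open>X\<close>, because the ground state is unique (the process
  visits every open set) and the Gaussian averages of the law of \<open>X\<^sub>t\<close> are determined by the symbol.
\<close>

section \<open>Gaussian averages and Fourier transforms\<close>

text \<open>The process is known only through an almost everywhere identity in \<open>L2\<close>,
  while the claim concerns every starting point. Pointwise information is therefore drawn from the
  characteristic function: its integrability makes the law at each positive time absolutely
  continuous, so the sphere of radius \<open>a\<close> is never charged and the open and the closed
  ball may be exchanged inside a potential. The exchange matters because a right-continuous path
  that is outside a closed set, or inside an open one, remains so for a short while: survival is
  studied in the closed ball, first entry in the open one. This also lets time grids replace
  stopping times, so that the Markov property at fixed times suffices. The fixed loss caused by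
  killing comes from paths lying in the shell between the radii \<open>a\<close> and
  \<open>6 * a\<close> at a suitable time \<open>t0\<close>: they are dead by then, while the
  unkilled integral still collects a discounted multiple of the ground state at the point reached.
  The a priori finiteness that the contraction argument needs is secured by cutting the time
  integral at \<open>N\<close>; the resulting bound is free of \<open>N\<close>.\<close>

lemma integral_lborel_prod:
  fixes f :: "'a::euclidean_space \<Rightarrow> real \<Rightarrow> complex"
  assumes f: "\<And>b. b \<in> Basis \<Longrightarrow> integrable lborel (f b)"
  shows "(LINT x|lborel. (\<Prod>b\<in>Basis. f b (x \<bullet> b))) = (\<Prod>b\<in>Basis. LINT r|lborel. f b r)"
proof -
  interpret product_sigma_finite "\<lambda>_::'a. lborel :: real measure" ..
  have [measurable]: "b \<in> Basis \<Longrightarrow> f b \<in> borel_measurable borel" for b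
    using borel_measurable_integrable[OF f, of b] by simp
  have "(LINT x|lborel. (\<Prod>b\<in>Basis. f b (x \<bullet> b))) =
    (LINT g|(\<Pi>\<^sub>M b\<in>Basis. lborel). (\<Prod>b\<in>Basis. f b ((\<Sum>b\<in>Basis. g b *\<^sub>R b) \<bullet> b)))"
    by (subst lborel_eq) (simp add: integral_distr)
  also have "\<dots> = (LINT g|(\<Pi>\<^sub>M b\<in>Basis. lborel). (\<Prod>b\<in>Basis. f b (g b)))"
    by simp
  also have "\<dots> = (\<Prod>b\<in>Basis. LINT r|lborel. f b r)"
    by (rule product_integral_prod) (auto intro: f)
  finally show ?thesis .
qed

lemma integrable_lborel_prod:
  fixes f :: "'a::euclidean_space \<Rightarrow> real \<Rightarrow> real"
  assumes f: "\<And>b. b \<in> Basis \<Longrightarrow> integrable lborel (f b)"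
  shows "integrable lborel (\<lambda>x::'a. (\<Prod>b\<in>Basis. f b (x \<bullet> b)))"
proof -
  interpret product_sigma_finite "\<lambda>_::'a. lborel :: real measure" ..
  have [measurable]: "b \<in> Basis \<Longrightarrow> f b \<in> borel_measurable borel" for b
    using borel_measurable_integrable[OF f, of b] by simp
  have "integrable (\<Pi>\<^sub>M b\<in>Basis. lborel) (\<lambda>g. (\<Prod>b\<in>Basis. f b ((\<Sum>b\<in>Basis. g b *\<^sub>R b) \<bullet> b)))"
    using product_integrable_prod[of "Basis :: 'a set" f] f by simp
  then show ?thesis
    by (subst lborel_eq, subst integrable_distr_eq) simp_all
qed

section \<open>Gaussian densities and their characteristic functions\<close>

lemma norm_sq_eq_sum: "(norm (x::'a::euclidean_space))\<^sup>2 = (\<Sum>b\<in>Basis. (x \<bullet> b)\<^sup>2)"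
  unfolding power2_norm_eq_inner by (subst euclidean_inner) (simp add: power2_eq_square)

text \<open>Density of the centred normal law with independent coordinates of variance
  \<open>\<epsilon>\<close>; the parameter is the variance, hence \<open>sqrt \<epsilon>\<close>
  wherever \<open>normal_density\<close> is used.\<close>

definition gauss :: "real \<Rightarrow> 'a::euclidean_space \<Rightarrow> real" where
  "gauss \<epsilon> x = exp (- (norm x)\<^sup>2 / (2 * \<epsilon>)) / sqrt (2 * pi * \<epsilon>) ^ DIM('a)"

lemma gauss_nonneg[simp]: "0 \<le> gauss \<epsilon> x" if "\<epsilon> > 0"
  using that by (simp add: gauss_def)

lemma gauss_minus[simp]: "gauss \<epsilon> (- x) = gauss \<epsilon> x"
  by (simp add: gauss_def)

lemma gauss_minus_commute: "gauss \<epsilon> (x - y) = gauss \<epsilon> (y - x)"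
  by (simp add: gauss_def norm_minus_commute)

lemma borel_measurable_gauss[measurable]: "gauss \<epsilon> \<in> borel_measurable borel"
  unfolding gauss_def[abs_def] by measurable

lemma gauss_prod:
  fixes x :: "'a::euclidean_space"
  assumes "\<epsilon> > 0"
  shows "gauss \<epsilon> x = (\<Prod>b\<in>Basis. normal_density 0 (sqrt \<epsilon>) (x \<bullet> b))"
proof -
  have "(\<Prod>b\<in>Basis. normal_density 0 (sqrt \<epsilon>) (x \<bullet> b)) =
    (\<Prod>b\<in>Basis. exp (- (x \<bullet> b)\<^sup>2 / (2 * \<epsilon>)) / sqrt (2 * pi * \<epsilon>))"
    using assms by (simp add: normal_density_def)
  also have "\<dots> = exp (\<Sum>b\<in>Basis. - (x \<bullet> b)\<^sup>2 / (2 * \<epsilon>)) / sqrt (2 * pi * \<epsilon>) ^ DIM('a)"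
    by (simp add: prod_dividef exp_sum)
  also have "(\<Sum>b\<in>Basis. - (x \<bullet> b)\<^sup>2 / (2 * \<epsilon>)) = - (norm x)\<^sup>2 / (2 * \<epsilon>)"
    unfolding sum_divide_distrib[symmetric] sum_negf
    by (simp add: norm_sq_eq_sum)
  finally show ?thesis by (simp add: gauss_def)
qed

lemma integrable_gauss:
  assumes "\<epsilon> > 0"
  shows "integrable lborel (gauss \<epsilon> :: 'a::euclidean_space \<Rightarrow> real)"
proof -
  have "(gauss \<epsilon> :: 'a \<Rightarrow> real) = (\<lambda>x. \<Prod>b\<in>Basis. normal_density 0 (sqrt \<epsilon>) (x \<bullet> b))"
    using assms by (intro ext gauss_prod)
  then show ?thesis
    using assms by (auto intro!: integrable_lborel_prod integrable_normal_density)
qed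

lemma cis_inner_eq_prod:
  fixes x w :: "'a::euclidean_space"
  shows "cis (w \<bullet> x) = (\<Prod>b\<in>Basis. cis ((w \<bullet> b) * (x \<bullet> b)))"
  by (simp add: euclidean_inner[of w x] cis_conv_exp exp_sum sum_distrib_left)

lemma gauss_char_1:
  assumes "\<epsilon> > 0"
  shows "(LINT r|lborel. of_real (normal_density 0 (sqrt \<epsilon>) r) * cis (r * s)) = of_real (exp (- \<epsilon> * s\<^sup>2 / 2))"
proof -
  have "complex_of_real (exp (- (sqrt \<epsilon> * s)\<^sup>2 / 2)) = char std_normal_distribution (sqrt \<epsilon> * s)"
    by (simp add: char_std_normal_distribution)
  also have "\<dots> = (LINT r|lborel. std_normal_density r *\<^sub>R cis (sqrt \<epsilon> * s * r))"
    unfolding char_def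
    by (subst integral_density) (auto simp: normal_density_nonneg cis_conv_exp mult_ac)
  also have "\<dots> = (LINT r|lborel. of_real (std_normal_density r) * cis (sqrt \<epsilon> * s * r))"
    by (simp add: scaleR_conv_of_real)
  also have "\<dots> = \<bar>inverse (sqrt \<epsilon>)\<bar> *\<^sub>R (LINT r|lborel. of_real (std_normal_density (0 + inverse (sqrt \<epsilon>) * r)) * cis (sqrt \<epsilon> * s * (0 + inverse (sqrt \<epsilon>) * r)))"
    by (rule lborel_integral_real_affine) (use assms in auto)
  also have "\<dots> = (LINT r|lborel. of_real (normal_density 0 (sqrt \<epsilon>) r) * cis (r * s))"
    using assms
    by (subst integral_scaleR_right[symmetric], intro Bochner_Integration.integral_cong)
       (auto simp: normal_density_def field_simps real_sqrt_mult power_mult_distrib scaleR_conv_of_real)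
  finally show ?thesis
    using assms by (simp add: power_mult_distrib)
qed

lemma gauss_char:
  fixes x :: "'a::euclidean_space"
  assumes "\<epsilon> > 0"
  shows "(LINT w|lborel. of_real (gauss \<epsilon> w) * cis (w \<bullet> x)) = of_real (exp (- \<epsilon> * (norm x)\<^sup>2 / 2))"
proof -
  have "(LINT w|lborel. of_real (gauss \<epsilon> w) * cis (w \<bullet> x)) =
     (LINT w|lborel. (\<Prod>b\<in>Basis. of_real (normal_density 0 (sqrt \<epsilon>) (w \<bullet> b)) * cis ((w \<bullet> b) * (x \<bullet> b))))"
    using assms by (simp add: gauss_prod cis_inner_eq_prod[of _ x] prod.distrib)
  also have "\<dots> = (\<Prod>b\<in>Basis. (LINT r|lborel. of_real (normal_density 0 (sqrt \<epsilon>) r) * cis (r * (x \<bullet> b))))"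
  proof (rule integral_lborel_prod)
    fix b :: 'a
    have "integrable lborel (\<lambda>r. complex_of_real (normal_density 0 (sqrt \<epsilon>) r))"
      using assms by (auto intro!: integrable_of_real integrable_normal_density)
    then show "integrable lborel (\<lambda>r. complex_of_real (normal_density 0 (sqrt \<epsilon>) r) * cis (r * (x \<bullet> b)))"
      by (rule Bochner_Integration.integrable_bound) (auto simp: norm_mult cis_conv_exp)
  qed
  also have "\<dots> = (\<Prod>b\<in>Basis. of_real (exp (- \<epsilon> * (x \<bullet> b)\<^sup>2 / 2)))"
    using gauss_char_1[OF assms] by simp
  also have "\<dots> = of_real (exp (\<Sum>b\<in>Basis. - \<epsilon> * (x \<bullet> b)\<^sup>2 / 2))"
    by (simp add: exp_sum)
  also have "(\<Sum>b\<in>Basis. - \<epsilon> * (x \<bullet> b)\<^sup>2 / 2) = - \<epsilon> * (norm x)\<^sup>2 / 2"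
    unfolding sum_divide_distrib[symmetric] sum_distrib_left[symmetric]
    by (simp add: norm_sq_eq_sum)
  finally show ?thesis .
qed

lemma integral_gauss: "\<epsilon> > 0 \<Longrightarrow> (LINT w|lborel. gauss \<epsilon> (w :: 'a::euclidean_space)) = 1"
proof -
  assume "\<epsilon> > 0"
  from gauss_char[OF this, of "0::'a"]
  have "complex_of_real (LINT w|lborel. gauss \<epsilon> (w :: 'a)) = 1"
    by (simp flip: integral_of_real)
  then show ?thesis by (metis of_real_eq_1_iff)
qed

lemma nn_integral_gauss: "\<epsilon> > 0 \<Longrightarrow> (\<integral>\<^sup>+w. ennreal (gauss \<epsilon> (w :: 'a::euclidean_space)) \<partial>lborel) = 1"
  by (subst nn_integral_eq_integral) (auto simp: integrable_gauss integral_gauss)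

lemma exp_norm_eq_gauss:
  assumes "\<epsilon> > 0"
  shows "exp (- \<epsilon> * (norm (w::'a::euclidean_space))\<^sup>2 / 2) = sqrt (2 * pi / \<epsilon>) ^ DIM('a) * gauss (1 / \<epsilon>) w"
  using assms by (simp add: gauss_def field_simps power_mult_distrib)

lemma integrable_exp_norm:
  assumes "\<epsilon> > 0"
  shows "integrable lborel (\<lambda>w::'a::euclidean_space. exp (- \<epsilon> * (norm w)\<^sup>2 / 2))"
  unfolding exp_norm_eq_gauss[OF assms] using assms by (simp add: integrable_gauss)

text \<open>The Gaussian factor is itself a multiple of the density of variance
  \<open>1 / \<epsilon>\<close>, so inversion is the computation of the characteristic function read
  backwards; the constants combine to \<open>(2 * pi) ^ DIM('a)\<close>.\<close>

lemma gauss_inversion: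
  fixes x :: "'a::euclidean_space"
  assumes "\<epsilon> > 0"
  shows "(LINT w|lborel. of_real (exp (- \<epsilon> * (norm w)\<^sup>2 / 2)) * cis (w \<bullet> x)) = of_real ((2 * pi) ^ DIM('a) * gauss \<epsilon> x)"
proof -
  have "(LINT w|lborel. of_real (exp (- \<epsilon> * (norm w)\<^sup>2 / 2)) * cis (w \<bullet> x)) =
     of_real (sqrt (2 * pi / \<epsilon>) ^ DIM('a)) * (LINT w|lborel. of_real (gauss (1 / \<epsilon>) w) * cis (w \<bullet> x))"
    unfolding exp_norm_eq_gauss[OF assms] by (subst integral_mult_right_zero[symmetric]) (simp add: mult_ac)
  also have "\<dots> = of_real (sqrt (2 * pi / \<epsilon>) ^ DIM('a) * exp (- (norm x)\<^sup>2 / (2 * \<epsilon>)))"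
    by (subst gauss_char) (use assms in auto)
  also have "sqrt (2 * pi / \<epsilon>) = 2 * pi / sqrt (2 * pi * \<epsilon>)"
    using assms by (auto simp: real_sqrt_divide real_sqrt_mult field_simps)
  finally show ?thesis by (simp add: gauss_def power_divide)
qed

text \<open>Fatou's lemma for integrals with a common bound. Measurability is asked of the
  approximants only, so the estimate applies to functions of entry times that lie below a lower
  limit of measurable grid quantities.\<close>

lemma nn_integral_le_of_tendsto:
  fixes u :: "nat \<Rightarrow> 'a \<Rightarrow> ennreal"
  assumes [measurable]: "\<And>n. u n \<in> borel_measurable M"
    and b: "\<And>n. (\<integral>\<^sup>+x. u n x \<partial>M) \<le> b"
    and lim: "\<And>x. x \<in> space M \<Longrightarrow> f x \<le> liminf (\<lambda>n. u n x)"
  shows "(\<integral>\<^sup>+x. f x \<partial>M) \<le> b"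
proof -
  have "(\<integral>\<^sup>+x. f x \<partial>M) \<le> (\<integral>\<^sup>+x. liminf (\<lambda>n. u n x) \<partial>M)"
    using lim by (rule nn_integral_mono)
  also have "\<dots> \<le> liminf (\<lambda>n. \<integral>\<^sup>+x. u n x \<partial>M)"
    by (rule nn_integral_liminf) simp
  also have "\<dots> \<le> b"
    by (rule Liminf_le) (use b in auto)
  finally show ?thesis .
qed

text \<open>Fubini applies because the integrand is dominated by
  \<open>norm (A w) * norm (h x)\<close>. In the applications \<open>K\<close> is a Fourier kernel
  \<open>cis\<close>, and the swap moves the transform from one factor to the other.\<close>

lemma integral_swap_bounded_kernel:
  fixes A :: "'a \<Rightarrow> complex" and h :: "'b \<Rightarrow> complex" and K :: "'a \<Rightarrow> 'b \<Rightarrow> complex"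
  assumes "sigma_finite_measure M" "sigma_finite_measure N"
    and A: "integrable M A" and h: "integrable N h"
    and K[measurable]: "case_prod K \<in> borel_measurable (M \<Otimes>\<^sub>M N)"
    and K1: "\<And>w x. norm (K w x) \<le> 1"
  shows "(LINT w|M. A w * (LINT x|N. K w x * h x)) = (LINT x|N. h x * (LINT w|M. K w x * A w))"
proof -
  interpret M: sigma_finite_measure M by fact
  interpret N: sigma_finite_measure N by fact
  interpret pair_sigma_finite M N ..
  have [measurable]: "A \<in> borel_measurable M" "h \<in> borel_measurable N" using A h by auto
  have "integrable (M \<Otimes>\<^sub>M N) (\<lambda>(w, x). A w * (K w x * h x))"
  proof (rule Fubini_integrable)
    show "(\<lambda>(w, x). A w * (K w x * h x)) \<in> borel_measurable (M \<Otimes>\<^sub>M N)" by measurable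
    have Kh: "integrable N (\<lambda>x. K w x * h x)" if "w \<in> space M" for w
      by (rule Bochner_Integration.integrable_bound[OF h])
         (use that K1 in \<open>auto simp: norm_mult mult_left_le_one_le\<close>)
    then show "AE w in M. integrable N (\<lambda>x. case (w, x) of (w, x) \<Rightarrow> A w * (K w x * h x))" by auto
    have bd: "(LINT x|N. norm (A w * (K w x * h x))) \<le> norm (A w) * (LINT x|N. norm (h x))" if "w \<in> space M" for w
      unfolding norm_mult[of "A w"]
      by (subst integral_mult_right_zero)
         (intro mult_left_mono integral_mono integrable_norm Kh h that;
          use K1 in \<open>auto simp: norm_mult mult_left_le_one_le\<close>)
    show "integrable M (\<lambda>w. LINT x|N. norm (case (w, x) of (w, x) \<Rightarrow> A w * (K w x * h x)))"
      unfolding split_beta fst_conv snd_conv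
    proof (rule Bochner_Integration.integrable_bound[where f="\<lambda>w. norm (A w) * (LINT x|N. norm (h x))"])
      show "integrable M (\<lambda>w. norm (A w) * (LINT x|N. norm (h x)))" using A by auto
      show "(\<lambda>w. LINT x|N. norm (A w * (K w x * h x))) \<in> borel_measurable M" by measurable
      show "AE w in M. norm (LINT x|N. norm (A w * (K w x * h x))) \<le> norm (norm (A w) * (LINT x|N. norm (h x)))"
        using bd by (intro AE_I2) (auto simp: abs_mult)
    qed
  qed
  from Fubini_integral[OF this]
  have "(LINT w|M. LINT x|N. A w * (K w x * h x)) = (LINT x|N. LINT w|M. A w * (K w x * h x))"
    by simp
  also have "(\<lambda>x. LINT w|M. A w * (K w x * h x)) = (\<lambda>x. h x * (LINT w|M. K w x * A w))"
    by (subst integral_mult_right_zero[symmetric]) (simp add: mult_ac)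
  finally show ?thesis by simp
qed

text \<open>Regularised Fourier inversion for the complex measure with density \<open>h\<close> with
  respect to \<open>N\<close>: damping its transform by a Gaussian and inverting gives its
  convolution with \<open>gauss \<epsilon>\<close>. With \<open>N = lborel\<close> it serves
  functions, with \<open>h = 1\<close> it serves probability laws.\<close>

lemma gauss_smoothing:
  fixes h :: "'a::euclidean_space \<Rightarrow> complex"
  assumes e: "\<epsilon> > 0" and N: "sigma_finite_measure N" "sets N = sets borel" and h: "integrable N h"
  shows "(LINT w|lborel. (of_real (exp (- \<epsilon> * (norm w)\<^sup>2 / 2)) * cis (w \<bullet> z)) * (LINT x|N. cis (- (w \<bullet> x)) * h x))
     = of_real ((2 * pi) ^ DIM('a)) * (LINT x|N. of_real (gauss \<epsilon> (z - x)) * h x)"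
proof -
  note [measurable_cong] = N(2)
  have "(LINT w|lborel. (of_real (exp (- \<epsilon> * (norm w)\<^sup>2 / 2)) * cis (w \<bullet> z)) * (LINT x|N. cis (- (w \<bullet> x)) * h x))
    = (LINT x|N. h x * (LINT w|lborel. cis (- (w \<bullet> x)) * (of_real (exp (- \<epsilon> * (norm w)\<^sup>2 / 2)) * cis (w \<bullet> z))))"
  proof (rule integral_swap_bounded_kernel)
    have "integrable lborel (\<lambda>w::'a. complex_of_real (exp (- \<epsilon> * (norm w)\<^sup>2 / 2)))"
      by (rule integrable_of_real, rule integrable_exp_norm[OF e])
    then show "integrable lborel (\<lambda>w::'a. complex_of_real (exp (- \<epsilon> * (norm w)\<^sup>2 / 2)) * cis (w \<bullet> z))"
      by (rule Bochner_Integration.integrable_bound) (auto simp: norm_mult cis_conv_exp)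
    show "(\<lambda>(w, x). cis (- (w \<bullet> x))) \<in> borel_measurable (lborel \<Otimes>\<^sub>M N)"
      unfolding cis_conv_exp by measurable
  qed (auto intro: N h lborel.sigma_finite_measure_axioms)
  also have "(\<lambda>x. LINT w|lborel. cis (- (w \<bullet> x)) * (of_real (exp (- \<epsilon> * (norm w)\<^sup>2 / 2)) * cis (w \<bullet> z)))
    = (\<lambda>x. LINT w|lborel. of_real (exp (- \<epsilon> * (norm w)\<^sup>2 / 2)) * cis (w \<bullet> (z - x)))"
    by (intro ext Bochner_Integration.integral_cong refl)
       (simp add: inner_diff_right cis_mult mult.assoc mult.left_commute[of "cis _" "of_real _"] add.commute)
  also have "\<dots> = (\<lambda>x. of_real ((2 * pi) ^ DIM('a) * gauss \<epsilon> (z - x)))"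
    using gauss_inversion[OF e, where 'a='a] by simp
  also have "(LINT x|N. h x * complex_of_real ((2 * pi) ^ DIM('a) * gauss \<epsilon> (z - x))) = of_real ((2 * pi) ^ DIM('a)) * (LINT x|N. of_real (gauss \<epsilon> (z - x)) * h x)"
    by (subst integral_mult_right_zero[symmetric]) (simp add: mult_ac)
  finally show ?thesis .
qed

section \<open>The Fourier transform of integrable functions and the Plancherel inequality\<close>

definition ft :: "(real ^ 'n \<Rightarrow> complex) \<Rightarrow> real ^ 'n \<Rightarrow> complex" where
  "ft f y = of_real ((2 * pi) powr (- real CARD('n) / 2)) * (LINT x|lborel. cis (- (y \<bullet> x)) * f x)"

lemma ft_const_sq: "((2 * pi) powr (- real CARD('n::finite) / 2))\<^sup>2 = 1 / (2 * pi) ^ CARD('n)"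
proof -
  have "((2 * pi) powr (- real CARD('n) / 2))\<^sup>2 = (2 * pi) powr (- real CARD('n))"
    by (simp add: power2_eq_square flip: powr_add)
  then show ?thesis by (simp add: powr_minus powr_realpow field_simps)
qed

lemma borel_measurable_cis[measurable (raw)]:
  "f \<in> borel_measurable M \<Longrightarrow> (\<lambda>x. cis (f x)) \<in> borel_measurable M"
  unfolding cis_conv_exp by measurable

lemma borel_measurable_ft[measurable]:
  fixes f :: "real ^ 'n::finite \<Rightarrow> complex"
  assumes [measurable]: "f \<in> borel_measurable lborel"
  shows "ft f \<in> borel_measurable borel"
proof -
  have "(\<lambda>y. LINT x|lborel. cis (- (y \<bullet> x)) * f x) \<in> borel_measurable borel"
    by (rule lborel.borel_measurable_lebesgue_integral) measurable
  then show ?thesis unfolding ft_def[abs_def] by measurable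
qed

lemma integrable_cis_mult:
  fixes f :: "'a \<Rightarrow> complex"
  assumes "integrable M f" "g \<in> borel_measurable M"
  shows "integrable M (\<lambda>x. cis (g x) * f x)"
  by (rule Bochner_Integration.integrable_bound[OF assms(1)]) (use assms in \<open>auto simp: norm_mult\<close>)

lemma ft_diff:
  fixes f g :: "real ^ 'n::finite \<Rightarrow> complex"
  assumes "integrable lborel f" "integrable lborel g"
  shows "ft (\<lambda>x. f x - g x) y = ft f y - ft g y"
  unfolding ft_def using assms
  by (simp add: integrable_cis_mult right_diff_distrib)

lemma norm_ft_le:
  fixes f :: "real ^ 'n::finite \<Rightarrow> complex"
  assumes f: "integrable lborel f"
  shows "norm (ft f y) \<le> (2 * pi) powr (- real CARD('n) / 2) * (LINT x|lborel. norm (f x))"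
proof -
  have "norm (LINT x|lborel. cis (- (y \<bullet> x)) * f x) \<le> (LINT x|lborel. norm (f x))"
    using integral_norm_bound[of lborel "\<lambda>x. cis (- (y \<bullet> x)) * f x"] by (simp add: norm_mult)
  then show ?thesis by (simp add: ft_def norm_mult mult_left_mono)
qed

lemma nn_integral_gauss_shift: "\<epsilon> > 0 \<Longrightarrow> (\<integral>\<^sup>+w. ennreal (gauss \<epsilon> (z - w :: 'a::euclidean_space)) \<partial>lborel) = 1"
proof -
  assume e: "\<epsilon> > 0"
  have "(\<integral>\<^sup>+w. ennreal (gauss \<epsilon> (w::'a)) \<partial>lborel) = (\<integral>\<^sup>+w. ennreal (gauss \<epsilon> w) \<partial>distr lborel borel (\<lambda>x. z + (-1) *\<^sub>R x))"
    by (subst lborel_affine[of "-1" z]) (simp_all add: nn_integral_density)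
  then show ?thesis
    by (simp add: nn_integral_distr nn_integral_gauss[OF e])
qed

text \<open>Schur's test: \<open>2 * norm (f x) * norm (f y)\<close> is at most the sum of the two
  squares, and the kernel has mass one in either variable.\<close>

lemma gauss_quadratic_form_le:
  fixes f :: "'a::euclidean_space \<Rightarrow> complex"
  assumes e: "\<epsilon> > 0" and [measurable]: "f \<in> borel_measurable borel"
  shows "(\<integral>\<^sup>+x. ennreal (norm (f x)) * (\<integral>\<^sup>+y. ennreal (gauss \<epsilon> (x - y) * norm (f y)) \<partial>lborel) \<partial>lborel)
    \<le> (\<integral>\<^sup>+x. ennreal ((norm (f x))\<^sup>2) \<partial>lborel)"
proof -
  let ?g = "\<lambda>x y. ennreal (gauss \<epsilon> (x - y :: 'a))"
  let ?F = "\<lambda>x. ennreal ((norm (f x))\<^sup>2 / 2)"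
  have "(\<integral>\<^sup>+x. ennreal (norm (f x)) * (\<integral>\<^sup>+y. ennreal (gauss \<epsilon> (x - y) * norm (f y)) \<partial>lborel) \<partial>lborel)
     = (\<integral>\<^sup>+x. \<integral>\<^sup>+y. ennreal (gauss \<epsilon> (x - y) * (norm (f x) * norm (f y))) \<partial>lborel \<partial>lborel)"
    by (subst nn_integral_cmult[symmetric]) (auto simp: ennreal_mult'[symmetric] e mult_ac intro!: nn_integral_cong)
  also have "\<dots> \<le> (\<integral>\<^sup>+x. \<integral>\<^sup>+y. ?F x * ?g x y + ?F y * ?g x y \<partial>lborel \<partial>lborel)"
  proof (intro nn_integral_mono)
    fix x y :: 'a
    have "norm (f x) * norm (f y) \<le> (norm (f x))\<^sup>2 / 2 + (norm (f y))\<^sup>2 / 2"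
      using sum_squares_bound[of "norm (f x)" "norm (f y)"] by simp
    then have "gauss \<epsilon> (x - y) * (norm (f x) * norm (f y)) \<le> gauss \<epsilon> (x - y) * ((norm (f x))\<^sup>2 / 2 + (norm (f y))\<^sup>2 / 2)"
      by (rule mult_left_mono) (simp add: e)
    then show "ennreal (gauss \<epsilon> (x - y) * (norm (f x) * norm (f y))) \<le> ?F x * ?g x y + ?F y * ?g x y"
      by (simp add: e ring_distribs mult_ac flip: ennreal_mult' ennreal_plus)
  qed
  also have "\<dots> = (\<integral>\<^sup>+x. \<integral>\<^sup>+y. ?F x * ?g x y \<partial>lborel \<partial>lborel) + (\<integral>\<^sup>+x. \<integral>\<^sup>+y. ?F y * ?g x y \<partial>lborel \<partial>lborel)"
    by (simp add: nn_integral_add)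
  also have "(\<integral>\<^sup>+x. \<integral>\<^sup>+y. ?F y * ?g x y \<partial>lborel \<partial>lborel) = (\<integral>\<^sup>+y. \<integral>\<^sup>+x. ?F y * ?g x y \<partial>lborel \<partial>lborel)"
    by (rule lborel_pair.Fubini') measurable
  also have "\<dots> = (\<integral>\<^sup>+y. ?F y \<partial>lborel)"
    by (simp add: nn_integral_cmult nn_integral_gauss_shift[OF e] gauss_minus_commute[of \<epsilon> _ "_::'a"] cong: nn_integral_cong)
  also have "(\<integral>\<^sup>+x. \<integral>\<^sup>+y. ?F x * ?g x y \<partial>lborel \<partial>lborel) = (\<integral>\<^sup>+y. ?F y \<partial>lborel)"
    by (simp add: nn_integral_cmult nn_integral_gauss_shift[OF e])
  also have "(\<integral>\<^sup>+y. ?F y \<partial>lborel) + (\<integral>\<^sup>+y. ?F y \<partial>lborel) = (\<integral>\<^sup>+y. ?F y + ?F y \<partial>lborel)"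
    by (rule nn_integral_add[symmetric]) auto
  finally show ?thesis by (simp flip: ennreal_plus)
qed

lemma sets_ball[measurable]: "ball z r \<in> sets borel"
  by (rule borel_open[OF open_ball])

lemma integrable_exp_norm_mult:
  fixes f :: "'a::euclidean_space \<Rightarrow> complex"
  assumes "\<epsilon> > 0" "f \<in> borel_measurable borel" "\<And>x. norm (f x) \<le> b"
  shows "integrable lborel (\<lambda>w. of_real (exp (- \<epsilon> * (norm w)\<^sup>2 / 2)) * f w)"
proof (rule Bochner_Integration.integrable_bound)
  show "integrable lborel (\<lambda>w::'a. b * exp (- \<epsilon> * (norm w)\<^sup>2 / 2))"
    using integrable_exp_norm[OF assms(1)] by (rule integrable_mult_right)
  have "0 \<le> b" using norm_ge_zero assms(3) by (rule order_trans)
  with assms(3) show "AE x in lborel. norm (of_real (exp (- \<epsilon> * (norm x)\<^sup>2 / 2)) * f x) \<le> norm (b * exp (- \<epsilon> * (norm x)\<^sup>2 / 2))"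
    by (auto simp: norm_mult abs_mult mult.commute)
qed (use assms in measurable)

text \<open>The Plancherel identity for the damped transform: one factor is expanded as an integral,
  the order of integration is exchanged, and \<open>gauss_smoothing\<close> identifies the inner
  integral. The damping is what makes the exchange absolutely convergent, since \<open>ft f\<close>
  is a priori only bounded.\<close>

lemma ft_gauss_quadratic:
  fixes f :: "real ^ 'n::finite \<Rightarrow> complex"
  assumes e: "\<epsilon> > 0" and f: "integrable lborel f"
  shows "complex_of_real (LINT y|lborel. exp (- \<epsilon> * (norm y)\<^sup>2 / 2) * (norm (ft f y))\<^sup>2)
    = (LINT x|lborel. cnj (f x) * (LINT y|lborel. of_real (gauss \<epsilon> (x - y)) * f y))"
proof -
  have [measurable]: "f \<in> borel_measurable borel" using f by auto
  define k where "k = (2 * pi) powr (- real CARD('n) / 2)"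
  have k2: "k * k * (2 * pi) ^ CARD('n) = 1"
    using ft_const_sq[where 'n='n] by (simp add: k_def power2_eq_square)
  let ?E = "\<lambda>y. complex_of_real (exp (- \<epsilon> * (norm (y::real^'n))\<^sup>2 / 2))"
  have fc: "cnj (ft f y) = of_real k * (LINT x|lborel. cis (y \<bullet> x) * cnj (f x))" for y
    using Bochner_Integration.integral_cnj[of lborel "\<lambda>x. cis (- (y \<bullet> x)) * f x"]
    by (simp add: ft_def k_def cis_cnj)
  have sq: "?E y * of_real ((norm (ft f y))\<^sup>2) = of_real k * ((?E y * ft f y) * (LINT x|lborel. cis (y \<bullet> x) * cnj (f x)))" for y
    unfolding complex_norm_square fc by (simp add: mult_ac)
  have "complex_of_real (LINT y|lborel. exp (- \<epsilon> * (norm y)\<^sup>2 / 2) * (norm (ft f y))\<^sup>2)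
     = (LINT y|lborel. ?E y * of_real ((norm (ft f y))\<^sup>2))"
    by (simp flip: integral_complex_of_real)
  also have "\<dots> = of_real k * (LINT y|lborel. (?E y * ft f y) * (LINT x|lborel. cis (y \<bullet> x) * cnj (f x)))"
    unfolding sq by (rule integral_mult_right_zero)
  also have "(LINT y|lborel. (?E y * ft f y) * (LINT x|lborel. cis (y \<bullet> x) * cnj (f x)))
    = (LINT x|lborel. cnj (f x) * (LINT y|lborel. cis (y \<bullet> x) * (?E y * ft f y)))"
  proof (rule integral_swap_bounded_kernel)
    show "integrable lborel (\<lambda>y. ?E y * ft f y)"
      by (rule integrable_exp_norm_mult[OF e _ norm_ft_le[OF f]]) simp
  qed (use f in \<open>auto intro: lborel.sigma_finite_measure_axioms\<close>)
  also have "\<dots> = (LINT x|lborel. cnj (f x) * (of_real (k * (2 * pi) ^ CARD('n)) * (LINT y|lborel. of_real (gauss \<epsilon> (x - y)) * f y)))"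
  proof (intro Bochner_Integration.integral_cong refl arg_cong2[where f="(*)"])
    fix x :: "real ^ 'n"
    have "(LINT y|lborel. cis (y \<bullet> x) * (?E y * ft f y)) = of_real k * (LINT y|lborel. (?E y * cis (y \<bullet> x)) * (LINT z|lborel. cis (- (y \<bullet> z)) * f z))"
      by (subst integral_mult_right_zero[symmetric]) (simp add: ft_def k_def mult_ac)
    also have "\<dots> = of_real k * (of_real ((2 * pi) ^ CARD('n)) * (LINT y|lborel. of_real (gauss \<epsilon> (x - y)) * f y))"
      by (subst gauss_smoothing[OF e lborel.sigma_finite_measure_axioms _ f]) simp_all
    finally show "(LINT y|lborel. cis (y \<bullet> x) * (?E y * ft f y)) = of_real (k * (2 * pi) ^ CARD('n)) * (LINT y|lborel. of_real (gauss \<epsilon> (x - y)) * f y)"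
      by simp
  qed
  also have "\<dots> = of_real (k * (2 * pi) ^ CARD('n)) * (LINT x|lborel. cnj (f x) * (LINT y|lborel. of_real (gauss \<epsilon> (x - y)) * f y))"
    by (subst integral_mult_right_zero[symmetric]) (simp add: mult_ac)
  finally show ?thesis using k2
    by (simp add: mult.assoc[symmetric] flip: of_real_mult of_real_power)
qed

lemma norm_lebesgue_integral_le:
  fixes f :: "'a \<Rightarrow> 'b::{banach, second_countable_topology}"
  shows "ennreal (norm (LINT x|M. f x)) \<le> (\<integral>\<^sup>+x. ennreal (norm (f x)) \<partial>M)"
  by (cases "integrable M f")
     (auto simp: integral_norm_bound_ennreal not_integrable_integral_eq)

text \<open>The damped integral equals a Gaussian quadratic form in \<open>f\<close>, which is at
  most the squared norm, and Fatou removes the damping. The inequality turns \<open>L2\<close>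
  convergence of truncations into \<open>L2\<close> convergence of their transforms.\<close>

lemma plancherel_le:
  fixes f :: "real ^ 'n::finite \<Rightarrow> complex"
  assumes f: "integrable lborel f"
  shows "(\<integral>\<^sup>+y. ennreal ((norm (ft f y))\<^sup>2) \<partial>lborel) \<le> (\<integral>\<^sup>+x. ennreal ((norm (f x))\<^sup>2) \<partial>lborel)"
proof -
  have [measurable]: "f \<in> borel_measurable borel" using f by auto
  have e: "(\<integral>\<^sup>+y. ennreal (exp (- \<epsilon> * (norm y)\<^sup>2 / 2) * (norm (ft f y))\<^sup>2) \<partial>lborel) \<le> (\<integral>\<^sup>+x. ennreal ((norm (f x))\<^sup>2) \<partial>lborel)"
    if e: "\<epsilon> > 0" for \<epsilon>
  proof -
    define b where "b = (2 * pi) powr (- real CARD('n) / 2) * (LINT x|lborel. norm (f x))"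
    have b: "norm (ft f y) \<le> b" for y unfolding b_def by (rule norm_ft_le[OF f])
    have "integrable lborel (\<lambda>y. complex_of_real (exp (- \<epsilon> * (norm y)\<^sup>2 / 2)) * of_real ((norm (ft f y))\<^sup>2))"
      by (rule integrable_exp_norm_mult[OF e, where b="b\<^sup>2"]) (use b in \<open>auto intro!: power_mono simp: norm_power\<close>)
    then have int: "integrable lborel (\<lambda>y. exp (- \<epsilon> * (norm y)\<^sup>2 / 2) * (norm (ft f y))\<^sup>2)"
      unfolding of_real_mult[symmetric] complex_of_real_integrable_eq .
    have "(\<integral>\<^sup>+y. ennreal (exp (- \<epsilon> * (norm y)\<^sup>2 / 2) * (norm (ft f y))\<^sup>2) \<partial>lborel)
      = ennreal (LINT y|lborel. exp (- \<epsilon> * (norm y)\<^sup>2 / 2) * (norm (ft f y))\<^sup>2)"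
      by (rule nn_integral_eq_integral[OF int]) auto
    also have "(LINT y|lborel. exp (- \<epsilon> * (norm y)\<^sup>2 / 2) * (norm (ft f y))\<^sup>2) =
        norm (complex_of_real (LINT y|lborel. exp (- \<epsilon> * (norm y)\<^sup>2 / 2) * (norm (ft f y))\<^sup>2))"
      unfolding norm_of_real by (intro abs_of_nonneg[symmetric] integral_nonneg) auto
    also have "\<dots> = norm (LINT x|lborel. cnj (f x) * (LINT y|lborel. of_real (gauss \<epsilon> (x - y)) * f y))"
      unfolding ft_gauss_quadratic[OF e f] ..
    also have "ennreal \<dots> \<le> (\<integral>\<^sup>+x. ennreal (norm (f x)) * (\<integral>\<^sup>+y. ennreal (gauss \<epsilon> (x - y) * norm (f y)) \<partial>lborel) \<partial>lborel)"
    proof (rule order_trans[OF norm_lebesgue_integral_le], intro nn_integral_mono)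
      fix x
      have "ennreal (norm (LINT y|lborel. of_real (gauss \<epsilon> (x - y)) * f y)) \<le> (\<integral>\<^sup>+y. ennreal (gauss \<epsilon> (x - y) * norm (f y)) \<partial>lborel)"
        using norm_lebesgue_integral_le[of lborel "\<lambda>y. of_real (gauss \<epsilon> (x - y)) * f y"] e by (simp add: norm_mult)
      then show "ennreal (norm (cnj (f x) * (LINT y|lborel. of_real (gauss \<epsilon> (x - y)) * f y)))
         \<le> ennreal (norm (f x)) * (\<integral>\<^sup>+y. ennreal (gauss \<epsilon> (x - y) * norm (f y)) \<partial>lborel)"
        by (simp add: norm_mult ennreal_mult' mult_left_mono)
    qed
    also have "\<dots> \<le> (\<integral>\<^sup>+x. ennreal ((norm (f x))\<^sup>2) \<partial>lborel)"
      by (rule gauss_quadratic_form_le[OF e]) simp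
    finally show ?thesis .
  qed
  show ?thesis
  proof (rule nn_integral_le_of_tendsto)
    fix n :: nat
    show "(\<integral>\<^sup>+y. ennreal (exp (- (1 / real (Suc n)) * (norm y)\<^sup>2 / 2) * (norm (ft f y))\<^sup>2) \<partial>lborel) \<le> (\<integral>\<^sup>+x. ennreal ((norm (f x))\<^sup>2) \<partial>lborel)"
      by (rule e) simp
    show "(\<lambda>y. ennreal (exp (- (1 / real (Suc n)) * (norm y)\<^sup>2 / 2) * (norm (ft f y))\<^sup>2)) \<in> borel_measurable lborel"
      by measurable
  next
    fix y :: "real ^ 'n"
    have "(\<lambda>n. ennreal (exp (- (1 / real (Suc n)) * (norm y)\<^sup>2 / 2) * (norm (ft f y))\<^sup>2)) \<longlonglongrightarrow> ennreal (exp (- 0 * (norm y)\<^sup>2 / 2) * (norm (ft f y))\<^sup>2)"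
      by (intro tendsto_intros LIMSEQ_Suc lim_1_over_n) auto
    from lim_imp_Liminf[OF _ this]
    show "ennreal ((norm (ft f y))\<^sup>2) \<le> liminf (\<lambda>n. ennreal (exp (- (1 / real (Suc n)) * (norm y)\<^sup>2 / 2) * (norm (ft f y))\<^sup>2))"
      by simp
  qed
qed

section \<open>Square integrable functions and the Fourier transform as a limit of
  truncations\<close>

lemma ennreal_norm_add_sq_le:
  fixes a b :: complex
  shows "ennreal ((norm (a + b))\<^sup>2) \<le> 2 * ennreal ((norm a)\<^sup>2) + 2 * ennreal ((norm b)\<^sup>2)"
proof -
  have "(norm (a + b))\<^sup>2 \<le> (norm a + norm b)\<^sup>2"
    by (intro power_mono norm_triangle_ineq) simp
  also have "\<dots> \<le> 2 * (norm a)\<^sup>2 + 2 * (norm b)\<^sup>2"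
    using sum_squares_bound[of "norm a" "norm b"] by (simp add: power2_sum)
  finally have "ennreal ((norm (a + b))\<^sup>2) \<le> ennreal (2 * (norm a)\<^sup>2 + 2 * (norm b)\<^sup>2)"
    by (rule ennreal_leI)
  then show ?thesis by (simp add: ennreal_mult ennreal_plus)
qed

lemma nn_integral_norm_add_sq_le:
  fixes f g :: "'a \<Rightarrow> complex"
  assumes [measurable]: "f \<in> borel_measurable M" "g \<in> borel_measurable M"
  shows "(\<integral>\<^sup>+x. ennreal ((norm (f x + g x))\<^sup>2) \<partial>M) \<le>
     2 * (\<integral>\<^sup>+x. ennreal ((norm (f x))\<^sup>2) \<partial>M) + 2 * (\<integral>\<^sup>+x. ennreal ((norm (g x))\<^sup>2) \<partial>M)"
proof -
  have "(\<integral>\<^sup>+x. ennreal ((norm (f x + g x))\<^sup>2) \<partial>M) \<le> (\<integral>\<^sup>+x. 2 * ennreal ((norm (f x))\<^sup>2) + 2 * ennreal ((norm (g x))\<^sup>2) \<partial>M)"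
    by (intro nn_integral_mono ennreal_norm_add_sq_le)
  then show ?thesis by (simp add: nn_integral_add nn_integral_cmult)
qed

lemma L2_iff: "f \<in> L2 \<longleftrightarrow> f \<in> borel_measurable borel \<and> (\<integral>\<^sup>+x. ennreal ((norm (f x))\<^sup>2) \<partial>lborel) < \<infinity>"
proof -
  have "f \<in> borel_measurable borel \<Longrightarrow> (\<lambda>x. (norm (f x))\<^sup>2) \<in> borel_measurable lborel" by measurable
  then show ?thesis by (auto simp: L2_def integrable_iff_bounded norm_power)
qed

lemma L2_add:
  assumes "f \<in> L2" "g \<in> L2"
  shows "(\<lambda>x. f x + g x) \<in> L2"
proof -
  have [measurable]: "f \<in> borel_measurable borel" "g \<in> borel_measurable borel" using assms by (auto simp: L2_iff)
  have "2 * (\<integral>\<^sup>+x. ennreal ((norm (f x))\<^sup>2) \<partial>lborel) + 2 * (\<integral>\<^sup>+x. ennreal ((norm (g x))\<^sup>2) \<partial>lborel) < \<infinity>"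
    using assms by (simp add: L2_iff ennreal_mult_less_top)
  then show ?thesis
    using nn_integral_norm_add_sq_le[of f lborel g] unfolding L2_iff
    by (auto intro: le_less_trans)
qed

lemma L2_cmult:
  assumes "f \<in> L2" shows "(\<lambda>x. c * f x) \<in> L2"
proof -
  have [measurable]: "f \<in> borel_measurable borel" using assms by (auto simp: L2_iff)
  have "(\<integral>\<^sup>+x. ennreal ((norm (c * f x))\<^sup>2) \<partial>lborel) = ennreal ((norm c)\<^sup>2) * (\<integral>\<^sup>+x. ennreal ((norm (f x))\<^sup>2) \<partial>lborel)"
    by (subst nn_integral_cmult[symmetric]) (auto simp: norm_mult power_mult_distrib ennreal_mult)
  then show ?thesis
    using assms by (simp add: L2_iff ennreal_mult_less_top)
qed

lemma truncated_fourier_eq: "truncated_fourier R f = ft (\<lambda>x. indicator (ball 0 R) x *\<^sub>R f x)"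
  by (simp add: truncated_fourier_def ft_def[abs_def] fun_eq_iff set_lebesgue_integral_def)

lemma L2_integrable_ball:
  fixes f :: "real ^ 'n::finite \<Rightarrow> complex"
  assumes "f \<in> L2"
  shows "integrable lborel (\<lambda>x. indicator (ball 0 R) x *\<^sub>R f x)"
proof (rule Bochner_Integration.integrable_bound)
  have [measurable]: "f \<in> borel_measurable borel" using assms by (auto simp: L2_iff)
  show "integrable lborel (\<lambda>x. indicator (ball 0 R) x + (norm (f x))\<^sup>2)"
    using assms by (auto simp: L2_def intro!: Bochner_Integration.integrable_add integrable_real_indicator emeasure_lborel_ball_finite)
  show "AE x in lborel. norm (indicator (ball 0 R) x *\<^sub>R f x) \<le> norm (indicator (ball 0 R) x + (norm (f x))\<^sup>2)"
  proof (intro AE_I2)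
    fix x :: "real ^ 'n"
    have "2 * norm (f x) \<le> 1 + (norm (f x))\<^sup>2" using sum_squares_bound[of 1 "norm (f x)"] by simp
    then have "norm (f x) \<le> 1 + (norm (f x))\<^sup>2" using zero_le_power2[of "norm (f x)"] by linarith
    then show "norm (indicator (ball 0 R) x *\<^sub>R f x) \<le> norm (indicator (ball 0 R) x + (norm (f x))\<^sup>2)"
      by (auto simp: indicator_def)
  qed
  show "(\<lambda>x. indicator (ball 0 R) x *\<^sub>R f x) \<in> borel_measurable lborel"
    using assms by (auto simp: L2_iff intro!: borel_measurable_scaleR borel_measurable_indicator)
qed

lemma L2_tail:
  fixes f :: "real ^ 'n::finite \<Rightarrow> complex"
  assumes f: "f \<in> L2"
  shows "((\<lambda>R. \<integral>\<^sup>+x. ennreal ((norm (indicator (- ball 0 R) x *\<^sub>R f x))\<^sup>2) \<partial>lborel) \<longlongrightarrow> 0) at_top"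
proof -
  have [measurable]: "f \<in> borel_measurable borel" using assms by (auto simp: L2_iff)
  have int: "integrable lborel (\<lambda>x. (norm (f x))\<^sup>2)" using f by (simp add: L2_def)
  have "((\<lambda>R. LINT x|lborel. (norm (indicator (- ball 0 R) x *\<^sub>R f x))\<^sup>2) \<longlongrightarrow> (LINT (x::real^'n)|lborel. 0)) at_top"
  proof (rule integral_dominated_convergence_at_top[OF _ _ int])
    show "AE x in lborel. ((\<lambda>R. (norm (indicator (- ball 0 R) x *\<^sub>R f x))\<^sup>2) \<longlongrightarrow> 0) at_top"
    proof (intro AE_I2 tendsto_eventually)
      fix x :: "real ^ 'n"
      show "eventually (\<lambda>R. (norm (indicator (- ball 0 R) x *\<^sub>R f x))\<^sup>2 = 0) at_top"
        using eventually_gt_at_top[of "norm x"] by eventually_elim auto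
    qed
    show "\<forall>\<^sub>F R in at_top. AE x in lborel. norm ((norm (indicator (- ball 0 R) x *\<^sub>R f x))\<^sup>2) \<le> (norm (f x))\<^sup>2"
      by (intro always_eventually allI AE_I2) (auto simp: indicator_def)
  qed (auto simp: )
  then have "((\<lambda>R. ennreal (LINT x|lborel. (norm (indicator (- ball 0 R) x *\<^sub>R f x))\<^sup>2)) \<longlongrightarrow> ennreal 0) at_top"
    by (intro tendsto_ennrealI) simp
  moreover have "ennreal (LINT x|lborel. (norm (indicator (- ball 0 R) x *\<^sub>R f x))\<^sup>2) = (\<integral>\<^sup>+x. ennreal ((norm (indicator (- ball 0 R) x *\<^sub>R f x))\<^sup>2) \<partial>lborel)" for R
    by (intro nn_integral_eq_integral[symmetric] Bochner_Integration.integrable_bound[OF int]) (auto simp: indicator_def)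
  ultimately show ?thesis by simp
qed

lemma L2_ft:
  fixes f :: "real ^ 'n::finite \<Rightarrow> complex"
  assumes "integrable lborel f" "f \<in> L2"
  shows "ft f \<in> L2"
  using plancherel_le[OF assms(1)] assms by (auto simp: L2_iff)

text \<open>By \<open>plancherel_le\<close> the error of the truncated transform is at most the
  squared norm of \<open>f\<close> outside the ball of radius \<open>R\<close>, which vanishes as
  \<open>R\<close> grows.\<close>

lemma L2_fourier_ft:
  fixes f :: "real ^ 'n::finite \<Rightarrow> complex"
  assumes f: "integrable lborel f" and f2: "f \<in> L2"
  shows "L2_fourier f (ft f)"
  unfolding L2_fourier_def
proof (intro conjI f2 L2_ft f)
  show "((\<lambda>R. \<integral>\<^sup>+ y. ennreal ((norm (truncated_fourier R f y - ft f y))\<^sup>2) \<partial>lborel) \<longlongrightarrow> 0) at_top"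
  proof (rule tendsto_sandwich[OF _ _ tendsto_const L2_tail[OF f2]])
    show "\<forall>\<^sub>F R in at_top. (\<integral>\<^sup>+ y. ennreal ((norm (truncated_fourier R f y - ft f y))\<^sup>2) \<partial>lborel)
      \<le> (\<integral>\<^sup>+x. ennreal ((norm (indicator (- ball 0 R) x *\<^sub>R f x))\<^sup>2) \<partial>lborel)"
    proof (intro always_eventually allI)
      fix R
      have "(\<integral>\<^sup>+ y. ennreal ((norm (truncated_fourier R f y - ft f y))\<^sup>2) \<partial>lborel) =
          (\<integral>\<^sup>+ y. ennreal ((norm (ft (\<lambda>x. indicator (ball 0 R) x *\<^sub>R f x - f x) y))\<^sup>2) \<partial>lborel)"
        by (simp add: truncated_fourier_eq ft_diff L2_integrable_ball f f2)
      also have "\<dots> \<le> (\<integral>\<^sup>+ x. ennreal ((norm (indicator (ball 0 R) x *\<^sub>R f x - f x))\<^sup>2) \<partial>lborel)"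
        by (intro plancherel_le Bochner_Integration.integrable_diff L2_integrable_ball f f2)
      also have "\<dots> = (\<integral>\<^sup>+x. ennreal ((norm (indicator (- ball 0 R) x *\<^sub>R f x))\<^sup>2) \<partial>lborel)"
        by (intro nn_integral_cong) (auto simp: indicator_def)
      finally show "(\<integral>\<^sup>+ y. ennreal ((norm (truncated_fourier R f y - ft f y))\<^sup>2) \<partial>lborel) \<le> (\<integral>\<^sup>+x. ennreal ((norm (indicator (- ball 0 R) x *\<^sub>R f x))\<^sup>2) \<partial>lborel)" .
    qed
  qed simp
qed

lemma L2_fourier_L2: "L2_fourier f F \<Longrightarrow> f \<in> L2" "L2_fourier f F \<Longrightarrow> F \<in> L2"
  by (auto simp: L2_fourier_def)

lemma L2_indicator:
  assumes f: "f \<in> L2" and S[measurable]: "S \<in> sets borel"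
  shows "(\<lambda>x. indicator S x *\<^sub>R f x) \<in> L2"
proof -
  have [measurable]: "f \<in> borel_measurable borel" using f by (simp add: L2_iff)
  have "(\<integral>\<^sup>+x. ennreal ((norm (indicator S x *\<^sub>R f x))\<^sup>2) \<partial>lborel) \<le> (\<integral>\<^sup>+x. ennreal ((norm (f x))\<^sup>2) \<partial>lborel)"
    by (intro nn_integral_mono) (auto simp: indicator_def)
  with f show ?thesis unfolding L2_iff by (auto intro: le_less_trans)
qed

lemma measurable_truncated_fourier[measurable]:
  assumes "f \<in> L2" shows "truncated_fourier R f \<in> borel_measurable borel"
  unfolding truncated_fourier_eq
  by (intro borel_measurable_ft borel_measurable_integrable L2_integrable_ball assms)

lemma truncated_fourier_cong_AE:
  assumes "f \<in> L2" "g \<in> L2" "AE x in lborel. f x = g x"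
  shows "truncated_fourier R f = truncated_fourier R g"
  unfolding truncated_fourier_eq
proof
  fix y
  have [measurable]: "f \<in> borel_measurable borel" "g \<in> borel_measurable borel" using assms by (auto simp: L2_iff)
  have "(LINT x|lborel. cis (- (y \<bullet> x)) * (indicator (ball 0 R) x *\<^sub>R f x)) = (LINT x|lborel. cis (- (y \<bullet> x)) * (indicator (ball 0 R) x *\<^sub>R g x))"
    by (rule integral_cong_AE) (use assms(3) in auto)
  then show "ft (\<lambda>x. indicator (ball 0 R) x *\<^sub>R f x) y = ft (\<lambda>x. indicator (ball 0 R) x *\<^sub>R g x) y"
    by (simp add: ft_def)
qed

lemma L2_fourier_cong:
  assumes "L2_fourier f F" "g \<in> L2" "AE x in lborel. f x = g x"
  shows "L2_fourier g F"
  using assms truncated_fourier_cong_AE[OF L2_fourier_L2(1)[OF assms(1)] assms(2,3)]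
  by (simp add: L2_fourier_def)

lemma nn_integral_sq_zero_AE:
  fixes F :: "'a::euclidean_space \<Rightarrow> complex"
  assumes "F \<in> borel_measurable borel" "(\<integral>\<^sup>+x. ennreal ((norm (F x))\<^sup>2) \<partial>lborel) \<le> 0"
  shows "AE x in lborel. F x = 0"
proof -
  have "(\<integral>\<^sup>+x. ennreal ((norm (F x))\<^sup>2) \<partial>lborel) = 0" using assms by simp
  then have "AE x in lborel. ennreal ((norm (F x))\<^sup>2) = 0"
    by (subst (asm) nn_integral_0_iff_AE) (use assms(1) in auto)
  then show ?thesis by eventually_elim (simp add: ennreal_eq_0_iff)
qed

text \<open>The truncated transforms of \<open>f\<close> and \<open>g\<close> coincide, since null
  sets do not affect integrals, and an \<open>L2\<close> limit is unique up to null sets.\<close>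

lemma L2_fourier_unique:
  assumes f: "L2_fourier f F" and g: "L2_fourier g G" and fg: "AE x in lborel. f x = g x"
  shows "AE y in lborel. F y = G y"
proof -
  have f': "L2_fourier g F" by (rule L2_fourier_cong[OF f L2_fourier_L2(1)[OF g] fg])
  have [measurable]: "F \<in> borel_measurable borel" "G \<in> borel_measurable borel" "g \<in> L2"
    using f g by (auto simp: L2_iff dest: L2_fourier_L2)
  let ?t = "\<lambda>F R. \<integral>\<^sup>+ y. ennreal ((norm (truncated_fourier R g y - F y))\<^sup>2) \<partial>lborel"
  have lim: "((\<lambda>R. 2 * ?t F R + 2 * ?t G R) \<longlongrightarrow> 2 * 0 + 2 * 0) at_top"
    using f' g unfolding L2_fourier_def by (intro tendsto_intros ennreal_tendsto_cmult) auto
  have "(\<integral>\<^sup>+ y. ennreal ((norm (F y - G y))\<^sup>2) \<partial>lborel) \<le> 2 * ?t F R + 2 * ?t G R" for R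
  proof -
    have "(\<integral>\<^sup>+ y. ennreal ((norm ((F y - truncated_fourier R g y) + (truncated_fourier R g y - G y)))\<^sup>2) \<partial>lborel)
      \<le> 2 * (\<integral>\<^sup>+ y. ennreal ((norm (F y - truncated_fourier R g y))\<^sup>2) \<partial>lborel) + 2 * ?t G R"
      by (rule nn_integral_norm_add_sq_le) auto
    then show ?thesis by (simp add: norm_minus_commute)
  qed
  then have "(\<integral>\<^sup>+ y. ennreal ((norm (F y - G y))\<^sup>2) \<partial>lborel) \<le> 2 * 0 + 2 * 0"
    by (intro tendsto_lowerbound[OF lim] always_eventually) auto
  then have "AE y in lborel. F y - G y = 0"
    by (intro nn_integral_sq_zero_AE) auto
  then show ?thesis by simp
qed

lemma L2_fourier_add_cmult:
  assumes f: "L2_fourier f F" and g: "L2_fourier g G"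
  shows "L2_fourier (\<lambda>x. f x + c * g x) (\<lambda>y. F y + c * G y)"
proof -
  note L = L2_fourier_L2[OF f] L2_fourier_L2[OF g]
  have [measurable]: "F \<in> borel_measurable borel" "G \<in> borel_measurable borel"
    using L by (auto simp: L2_iff)
  note [measurable] = L(1,3)
  let ?t = "\<lambda>f F R. \<integral>\<^sup>+ y. ennreal ((norm (truncated_fourier R f y - F y))\<^sup>2) \<partial>lborel"
  have tr: "truncated_fourier R (\<lambda>x. f x + c * g x) y = truncated_fourier R f y + c * truncated_fourier R g y" for R y
  proof -
    have i: "integrable lborel (\<lambda>x. cis (- (y \<bullet> x)) * (indicator (ball 0 R) x *\<^sub>R f x))"
       "integrable lborel (\<lambda>x. cis (- (y \<bullet> x)) * (indicator (ball 0 R) x *\<^sub>R g x))"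
      by (rule integrable_cis_mult[OF L2_integrable_ball[OF L(1)]] integrable_cis_mult[OF L2_integrable_ball[OF L(3)]]; simp)+
    have "(LINT x|lborel. cis (- (y \<bullet> x)) * (indicator (ball 0 R) x *\<^sub>R (f x + c * g x))) =
       (LINT x|lborel. cis (- (y \<bullet> x)) * (indicator (ball 0 R) x *\<^sub>R f x) + c * (cis (- (y \<bullet> x)) * (indicator (ball 0 R) x *\<^sub>R g x)))"
      by (intro Bochner_Integration.integral_cong) (auto simp: algebra_simps)
    also have "\<dots> = (LINT x|lborel. cis (- (y \<bullet> x)) * (indicator (ball 0 R) x *\<^sub>R f x)) + c * (LINT x|lborel. cis (- (y \<bullet> x)) * (indicator (ball 0 R) x *\<^sub>R g x))"
      by (subst Bochner_Integration.integral_add[OF i(1) integrable_mult_right[OF i(2)]], subst integral_mult_right_zero) (rule refl)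
    finally show ?thesis unfolding truncated_fourier_eq ft_def by (simp add: algebra_simps)
  qed
  have bd: "?t (\<lambda>x. f x + c * g x) (\<lambda>y. F y + c * G y) R \<le> 2 * ?t f F R + 2 * (ennreal ((norm c)\<^sup>2) * ?t g G R)" for R
  proof -
    have "?t (\<lambda>x. f x + c * g x) (\<lambda>y. F y + c * G y) R =
      (\<integral>\<^sup>+ y. ennreal ((norm ((truncated_fourier R f y - F y) + c * (truncated_fourier R g y - G y)))\<^sup>2) \<partial>lborel)"
      by (simp add: tr algebra_simps)
    also have "\<dots> \<le> 2 * ?t f F R + 2 * (\<integral>\<^sup>+ y. ennreal ((norm (c * (truncated_fourier R g y - G y)))\<^sup>2) \<partial>lborel)"
      by (rule nn_integral_norm_add_sq_le) auto
    also have "(\<integral>\<^sup>+ y. ennreal ((norm (c * (truncated_fourier R g y - G y)))\<^sup>2) \<partial>lborel) = ennreal ((norm c)\<^sup>2) * ?t g G R"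
      by (subst nn_integral_cmult[symmetric]) (auto simp: norm_mult power_mult_distrib ennreal_mult)
    finally show ?thesis .
  qed
  have lim: "((\<lambda>R. 2 * ?t f F R + 2 * (ennreal ((norm c)\<^sup>2) * ?t g G R)) \<longlongrightarrow> 2 * 0 + 2 * (ennreal ((norm c)\<^sup>2) * 0)) at_top"
    using f g unfolding L2_fourier_def by (intro tendsto_intros ennreal_tendsto_cmult) auto
  have "((\<lambda>R. ?t (\<lambda>x. f x + c * g x) (\<lambda>y. F y + c * G y) R) \<longlongrightarrow> 0) at_top"
    by (rule tendsto_sandwich[OF _ _ tendsto_const lim[simplified]])
       (use bd in \<open>auto intro!: always_eventually\<close>)
  then show ?thesis
    unfolding L2_fourier_def by (intro conjI L2_add L2_cmult L)
qed

lemma integrable_mult_L2: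
  assumes f: "f \<in> L2" and g: "g \<in> L2"
  shows "integrable lborel (\<lambda>x. f x * g x)"
proof (rule Bochner_Integration.integrable_bound)
  have [measurable]: "f \<in> borel_measurable borel" "g \<in> borel_measurable borel" using f g by (auto simp: L2_iff)
  show "integrable lborel (\<lambda>x. (norm (f x))\<^sup>2 + (norm (g x))\<^sup>2)"
    using f g by (auto simp: L2_def)
  show "AE x in lborel. norm (f x * g x) \<le> norm ((norm (f x))\<^sup>2 + (norm (g x))\<^sup>2)"
  proof (intro AE_I2)
    fix x
    show "norm (f x * g x) \<le> norm ((norm (f x))\<^sup>2 + (norm (g x))\<^sup>2)"
      using sum_squares_bound[of "norm (f x)" "norm (g x)"] mult_nonneg_nonneg[OF norm_ge_zero[of "f x"] norm_ge_zero[of "g x"]]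
      unfolding norm_mult abs_of_nonneg[OF add_nonneg_nonneg[OF zero_le_power2 zero_le_power2]] real_norm_def by linarith
  qed
  show "(\<lambda>x. f x * g x) \<in> borel_measurable lborel" by simp
qed

lemma bounded_integrable_L2:
  fixes f :: "real ^ 'n::finite \<Rightarrow> complex"
  assumes f: "integrable lborel f" and b: "\<And>x. norm (f x) \<le> b"
  shows "f \<in> L2"
proof -
  have [measurable]: "f \<in> borel_measurable borel" using f by auto
  have "integrable lborel (\<lambda>x. (norm (f x))\<^sup>2)"
  proof (rule Bochner_Integration.integrable_bound)
    show "integrable lborel (\<lambda>x. b * norm (f x))" using f by auto
    show "AE x in lborel. norm ((norm (f x))\<^sup>2) \<le> norm (b * norm (f x))"
      using b by (intro AE_I2) (auto simp: power2_eq_square abs_mult intro!: mult_right_mono order_trans[OF b abs_ge_self])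
  qed simp
  then show ?thesis by (simp add: L2_def)
qed

lemma gauss_L2: "\<epsilon> > 0 \<Longrightarrow> (\<lambda>x::real^'n::finite. complex_of_real (gauss \<epsilon> (z - x))) \<in> L2"
  and integrable_gauss_shift: "\<epsilon> > 0 \<Longrightarrow> integrable lborel (\<lambda>x::real^'n::finite. gauss \<epsilon> (z - x))"
proof -
  assume e: "\<epsilon> > 0"
  show i: "integrable lborel (\<lambda>x::real^'n::finite. gauss \<epsilon> (z - x))"
    by (rule integrableI_nn_integral_finite[where x=1]) (simp_all add: e nn_integral_gauss_shift)
  show "(\<lambda>x::real^'n::finite. complex_of_real (gauss \<epsilon> (z - x))) \<in> L2"
  proof (rule bounded_integrable_L2)
    show "integrable lborel (\<lambda>x::real^'n::finite. complex_of_real (gauss \<epsilon> (z - x)))"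
      using i by (rule integrable_of_real)
    show "norm (complex_of_real (gauss \<epsilon> (z - x))) \<le> 1 / sqrt (2 * pi * \<epsilon>) ^ DIM(real^'n)" for x
      unfolding norm_of_real using e by (simp add: gauss_def abs_of_nonneg divide_right_mono)
  qed
qed

text \<open>The multiplication formula \<open>\<integral>Ff \<psi> = \<integral>f F\<psi>\<close> for a modulated Gaussian \<open>\<psi>\<close>; it replaces the
  full Plancherel theorem and shows that the transform determines all Gaussian averages of \<open>f\<close>.\<close>

lemma L2_fourier_gauss_average:
  fixes f :: "real ^ 'n::finite \<Rightarrow> complex"
  assumes e: "\<epsilon> > 0" and f: "L2_fourier f F"
  shows "(LINT x|lborel. of_real (gauss \<epsilon> (z - x)) * f x) =
    of_real ((2 * pi) powr (- real CARD('n) / 2)) * (LINT w|lborel. (of_real (exp (- \<epsilon> * (norm w)\<^sup>2 / 2)) * cis (w \<bullet> z)) * F w)"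
proof (rule LIMSEQ_unique)
  define k where "k = (2 * pi) powr (- real CARD('n) / 2)"
  have k2: "k * k * (2 * pi) ^ CARD('n) = 1"
    using ft_const_sq[where 'n='n] by (simp add: k_def power2_eq_square)
  note L = L2_fourier_L2[OF f]
  have [measurable]: "f \<in> borel_measurable borel" "F \<in> borel_measurable borel" using L by (auto simp: L2_iff)
  note [measurable] = L(1)
  let ?A = "\<lambda>w. complex_of_real (exp (- \<epsilon> * (norm (w::real^'n))\<^sup>2 / 2)) * cis (w \<bullet> z)"
  let ?t = "\<lambda>n. truncated_fourier (real n) f"
  have "?A \<in> L2"
  proof (rule bounded_integrable_L2)
    show "integrable lborel ?A" by (rule integrable_exp_norm_mult[OF e, where b=1]) auto
    show "norm (?A x) \<le> 1" for x using e by (simp add: norm_mult)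
  qed
  show "(\<lambda>n. LINT x|lborel. of_real (gauss \<epsilon> (z - x)) * (indicator (ball 0 (real n)) x *\<^sub>R f x)) \<longlonglongrightarrow> (LINT x|lborel. of_real (gauss \<epsilon> (z - x)) * f x)"
  proof (rule integral_dominated_convergence)
    show "integrable lborel (\<lambda>x. norm (of_real (gauss \<epsilon> (z - x)) * f x))"
      by (intro integrable_norm integrable_mult_L2 gauss_L2 e L)
    show "AE x in lborel. (\<lambda>n. of_real (gauss \<epsilon> (z - x)) * (indicator (ball 0 (real n)) x *\<^sub>R f x)) \<longlonglongrightarrow> of_real (gauss \<epsilon> (z - x)) * f x"
    proof (intro AE_I2 tendsto_eventually)
      fix x :: "real^'n"
      obtain N where "norm x < real N" using reals_Archimedean2 by blast
      then show "\<forall>\<^sub>F n in sequentially. of_real (gauss \<epsilon> (z - x)) * (indicator (ball 0 (real n)) x *\<^sub>R f x) = of_real (gauss \<epsilon> (z - x)) * f x"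
        by (intro eventually_sequentiallyI[of N]) (auto simp: indicator_def)
    qed
    show "AE x in lborel. norm (of_real (gauss \<epsilon> (z - x)) * (indicator (ball 0 (real n)) x *\<^sub>R f x)) \<le> norm (of_real (gauss \<epsilon> (z - x)) * f x)" for n
      by (intro AE_I2) (auto simp: indicator_def)
    show "(\<lambda>x. of_real (gauss \<epsilon> (z - x)) * (indicator (ball 0 (real n)) x *\<^sub>R f x)) \<in> borel_measurable lborel" for n
      by (auto intro!: borel_measurable_times borel_measurable_scaleR borel_measurable_indicator)
  qed (auto intro!: borel_measurable_times)
  have lim0: "(\<lambda>n. (\<integral>\<^sup>+w. ennreal ((norm (?A w))\<^sup>2) \<partial>lborel) * (\<integral>\<^sup>+ y. ennreal ((norm (?t n y - F y))\<^sup>2) \<partial>lborel)) \<longlonglongrightarrow> (\<integral>\<^sup>+w. ennreal ((norm (?A w))\<^sup>2) \<partial>lborel) * 0"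
  proof (rule ennreal_tendsto_cmult)
    show "(\<integral>\<^sup>+w. ennreal ((norm (?A w))\<^sup>2) \<partial>lborel) < top"
      using \<open>?A \<in> L2\<close> by (simp only: L2_iff infinity_ennreal_def)
    show "(\<lambda>n. \<integral>\<^sup>+ y. ennreal ((norm (?t n y - F y))\<^sup>2) \<partial>lborel) \<longlonglongrightarrow> 0"
      using filterlim_compose[OF _ filterlim_real_sequentially, of "\<lambda>R. \<integral>\<^sup>+ y. ennreal ((norm (truncated_fourier R f y - F y))\<^sup>2) \<partial>lborel" "nhds 0"] f
      unfolding L2_fourier_def by simp
  qed
  have tA: "integrable lborel (\<lambda>w. ?A w * ?t n w)" for n
    unfolding truncated_fourier_eq
    by (rule integrable_mult_L2[OF \<open>?A \<in> L2\<close> L2_ft[OF L2_integrable_ball[OF L(1)] L2_indicator[OF L(1) sets_ball]]])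
  have FA: "integrable lborel (\<lambda>w. ?A w * F w)"
    by (rule integrable_mult_L2[OF \<open>?A \<in> L2\<close> L(2)])
  \<comment> \<open>Cauchy-Schwarz: the Gaussian factor is in \<open>L2\<close>, so pairing with it
    passes to the \<open>L2\<close> limit that defines \<open>F\<close>.\<close>
  have sqrt_lim: "(\<lambda>n. (LINT w|lborel. ?A w * ?t n w) - (LINT w|lborel. ?A w * F w)) \<longlonglongrightarrow> 0"
  proof -
    have "(ennreal (norm ((LINT w|lborel. ?A w * ?t n w) - (LINT w|lborel. ?A w * F w))))\<^sup>2
      \<le> (\<integral>\<^sup>+w. ennreal ((norm (?A w))\<^sup>2) \<partial>lborel) * (\<integral>\<^sup>+ y. ennreal ((norm (?t n y - F y))\<^sup>2) \<partial>lborel)" for n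
    proof -
      have "(LINT w|lborel. ?A w * ?t n w) - (LINT w|lborel. ?A w * F w) = (LINT w|lborel. ?A w * (?t n w - F w))"
        using Bochner_Integration.integral_diff[OF tA[of n] FA] by (simp add: right_diff_distrib)
      then have "ennreal (norm ((LINT w|lborel. ?A w * ?t n w) - (LINT w|lborel. ?A w * F w))) \<le> (\<integral>\<^sup>+w. ennreal (norm (?A w)) * ennreal (norm (?t n w - F w)) \<partial>lborel)"
        using norm_lebesgue_integral_le[of lborel "\<lambda>w. ?A w * (?t n w - F w)"] by (simp add: norm_mult ennreal_mult' mult.assoc)
      then have "(ennreal (norm ((LINT w|lborel. ?A w * ?t n w) - (LINT w|lborel. ?A w * F w))))\<^sup>2 \<le> (\<integral>\<^sup>+w. ennreal (norm (?A w)) * ennreal (norm (?t n w - F w)) \<partial>lborel)\<^sup>2"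
        by (rule power_mono) simp
      also have "\<dots> \<le> (\<integral>\<^sup>+w. (ennreal (norm (?A w)))\<^sup>2 \<partial>lborel) * (\<integral>\<^sup>+w. (ennreal (norm (?t n w - F w)))\<^sup>2 \<partial>lborel)"
        by (rule Cauchy_Schwarz_nn_integral) auto
      finally show ?thesis by (simp add: ennreal_power)
    qed
    then have "(\<lambda>n. ennreal ((norm ((LINT w|lborel. ?A w * ?t n w) - (LINT w|lborel. ?A w * F w)))\<^sup>2)) \<longlonglongrightarrow> 0"
      by (intro tendsto_sandwich[OF _ _ tendsto_const lim0[simplified]]) (auto simp: ennreal_power intro!: always_eventually)
    then have "(\<lambda>n. (norm ((LINT w|lborel. ?A w * ?t n w) - (LINT w|lborel. ?A w * F w)))\<^sup>2) \<longlonglongrightarrow> 0"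
      by (simp add: tendsto_ennreal_iff[where x=0, simplified])
    then show ?thesis by (simp add: tendsto_norm_zero_iff)
  qed
  have eq: "(LINT x|lborel. of_real (gauss \<epsilon> (z - x)) * (indicator (ball 0 (real n)) x *\<^sub>R f x)) = of_real k * (LINT w|lborel. ?A w * ?t n w)" for n
  proof -
    have "(LINT w|lborel. ?A w * ?t n w) = of_real k * (LINT w|lborel. ?A w * (LINT x|lborel. cis (- (w \<bullet> x)) * (indicator (ball 0 (real n)) x *\<^sub>R f x)))"
      by (subst integral_mult_right_zero[symmetric]) (simp add: truncated_fourier_eq ft_def k_def mult_ac)
    also have "\<dots> = of_real k * (of_real ((2 * pi) ^ CARD('n)) * (LINT x|lborel. of_real (gauss \<epsilon> (z - x)) * (indicator (ball 0 (real n)) x *\<^sub>R f x)))"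
      by (subst gauss_smoothing[OF e lborel.sigma_finite_measure_axioms _ L2_integrable_ball[OF L(1)]]) simp_all
    finally have "of_real k * (LINT w|lborel. ?A w * ?t n w) = of_real (k * k * (2 * pi) ^ CARD('n)) * (LINT x|lborel. of_real (gauss \<epsilon> (z - x)) * (indicator (ball 0 (real n)) x *\<^sub>R f x))"
      by (simp add: mult.assoc)
    then show ?thesis unfolding k2 by simp
  qed
  show "(\<lambda>n. LINT x|lborel. of_real (gauss \<epsilon> (z - x)) * (indicator (ball 0 (real n)) x *\<^sub>R f x)) \<longlonglongrightarrow> of_real ((2 * pi) powr (- real CARD('n) / 2)) * (LINT w|lborel. ?A w * F w)"
    unfolding eq k_def[symmetric]
    using sqrt_lim by (intro tendsto_mult_left) (simp add: LIM_zero_iff)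
qed

section \<open>Narrow Gaussian averages, absolute continuity of laws and Fourier inversion\<close>

lemma integral_lborel_affine:
  fixes f :: "'a::euclidean_space \<Rightarrow> 'b::{banach, second_countable_topology}"
  assumes c: "c \<noteq> 0" and [measurable]: "f \<in> borel_measurable borel"
  shows "(LINT x|lborel. f x) = \<bar>c\<bar> ^ DIM('a) *\<^sub>R (LINT x|lborel. f (t + c *\<^sub>R x))"
  by (subst lborel_affine[OF c, of t]) (simp add: integral_density integral_distr)

lemma nn_integral_lborel_affine:
  fixes f :: "'a::euclidean_space \<Rightarrow> ennreal"
  assumes c: "c \<noteq> 0" and [measurable]: "f \<in> borel_measurable borel"
  shows "(\<integral>\<^sup>+x. f x \<partial>lborel) = \<bar>c\<bar> ^ DIM('a) * (\<integral>\<^sup>+x. f (t + c *\<^sub>R x) \<partial>lborel)"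
  by (subst lborel_affine[OF c, of t]) (simp add: nn_integral_density nn_integral_distr nn_integral_cmult ennreal_power)

lemma gauss_average_rescale:
  fixes f :: "'a::euclidean_space \<Rightarrow> complex"
  assumes e: "\<epsilon> > 0" and [measurable]: "f \<in> borel_measurable borel"
  shows "(LINT x|lborel. of_real (gauss \<epsilon> (z - x)) * f x) = (LINT w|lborel. of_real (gauss 1 w) * f (z + sqrt \<epsilon> *\<^sub>R w))"
proof -
  have "gauss \<epsilon> (z - (z + sqrt \<epsilon> *\<^sub>R w)) * sqrt \<epsilon> ^ DIM('a) = gauss 1 w" for w :: 'a
    using e by (simp add: gauss_def power_mult_distrib real_sqrt_mult)
  then have *: "complex_of_real (sqrt \<epsilon> ^ DIM('a)) * (of_real (gauss \<epsilon> (z - (z + sqrt \<epsilon> *\<^sub>R w))) * f (z + sqrt \<epsilon> *\<^sub>R w))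
      = of_real (gauss 1 w) * f (z + sqrt \<epsilon> *\<^sub>R w)" for w
    by (metis mult.assoc mult.commute of_real_mult)
  have "(LINT x|lborel. of_real (gauss \<epsilon> (z - x)) * f x) =
    \<bar>sqrt \<epsilon>\<bar> ^ DIM('a) *\<^sub>R (LINT w|lborel. of_real (gauss \<epsilon> (z - (z + sqrt \<epsilon> *\<^sub>R w))) * f (z + sqrt \<epsilon> *\<^sub>R w))"
    by (rule integral_lborel_affine) (use e in auto)
  also have "\<dots> = (LINT w|lborel. complex_of_real (sqrt \<epsilon> ^ DIM('a)) * (of_real (gauss \<epsilon> (z - (z + sqrt \<epsilon> *\<^sub>R w))) * f (z + sqrt \<epsilon> *\<^sub>R w)))"
    by (subst integral_mult_right_zero) (use e in \<open>simp add: scaleR_conv_of_real\<close>)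
  finally show ?thesis unfolding * .
qed

text \<open>After rescaling, the weight is the fixed standard Gaussian and the width enters only the
  argument of \<open>f\<close>, so dominated convergence and continuity at \<open>z\<close>
  suffice.\<close>

lemma gauss_average_tendsto:
  fixes f :: "'a::euclidean_space \<Rightarrow> complex"
  assumes [measurable]: "f \<in> borel_measurable borel" and b: "\<And>x. norm (f x) \<le> b" and z: "isCont f z"
  shows "(\<lambda>n. LINT x|lborel. of_real (gauss (1 / real (Suc n)) (z - x)) * f x) \<longlonglongrightarrow> f z"
proof -
  have lim: "(\<lambda>n. LINT w|lborel. of_real (gauss 1 w) * f (z + sqrt (1 / real (Suc n)) *\<^sub>R w)) \<longlonglongrightarrow> (LINT w|lborel. of_real (gauss 1 (w::'a)) * f z)"
  proof (rule integral_dominated_convergence)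
    show "integrable lborel (\<lambda>w::'a. gauss 1 w * b)" using integrable_gauss[of 1, where 'a='a] by simp
    show "AE w in lborel. (\<lambda>n. of_real (gauss 1 w) * f (z + sqrt (1 / real (Suc n)) *\<^sub>R w)) \<longlonglongrightarrow> of_real (gauss 1 w) * f z"
    proof (intro AE_I2 tendsto_mult_left)
      fix w :: 'a
      have "(\<lambda>n. z + sqrt (1 / real (Suc n)) *\<^sub>R w) \<longlonglongrightarrow> z + sqrt 0 *\<^sub>R w"
        by (intro tendsto_intros LIMSEQ_Suc lim_1_over_n)
      then show "(\<lambda>n. f (z + sqrt (1 / real (Suc n)) *\<^sub>R w)) \<longlonglongrightarrow> f z"
        by (intro isCont_tendsto_compose[OF z]) simp
    qed
    show "AE w in lborel. norm (of_real (gauss 1 w) * f (z + sqrt (1 / real (Suc n)) *\<^sub>R w)) \<le> gauss 1 w * b" for n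
      using b by (intro AE_I2) (simp add: norm_mult mult_left_mono)
  qed auto
  have "(LINT w|lborel. of_real (gauss 1 (w::'a)) * f z) = f z"
    using integral_gauss[of 1, where 'a='a] by (simp flip: integral_of_real)
  with lim show ?thesis
    by (subst gauss_average_rescale) auto
qed

text \<open>The density of the smoothed law is a damped inverse transform by
  \<open>gauss_smoothing\<close>, hence bounded by the integral of the modulus of the characteristic
  function, uniformly in \<open>z\<close> and \<open>\<epsilon>\<close>. The factor
  \<open>(2 * pi) ^ DIM('a)\<close> is at least one and is discarded.\<close>

lemma integral_gauss_char_bound:
  fixes N :: "'a::euclidean_space measure"
  assumes N: "finite_measure N" "sets N = sets borel" and e: "\<epsilon> > 0"
    and int: "integrable lborel (\<lambda>w. LINT x|N. cis (- (w \<bullet> x)))"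
  shows "(\<integral>\<^sup>+x. ennreal (gauss \<epsilon> (z - x)) \<partial>N) \<le> ennreal (LINT w|lborel. norm (LINT x|N. cis (- (w \<bullet> x))))"
proof -
  interpret finite_measure N by fact
  note [measurable_cong] = N(2)
  let ?X = "\<lambda>w. LINT x|N. cis (- (w \<bullet> x))"
  have bdd: "gauss \<epsilon> (z - x) \<le> 1 / sqrt (2 * pi * \<epsilon>) ^ DIM('a)" for x :: 'a
    using e by (simp add: gauss_def divide_right_mono)
  have ig: "integrable N (\<lambda>x. gauss \<epsilon> (z - x))"
    by (rule integrable_const_bound[where B="1 / sqrt (2 * pi * \<epsilon>) ^ DIM('a)"]) (use bdd e in auto)
  have "complex_of_real ((2 * pi) ^ DIM('a) * (LINT x|N. gauss \<epsilon> (z - x))) =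
     of_real ((2 * pi) ^ DIM('a)) * (LINT x|N. of_real (gauss \<epsilon> (z - x)) * 1)"
    by simp
  also have "\<dots> = (LINT w|lborel. (of_real (exp (- \<epsilon> * (norm w)\<^sup>2 / 2)) * cis (w \<bullet> z)) * (LINT x|N. cis (- (w \<bullet> x)) * 1))"
    by (rule gauss_smoothing[symmetric, OF e _ N(2)]) (auto intro: sigma_finite_measure_axioms)
  finally have eq: "complex_of_real ((2 * pi) ^ DIM('a) * (LINT x|N. gauss \<epsilon> (z - x))) = (LINT w|lborel. (of_real (exp (- \<epsilon> * (norm w)\<^sup>2 / 2)) * cis (w \<bullet> z)) * ?X w)"
    by simp
  have [measurable]: "?X \<in> borel_measurable borel" using int by auto
  have "integrable lborel (\<lambda>w. (of_real (exp (- \<epsilon> * (norm w)\<^sup>2 / 2)) * cis (w \<bullet> z)) * ?X w)"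
    by (rule Bochner_Integration.integrable_bound[OF int]) (use e in \<open>auto simp: norm_mult intro!: AE_I2 mult_left_le_one_le\<close>)
  then have "norm (complex_of_real ((2 * pi) ^ DIM('a) * (LINT x|N. gauss \<epsilon> (z - x)))) \<le> (LINT w|lborel. norm (?X w))"
    unfolding eq using int e
    by (intro order_trans[OF integral_norm_bound] integral_mono integrable_norm)
       (auto simp: norm_mult intro!: mult_left_le_one_le)
  then have "(2 * pi) ^ DIM('a) * (LINT x|N. gauss \<epsilon> (z - x)) \<le> (LINT w|lborel. norm (?X w))"
    unfolding norm_of_real by simp
  moreover have "1 * (LINT x|N. gauss \<epsilon> (z - x)) \<le> (2 * pi) ^ DIM('a) * (LINT x|N. gauss \<epsilon> (z - x))"
    using pi_gt3 e by (intro mult_right_mono one_le_power integral_nonneg) auto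
  ultimately have "(LINT x|N. gauss \<epsilon> (z - x)) \<le> (LINT w|lborel. norm (?X w))" by linarith
  then show ?thesis
    by (subst nn_integral_eq_integral[OF ig]) (use e in \<open>auto intro: ennreal_leI\<close>)
qed

text \<open>An integrable characteristic function forces absolute continuity. No density is
  constructed: \<open>N\<close> is dominated by a multiple of Lebesgue measure on open sets, and
  outer regularity carries this to null sets.\<close>

lemma null_set_of_integrable_char:
  fixes N :: "'a::euclidean_space measure"
  assumes N: "finite_measure N" "sets N = sets borel"
    and int: "integrable lborel (\<lambda>w. LINT x|N. cis (- (w \<bullet> x)))"
    and A: "A \<in> sets borel" "emeasure lborel A = 0"
  shows "emeasure N A = 0"
proof -
  interpret finite_measure N by fact
  note [measurable_cong] = N(2)
  define C where "C = (LINT w|lborel. norm (LINT x|N. cis (- (w \<bullet> x))))"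
  have C: "C \<ge> 0" unfolding C_def by simp
  \<comment> \<open>The smoothings of \<open>N\<close> give \<open>U\<close> a mass of at most
    \<open>C\<close> times its volume. The Gaussian mass of \<open>U\<close> seen from a point of
    \<open>U\<close> tends to one, so by Fatou the bound passes to \<open>N\<close> itself.\<close>
  have opn: "emeasure N U \<le> ennreal C * emeasure lborel U" if U: "open U" for U
  proof -
    have [measurable]: "U \<in> sets borel" using U by auto
    let ?u = "\<lambda>n x. \<integral>\<^sup>+z. indicator U z * ennreal (gauss (1 / real (Suc n)) (z - x)) \<partial>lborel"
    have "emeasure N U = (\<integral>\<^sup>+x. indicator U x \<partial>N)" by simp
    also have "\<dots> \<le> ennreal C * emeasure lborel U"
    proof (rule nn_integral_le_of_tendsto)
      fix n :: nat
      show "?u n \<in> borel_measurable N" by measurable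
      interpret pair_sigma_finite N lborel ..
      have "(\<integral>\<^sup>+x. ?u n x \<partial>N) = (\<integral>\<^sup>+z. \<integral>\<^sup>+x. indicator U z * ennreal (gauss (1 / real (Suc n)) (z - x)) \<partial>N \<partial>lborel)"
        by (rule Fubini'[symmetric]) measurable
      also have "\<dots> \<le> (\<integral>\<^sup>+z. indicator U z * ennreal C \<partial>lborel)"
      proof (intro nn_integral_mono)
        fix z :: 'a
        have "(\<integral>\<^sup>+x. ennreal (gauss (1 / real (Suc n)) (z - x)) \<partial>N) \<le> ennreal C"
          unfolding C_def by (rule integral_gauss_char_bound[OF N _ int]) simp
        then show "(\<integral>\<^sup>+x. indicator U z * ennreal (gauss (1 / real (Suc n)) (z - x)) \<partial>N) \<le> indicator U z * ennreal C"
          by (simp add: nn_integral_cmult mult_left_mono)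
      qed
      also have "\<dots> = ennreal C * emeasure lborel U"
        using nn_integral_cmult_indicator[of U lborel "ennreal C"] by (simp add: mult.commute)
      finally show "(\<integral>\<^sup>+x. ?u n x \<partial>N) \<le> ennreal C * emeasure lborel U" .
    next
      fix x :: 'a assume "x \<in> space N"
      show "indicator U x \<le> liminf (\<lambda>n. ?u n x)"
      proof (cases "x \<in> U")
        case True
        have ev: "\<forall>\<^sub>F y in nhds x. indicator U y = (1::complex)"
          using U True by (auto simp: eventually_nhds intro!: exI[of _ U])
        have "isCont (indicator U :: 'a \<Rightarrow> complex) x"
          unfolding isCont_def by (intro tendsto_eventually eventually_at_filter[THEN iffD2] eventually_mono[OF ev])
             (use True in auto)
        from gauss_average_tendsto[OF _ _ this, of 1]
        have "(\<lambda>n. LINT z|lborel. of_real (gauss (1 / real (Suc n)) (x - z)) * indicator U z) \<longlonglongrightarrow> (1::complex)"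
          using True by (auto simp: indicator_def)
        moreover have "(LINT z|lborel. of_real (gauss (1 / real (Suc n)) (x - z)) * indicator U z)
           = complex_of_real (LINT z|lborel. gauss (1 / real (Suc n)) (x - z) * indicator U z)" for n
          by (subst integral_complex_of_real[symmetric]) (auto intro!: Bochner_Integration.integral_cong simp: indicator_def)
        ultimately have "(\<lambda>n. complex_of_real (LINT z|lborel. gauss (1 / real (Suc n)) (x - z) * indicator U z)) \<longlonglongrightarrow> complex_of_real 1"
          by (simp only: of_real_1)
        then have lim: "(\<lambda>n. LINT z|lborel. gauss (1 / real (Suc n)) (x - z) * indicator U z) \<longlonglongrightarrow> 1"
          by (rule tendsto_of_real_iff[THEN iffD1])
        have "?u n x = ennreal (LINT z|lborel. gauss (1 / real (Suc n)) (x - z) * indicator U z)" for n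
        proof -
          have "integrable lborel (\<lambda>z. gauss (1 / real (Suc n)) (x - z) * indicator U z)"
          proof (rule Bochner_Integration.integrable_bound)
            show "integrable lborel (\<lambda>z. gauss (1 / real (Suc n)) (x - z))"
              by (rule integrableI_nn_integral_finite[where x=1]) (simp_all add: nn_integral_gauss_shift)
          qed (auto simp: indicator_def)
          then have "(\<integral>\<^sup>+z. ennreal (gauss (1 / real (Suc n)) (x - z) * indicator U z) \<partial>lborel) = ennreal (LINT z|lborel. gauss (1 / real (Suc n)) (x - z) * indicator U z)"
            by (rule nn_integral_eq_integral) auto
          then show ?thesis
            by (subst (asm) gauss_minus_commute) (simp add: ennreal_mult' ennreal_indicator mult.commute)
        qed
        then have "(\<lambda>n. ?u n x) \<longlonglongrightarrow> ennreal 1"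
          using tendsto_ennrealI[OF lim] by simp
        then show ?thesis using lim_imp_Liminf[of sequentially "\<lambda>n. ?u n x" 1] True by simp
      qed simp
    qed
    finally show ?thesis .
  qed
  have "emeasure N A \<le> ennreal C * ennreal e" if e: "e > 0" for e
  proof -
    obtain U where U: "open U" "A \<subseteq> U" "emeasure lborel (U - A) < ennreal e"
      using outer_regular_lborel[OF A(1) e] by blast
    have "emeasure lborel U \<le> emeasure lborel ((U - A) \<union> A)" using A U by (intro emeasure_mono) auto
    also have "\<dots> \<le> emeasure lborel (U - A) + emeasure lborel A"
      using A U by (intro emeasure_subadditive) auto
    finally have "emeasure lborel U \<le> ennreal e" using U(3) A(2) by simp
    have "emeasure N A \<le> emeasure N U" using U N by (intro emeasure_mono) auto
    also have "\<dots> \<le> ennreal C * emeasure lborel U" by (rule opn[OF U(1)])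
    also have "\<dots> \<le> ennreal C * ennreal e" using \<open>emeasure lborel U \<le> ennreal e\<close> by (intro mult_left_mono) auto
    finally show ?thesis .
  qed
  then have le: "emeasure N A \<le> ennreal (C * (1 / real (Suc n)))" for n
    using C by (metis ennreal_mult of_nat_0_less_iff zero_less_Suc zero_less_divide_1_iff order_less_imp_le)
  have "(\<lambda>n. ennreal (C * (1 / real (Suc n)))) \<longlonglongrightarrow> ennreal (C * 0)"
    by (intro tendsto_intros LIMSEQ_Suc lim_1_over_n)
  then have "emeasure N A \<le> ennreal (C * 0)"
    by (rule tendsto_lowerbound) (use le in auto)
  then show ?thesis by simp
qed

text \<open>The convolution is the smoothing of \<open>gauss \<delta>\<close>; characteristic
  functions multiply, so the variances add.\<close>

lemma gauss_convolution:
  fixes y :: "'a::euclidean_space"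
  assumes e: "\<epsilon> > 0" and d: "\<delta> > 0"
  shows "(LINT w|lborel. gauss \<epsilon> (y - w) * gauss \<delta> w) = gauss (\<epsilon> + \<delta>) y"
proof -
  have *: "(LINT x|lborel. cis (- (w \<bullet> x)) * of_real (gauss \<delta> x)) = of_real (exp (- \<delta> * (norm w)\<^sup>2 / 2))" for w :: 'a
    using gauss_char[OF d, of "- w"] by (simp add: inner_commute mult.commute)
  have "complex_of_real ((2 * pi) ^ DIM('a) * (LINT w|lborel. gauss \<epsilon> (y - w) * gauss \<delta> w)) = of_real ((2 * pi) ^ DIM('a)) * (LINT w|lborel. of_real (gauss \<epsilon> (y - w)) * of_real (gauss \<delta> w))"
    by (simp flip: of_real_mult)
  also have "\<dots> = (LINT w|lborel. (of_real (exp (- \<epsilon> * (norm w)\<^sup>2 / 2)) * cis (w \<bullet> y)) * (LINT x|lborel. cis (- (w \<bullet> x)) * of_real (gauss \<delta> x)))"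
    by (rule gauss_smoothing[symmetric, OF e lborel.sigma_finite_measure_axioms])
       (auto intro!: integrable_of_real integrable_gauss d)
  also have "\<dots> = (LINT w|lborel. of_real (exp (- (\<epsilon> + \<delta>) * (norm w)\<^sup>2 / 2)) * cis (w \<bullet> y))"
    unfolding * by (intro Bochner_Integration.integral_cong) (auto simp: algebra_simps add_divide_distrib exp_add[symmetric] simp flip: of_real_mult)
  also have "\<dots> = of_real ((2 * pi) ^ DIM('a) * gauss (\<epsilon> + \<delta>) y)"
    using e d by (intro gauss_inversion) simp
  finally show ?thesis by (simp only: of_real_eq_iff) simp
qed

lemma integral_lborel_uminus:
  fixes f :: "'a::euclidean_space \<Rightarrow> complex"
  assumes "f \<in> borel_measurable borel"
  shows "(LINT x|lborel. f (- x)) = (LINT x|lborel. f x)"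
  using integral_lborel_affine[of "-1" f 0] assms by simp

lemma nn_integral_lborel_uminus:
  fixes f :: "'a::euclidean_space \<Rightarrow> ennreal"
  assumes "f \<in> borel_measurable borel"
  shows "(\<integral>\<^sup>+x. f (- x) \<partial>lborel) = (\<integral>\<^sup>+x. f x \<partial>lborel)"
  using nn_integral_lborel_affine[of "-1" f 0] assms by simp

lemma exp_norm_gauss_1: "exp (- (norm (w::'a::euclidean_space))\<^sup>2 / 2) = sqrt (2 * pi) ^ DIM('a) * gauss 1 w"
  by (simp add: gauss_def)

text \<open>Fourier inversion in \<open>L\<^sup>2\<close>: the inverse transform of \<open>m\<close> is tamed by the factor
  \<open>exp (-\<epsilon>|x|\<^sup>2/2)\<close>, whose effect on the Fourier side is convolution with a narrow Gaussian.\<close>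

lemma L2_fourier_inversion:
  fixes m :: "real ^ 'n::finite \<Rightarrow> complex"
  assumes cont: "continuous_on UNIV m" and bd: "\<And>y. norm (m y) \<le> exp (- (norm y)\<^sup>2 / 2)"
  shows "L2_fourier (\<lambda>x. ft m (- x)) m"
proof -
  define k where "k = (2 * pi) powr (- real CARD('n) / 2)"
  have k2: "k * k * (2 * pi) ^ CARD('n) = 1"
    using ft_const_sq[where 'n='n] by (simp add: k_def power2_eq_square)
  have [measurable]: "m \<in> borel_measurable borel" using cont by (rule borel_measurable_continuous_onI)
  have mint: "integrable lborel m"
    by (rule Bochner_Integration.integrable_bound[OF integrable_exp_norm[of 1]]) (use bd in \<open>auto intro!: AE_I2\<close>)
  have bd1: "norm (m y) \<le> 1" for y using bd[of y] by (rule order_trans) simp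
  have mL2: "m \<in> L2" by (rule bounded_integrable_L2[OF mint bd1])
  define g where "g x = ft m (- x)" for x
  have [measurable]: "g \<in> borel_measurable borel" unfolding g_def[abs_def] by measurable
  have gL2: "g \<in> L2"
    using L2_ft[OF mint mL2] nn_integral_lborel_uminus[of "\<lambda>x. ennreal ((norm (ft m x))\<^sup>2)"]
    by (simp add: L2_iff g_def[abs_def])
  define E where "E n x = exp (- (1 / real (Suc n)) * (norm x)\<^sup>2 / 2)" for n and x :: "real ^ 'n"
  have E1: "E n x \<le> 1" "0 \<le> E n x" for n x by (auto simp: E_def)
  have [measurable]: "E n \<in> borel_measurable borel" for n unfolding E_def[abs_def] by measurable
  define ge where "ge n x = of_real (E n x) * g x" for n x
  have [measurable]: "ge n \<in> borel_measurable borel" for n unfolding ge_def[abs_def] by measurable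
  have ge: "integrable lborel (ge n)" for n
    unfolding ge_def E_def g_def
    by (rule integrable_exp_norm_mult[OF _ _ norm_ft_le[OF mint]]) auto
  define me where "me n y = (LINT w|lborel. of_real (gauss (1 / real (Suc n)) (y - w)) * m w)" for n y
  \<comment> \<open>The damped function \<open>ge n\<close> is integrable, so its transform is a
    genuine integral; it is the average \<open>me n\<close> of \<open>m\<close> against a Gaussian
    of variance \<open>1 / real (Suc n)\<close>.\<close>
  have ft_ge: "ft (ge n) y = me n y" for n y
  proof -
    have "ft (ge n) y = of_real k * (LINT x|lborel. cis (y \<bullet> x) * (of_real (E n x) * ft m x))"
      unfolding ft_def[of "ge n"] k_def[symmetric]
      using integral_lborel_uminus[of "\<lambda>x. cis (- (y \<bullet> x)) * ge n x"]
      by (simp add: ge_def g_def E_def)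
    also have "\<dots> = of_real k * (of_real k * (LINT x|lborel. (of_real (E n x) * cis (x \<bullet> y)) * (LINT w|lborel. cis (- (x \<bullet> w)) * m w)))"
      by (subst (2) integral_mult_right_zero[symmetric]) (simp add: ft_def k_def mult_ac inner_commute)
    also have "(LINT x|lborel. (of_real (E n x) * cis (x \<bullet> y)) * (LINT w|lborel. cis (- (x \<bullet> w)) * m w)) = of_real ((2 * pi) ^ CARD('n)) * me n y"
      unfolding E_def me_def
      by (subst gauss_smoothing[OF _ lborel.sigma_finite_measure_axioms _ mint]) simp_all
    also have "of_real k * (of_real k * (of_real ((2 * pi) ^ CARD('n)) * me n y)) = of_real (k * k * (2 * pi) ^ CARD('n)) * me n y"
      by simp
    finally show ?thesis unfolding k2 by simp
  qed
  have [measurable]: "me n \<in> borel_measurable borel" for n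
    using borel_measurable_ft[of "ge n"] by (simp add: ft_ge[abs_def])
  \<comment> \<open>Majorant for dominated convergence: \<open>m\<close> is dominated by a multiple
    of the Gaussian of variance 1, and convolving with variance \<open>1 / real (Suc n)\<close>
    yields variance at most 2, whence the exponent \<open>- (norm y)\<^sup>2 / 4\<close>.\<close>
  have me_bound: "norm (me n y) \<le> exp (- (norm y)\<^sup>2 / 4)" for n y
  proof -
    let ?e = "1 / real (Suc n)"
    have gb: "sqrt (2 * pi) ^ CARD('n) * gauss 1 w = exp (- (norm w)\<^sup>2 / 2)" for w :: "real ^ 'n"
      using exp_norm_gauss_1[of w] by simp
    have ig: "integrable lborel (\<lambda>w. gauss ?e (y - w))" by (rule integrable_gauss_shift) simp
    have "norm (me n y) \<le> (LINT w|lborel. gauss ?e (y - w) * (sqrt (2 * pi) ^ CARD('n) * gauss 1 w))"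
      unfolding me_def
    proof (rule Bochner_Integration.integral_norm_bound_integral)
      show "integrable lborel (\<lambda>w. of_real (gauss ?e (y - w)) * m w)"
        by (rule Bochner_Integration.integrable_bound[OF ig]) (use bd1 in \<open>auto simp: norm_mult intro!: AE_I2 mult_left_le\<close>)
      show "integrable lborel (\<lambda>w. gauss ?e (y - w) * (sqrt (2 * pi) ^ CARD('n) * gauss 1 w))"
        by (rule Bochner_Integration.integrable_bound[OF integrable_mult_right[OF ig, of "1"]])
           (auto simp: gb intro!: AE_I2 mult_left_le)
      show "norm (of_real (gauss ?e (y - w)) * m w) \<le> gauss ?e (y - w) * (sqrt (2 * pi) ^ CARD('n) * gauss 1 w)" for w
        using bd[of w] exp_norm_gauss_1[of w] by (simp add: norm_mult mult_left_mono)
    qed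
    also have "\<dots> = sqrt (2 * pi) ^ CARD('n) * (LINT w|lborel. gauss ?e (y - w) * gauss 1 w)"
      by (subst integral_mult_right_zero[symmetric]) (simp add: mult_ac)
    also have "\<dots> = sqrt (2 * pi) ^ CARD('n) * gauss (?e + 1) y" by (subst gauss_convolution) auto
    also have "\<dots> = exp (- (norm y)\<^sup>2 / (2 * (?e + 1))) / sqrt (?e + 1) ^ CARD('n)"
      unfolding gauss_def by (simp add: real_sqrt_mult power_mult_distrib del: One_nat_def of_nat_Suc)
    also have "\<dots> \<le> exp (- (norm y)\<^sup>2 / (2 * (?e + 1)))"
    proof -
      have s: "1 \<le> sqrt (?e + 1) ^ CARD('n)" by (intro one_le_power) simp
      have "exp (- (norm y)\<^sup>2 / (2 * (?e + 1))) / sqrt (?e + 1) ^ CARD('n) \<le> exp (- (norm y)\<^sup>2 / (2 * (?e + 1))) / 1"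
        using s less_le_trans[OF zero_less_one s] by (intro divide_left_mono) auto
      then show ?thesis by simp
    qed
    also have "\<dots> \<le> exp (- (norm y)\<^sup>2 / 4)"
    proof -
      have "2 * (?e + 1) \<le> 4" by (simp add: divide_le_eq)
      then have "(norm y)\<^sup>2 / 4 \<le> (norm y)\<^sup>2 / (2 * (?e + 1))"
        by (intro divide_left_mono) (auto simp del: of_nat_Suc simp: add_pos_pos)
      then show ?thesis by simp
    qed
    finally show ?thesis .
  qed
  have A: "(\<lambda>n. \<integral>\<^sup>+y. ennreal ((norm (me n y - m y))\<^sup>2) \<partial>lborel) \<longlonglongrightarrow> (\<integral>\<^sup>+(y::real^'n). 0 \<partial>lborel)"
  proof (rule nn_integral_dominated_convergence)
    show "AE y in lborel. ennreal ((norm (me n y - m y))\<^sup>2) \<le> ennreal (4 * exp (- 1 * (norm y)\<^sup>2 / 2))" for n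
    proof (intro AE_I2 ennreal_leI)
      fix y :: "real ^ 'n"
      have "exp (- (norm y)\<^sup>2 / 2) \<le> exp (- (norm y)\<^sup>2 / 4)" by simp
      then have "norm (me n y - m y) \<le> 2 * exp (- (norm y)\<^sup>2 / 4)"
        using me_bound[of n y] bd[of y] norm_triangle_ineq4[of "me n y" "m y"] by linarith
      then have "(norm (me n y - m y))\<^sup>2 \<le> (2 * exp (- (norm y)\<^sup>2 / 4))\<^sup>2" by (rule power_mono) simp
      also have "\<dots> = 4 * exp (- 1 * (norm y)\<^sup>2 / 2)" by (simp add: power_mult_distrib flip: exp_double)
      finally show "(norm (me n y - m y))\<^sup>2 \<le> 4 * exp (- 1 * (norm y)\<^sup>2 / 2)" .
    qed
    show "(\<integral>\<^sup>+y. ennreal (4 * exp (- 1 * (norm (y::real^'n))\<^sup>2 / 2)) \<partial>lborel) < \<infinity>"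
      using integrable_mult_right[OF integrable_exp_norm[of 1, where 'a="real^'n"], of 4]
      by (subst nn_integral_eq_integral) auto
    show "AE y in lborel. (\<lambda>n. ennreal ((norm (me n y - m y))\<^sup>2)) \<longlonglongrightarrow> 0"
    proof (intro AE_I2)
      fix y
      have "(\<lambda>n. me n y) \<longlonglongrightarrow> m y" unfolding me_def
        using gauss_average_tendsto[of m 1 y] bd1 cont by (simp add: continuous_on_eq_continuous_at)
      then have "(\<lambda>n. ennreal ((norm (me n y - m y))\<^sup>2)) \<longlonglongrightarrow> ennreal ((norm (m y - m y))\<^sup>2)"
        by (intro tendsto_intros)
      then show "(\<lambda>n. ennreal ((norm (me n y - m y))\<^sup>2)) \<longlonglongrightarrow> 0" by simp
    qed
  qed auto
  have G: "(\<lambda>n. \<integral>\<^sup>+x. ennreal ((norm (g x - ge n x))\<^sup>2) \<partial>lborel) \<longlonglongrightarrow> (\<integral>\<^sup>+(x::real^'n). 0 \<partial>lborel)"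
  proof (rule nn_integral_dominated_convergence)
    show "AE x in lborel. ennreal ((norm (g x - ge n x))\<^sup>2) \<le> ennreal ((norm (g x))\<^sup>2)" for n
    proof (intro AE_I2 ennreal_leI power_mono)
      fix x
      have "g x - ge n x = of_real (1 - E n x) * g x" by (simp add: ge_def algebra_simps)
      then show "norm (g x - ge n x) \<le> norm (g x)"
        using E1[of n x] by (simp only: norm_mult norm_of_real) (simp add: mult_left_le_one_le)
    qed simp
    show "(\<integral>\<^sup>+x. ennreal ((norm (g x))\<^sup>2) \<partial>lborel) < \<infinity>" using gL2 by (simp add: L2_iff)
    show "AE x in lborel. (\<lambda>n. ennreal ((norm (g x - ge n x))\<^sup>2)) \<longlonglongrightarrow> 0"
    proof (intro AE_I2)
      fix x
      have "(\<lambda>n. E n x) \<longlonglongrightarrow> exp (- 0 * (norm x)\<^sup>2 / 2)"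
        unfolding E_def by (intro tendsto_intros LIMSEQ_Suc lim_1_over_n) auto
      then have "(\<lambda>n. ennreal ((norm (g x - of_real (E n x) * g x))\<^sup>2)) \<longlonglongrightarrow> ennreal ((norm (g x - of_real (exp (- 0 * (norm x)\<^sup>2 / 2)) * g x))\<^sup>2)"
        by (intro tendsto_intros)
      then show "(\<lambda>n. ennreal ((norm (g x - ge n x))\<^sup>2)) \<longlonglongrightarrow> 0" by (simp add: ge_def)
    qed
  qed auto
  note gL2[measurable]
  let ?T = "\<lambda>R. \<integral>\<^sup>+x. ennreal ((norm (indicator (- ball 0 R) x *\<^sub>R g x))\<^sup>2) \<partial>lborel"
  \<comment> \<open>\<open>R\<close> stays fixed while \<open>n\<close> tends to infinity. The
    factors 2 come from splitting the error twice, through \<open>me n\<close> and through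
    \<open>ge n\<close>; both errors that depend on \<open>n\<close> vanish and only the tail of
    \<open>g\<close> remains.\<close>
  have X: "(\<integral>\<^sup>+ y. ennreal ((norm (truncated_fourier R g y - m y))\<^sup>2) \<partial>lborel) \<le> 2 * (2 * ?T R)" for R
  proof -
    have le: "(\<integral>\<^sup>+ y. ennreal ((norm (truncated_fourier R g y - m y))\<^sup>2) \<partial>lborel) \<le>
       2 * (2 * ?T R + 2 * (\<integral>\<^sup>+x. ennreal ((norm (g x - ge n x))\<^sup>2) \<partial>lborel)) + 2 * (\<integral>\<^sup>+y. ennreal ((norm (me n y - m y))\<^sup>2) \<partial>lborel)" for n
    proof -
      have "(\<integral>\<^sup>+ y. ennreal ((norm (truncated_fourier R g y - m y))\<^sup>2) \<partial>lborel) =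
        (\<integral>\<^sup>+ y. ennreal ((norm ((truncated_fourier R g y - me n y) + (me n y - m y)))\<^sup>2) \<partial>lborel)" by simp
      also have "\<dots> \<le> 2 * (\<integral>\<^sup>+ y. ennreal ((norm (truncated_fourier R g y - me n y))\<^sup>2) \<partial>lborel) + 2 * (\<integral>\<^sup>+y. ennreal ((norm (me n y - m y))\<^sup>2) \<partial>lborel)"
        by (rule nn_integral_norm_add_sq_le) auto
      finally have le0: "(\<integral>\<^sup>+ y. ennreal ((norm (truncated_fourier R g y - m y))\<^sup>2) \<partial>lborel) \<le> 2 * (\<integral>\<^sup>+ y. ennreal ((norm (truncated_fourier R g y - me n y))\<^sup>2) \<partial>lborel) + 2 * (\<integral>\<^sup>+y. ennreal ((norm (me n y - m y))\<^sup>2) \<partial>lborel)" .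
      have "(\<integral>\<^sup>+ y. ennreal ((norm (truncated_fourier R g y - me n y))\<^sup>2) \<partial>lborel) =
         (\<integral>\<^sup>+ y. ennreal ((norm (ft (\<lambda>x. indicator (ball 0 R) x *\<^sub>R g x - ge n x) y))\<^sup>2) \<partial>lborel)"
        by (simp add: truncated_fourier_eq ft_ge[symmetric] ft_diff L2_integrable_ball gL2 ge)
      also have "\<dots> \<le> (\<integral>\<^sup>+ x. ennreal ((norm (indicator (ball 0 R) x *\<^sub>R g x - ge n x))\<^sup>2) \<partial>lborel)"
        by (intro plancherel_le Bochner_Integration.integrable_diff L2_integrable_ball gL2 ge)
      also have "\<dots> = (\<integral>\<^sup>+ x. ennreal ((norm (- (indicator (- ball 0 R) x *\<^sub>R g x) + (g x - ge n x)))\<^sup>2) \<partial>lborel)"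
        by (intro nn_integral_cong) (auto simp: indicator_def)
      also have "\<dots> \<le> 2 * (\<integral>\<^sup>+ x. ennreal ((norm (- (indicator (- ball 0 R) x *\<^sub>R g x)))\<^sup>2) \<partial>lborel) + 2 * (\<integral>\<^sup>+x. ennreal ((norm (g x - ge n x))\<^sup>2) \<partial>lborel)"
        by (rule nn_integral_norm_add_sq_le) auto
      finally have "(\<integral>\<^sup>+ y. ennreal ((norm (truncated_fourier R g y - me n y))\<^sup>2) \<partial>lborel) \<le> 2 * ?T R + 2 * (\<integral>\<^sup>+x. ennreal ((norm (g x - ge n x))\<^sup>2) \<partial>lborel)"
        by (simp only: norm_minus_cancel)
      then show ?thesis
        by (intro order_trans[OF le0] add_mono mult_left_mono order_refl) auto
    qed
    have "(\<lambda>n. 2 * (2 * ?T R + 2 * (\<integral>\<^sup>+x. ennreal ((norm (g x - ge n x))\<^sup>2) \<partial>lborel)) + 2 * (\<integral>\<^sup>+y. ennreal ((norm (me n y - m y))\<^sup>2) \<partial>lborel))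
      \<longlonglongrightarrow> 2 * (2 * ?T R + 2 * (\<integral>\<^sup>+(x::real^'n). 0 \<partial>lborel)) + 2 * (\<integral>\<^sup>+(x::real^'n). 0 \<partial>lborel)"
      by (intro tendsto_add tendsto_const ennreal_tendsto_cmult A G) auto
    from tendsto_lowerbound[OF this, of "\<integral>\<^sup>+ y. ennreal ((norm (truncated_fourier R g y - m y))\<^sup>2) \<partial>lborel"] le
    show ?thesis by simp
  qed
  have T0: "((\<lambda>R. 2 * (2 * ?T R)) \<longlongrightarrow> 2 * (2 * 0)) at_top"
    by (intro ennreal_tendsto_cmult L2_tail gL2) auto
  have "((\<lambda>R. \<integral>\<^sup>+ y. ennreal ((norm (truncated_fourier R g y - m y))\<^sup>2) \<partial>lborel) \<longlongrightarrow> 0) at_top"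
  proof (rule tendsto_sandwich[OF _ _ tendsto_const])
    show "\<forall>\<^sub>F R in at_top. (\<integral>\<^sup>+ y. ennreal ((norm (truncated_fourier R g y - m y))\<^sup>2) \<partial>lborel) \<le> 2 * (2 * ?T R)"
      by (intro always_eventually allI X)
    show "((\<lambda>R. 2 * (2 * ?T R)) \<longlongrightarrow> 0) at_top" using T0 by (simp only: mult_zero_right)
  qed simp
  then show ?thesis
    using gL2 mL2 unfolding L2_fourier_def g_def[abs_def] by blast
qed

section \<open>Averages over random translations, and Gaussian averages as a separating
  family\<close>

lemma integrable_average:
  fixes g :: "'a::euclidean_space \<Rightarrow> complex"
  assumes N: "finite_measure N" "sets N = sets borel" and g: "integrable lborel g"
  shows "integrable (lborel \<Otimes>\<^sub>M N) (\<lambda>(x, z). g (x + z))"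
    and "integrable lborel (\<lambda>x. LINT z|N. g (x + z))"
proof -
  interpret finite_measure N by fact
  interpret pair_sigma_finite lborel N ..
  note [measurable_cong] = N(2)
  have [measurable]: "g \<in> borel_measurable borel" using g by auto
  have finN: "emeasure N (space N) < top" by (metis emeasure_finite infinity_ennreal_def less_top)
  have "(\<integral>\<^sup>+p. ennreal (norm (case p of (x, z) \<Rightarrow> g (x + z))) \<partial>(lborel \<Otimes>\<^sub>M N)) = (\<integral>\<^sup>+z. \<integral>\<^sup>+x. ennreal (norm (g (x + z))) \<partial>lborel \<partial>N)"
    by (subst nn_integral_snd[symmetric]) auto
  also have "(\<lambda>z. \<integral>\<^sup>+x. ennreal (norm (g (x + z))) \<partial>lborel) = (\<lambda>z. \<integral>\<^sup>+x. ennreal (norm (g x)) \<partial>lborel)"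
    using nn_integral_lborel_affine[of 1 "\<lambda>x. ennreal (norm (g x))"] by (simp add: add.commute)
  also have "(\<integral>\<^sup>+z. \<integral>\<^sup>+x. ennreal (norm (g x)) \<partial>lborel \<partial>N) < \<infinity>"
    using g finN by (simp add: integrable_iff_bounded ennreal_mult_less_top)
  finally show i: "integrable (lborel \<Otimes>\<^sub>M N) (\<lambda>(x, z). g (x + z))"
    by (subst integrable_iff_bounded) simp
  from integrable_fst'[OF this] show "integrable lborel (\<lambda>x. LINT z|N. g (x + z))" by simp
qed

text \<open>The average is the convolution of \<open>g\<close> with the reflected measure, so its
  transform is \<open>ft g\<close> times the characteristic function of \<open>N\<close> with a
  positive sign in \<open>cis\<close>.\<close>

lemma ft_average:
  fixes g :: "real ^ 'n::finite \<Rightarrow> complex"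
  assumes N: "finite_measure N" "sets N = sets borel" and g: "integrable lborel g"
  shows "ft (\<lambda>x. LINT z|N. g (x + z)) y = ft g y * (LINT z|N. cis (y \<bullet> z))"
proof -
  interpret finite_measure N by fact
  interpret pair_sigma_finite lborel N ..
  note [measurable_cong] = N(2)
  have [measurable]: "g \<in> borel_measurable borel" using g by auto
  define I where "I = (LINT x|lborel. cis (- (y \<bullet> x)) * g x)"
  have "integrable (lborel \<Otimes>\<^sub>M N) (\<lambda>(x, z). cis (- (y \<bullet> x)) * g (x + z))"
    by (rule Bochner_Integration.integrable_bound[OF integrable_average(1)[OF N g]]) (auto simp: norm_mult)
  from Fubini_integral[OF this]
  have "(LINT x|lborel. cis (- (y \<bullet> x)) * (LINT z|N. g (x + z))) = (LINT z|N. LINT x|lborel. cis (- (y \<bullet> x)) * g (x + z))"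
    by simp
  also have "\<dots> = (LINT z|N. cis (y \<bullet> z) * I)"
  proof (intro Bochner_Integration.integral_cong refl)
    fix z
    have "I = (LINT x|lborel. cis (- (y \<bullet> (z + x))) * g (z + x))"
      unfolding I_def by (subst integral_lborel_affine[of 1 _ z]) simp_all
    also have "\<dots> = (LINT x|lborel. cis (- (y \<bullet> z)) * (cis (- (y \<bullet> x)) * g (x + z)))"
      by (intro Bochner_Integration.integral_cong refl) (simp add: inner_add_right cis_mult mult.assoc[symmetric] add.commute)
    finally have "cis (y \<bullet> z) * I = (cis (y \<bullet> z) * cis (- (y \<bullet> z))) * (LINT x|lborel. cis (- (y \<bullet> x)) * g (x + z))"
      by (simp add: mult.assoc)
    then show "(LINT x|lborel. cis (- (y \<bullet> x)) * g (x + z)) = cis (y \<bullet> z) * I"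
      by (simp add: cis_mult)
  qed
  also have "\<dots> = I * (LINT z|N. cis (y \<bullet> z))"
    by (simp add: mult.commute)
  finally show ?thesis by (simp add: ft_def I_def)
qed

text \<open>Averages against ever narrower Gaussians converge to the values of a bounded continuous
  function and so determine it at every point. This turns equality of \<open>L2\<close> transforms
  into a pointwise identity.\<close>

lemma gauss_average_inj:
  fixes f g :: "real ^ 'n::finite \<Rightarrow> real"
  assumes f: "continuous_on UNIV f" "bounded (range f)" and g: "continuous_on UNIV g" "bounded (range g)"
    and eq: "\<And>\<epsilon> z. \<epsilon> > 0 \<Longrightarrow> (LINT x|lborel. complex_of_real (gauss \<epsilon> (z - x)) * of_real (f x)) = (LINT x|lborel. of_real (gauss \<epsilon> (z - x)) * of_real (g x))"
  shows "f z = g z"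
proof -
  have *: "(\<lambda>n. LINT x|lborel. of_real (gauss (1 / real (Suc n)) (z - x)) * complex_of_real (h x)) \<longlonglongrightarrow> of_real (h z)"
    if h: "continuous_on UNIV h" "bounded (range h)" for h
  proof -
    obtain b where b: "\<And>x. norm (h x) \<le> b" using h(2) by (auto simp: bounded_iff)
    have "isCont (\<lambda>x. complex_of_real (h x)) z"
      using h(1) by (intro continuous_intros) (simp add: continuous_on_eq_continuous_at)
    with b show ?thesis
      by (intro gauss_average_tendsto[where b=b]) (auto intro!: borel_measurable_continuous_onI h)
  qed
  have "complex_of_real (f z) = of_real (g z)"
    by (rule LIMSEQ_unique[OF *[OF f]]) (use *[OF g] eq in simp)
  then show ?thesis by simp
qed

section \<open>The law of the process\<close>

lemma Phi_nonneg:
  assumes "0 < \<alpha>" "0 \<le> m" "0 \<le> z"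
  shows "0 \<le> Phi m \<alpha> z"
proof -
  have "m = (m powr (2 / \<alpha>)) powr (\<alpha> / 2)"
    using assms by (cases "m = 0") (auto simp: powr_powr)
  also have "\<dots> \<le> (z + m powr (2 / \<alpha>)) powr (\<alpha> / 2)"
    using assms by (intro powr_mono2) auto
  finally show ?thesis by (simp add: Phi_def)
qed

text \<open>Dropping the mass inside the power leaves growth of order \<open>\<alpha>\<close>, which
  makes the characteristic function integrable at positive times.\<close>

lemma Phi_ge: 
  assumes "0 < \<alpha>" "0 \<le> m" 
  shows "norm y powr \<alpha> - m \<le> Phi m \<alpha> ((norm y)\<^sup>2)"
proof -
  have "norm y powr \<alpha> = ((norm y)\<^sup>2) powr (\<alpha> / 2)"
  proof (cases "y = 0")
    case False
    then have "(norm y)\<^sup>2 = norm y powr 2" using powr_realpow[of "norm y" 2] by simp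
    then show ?thesis by (simp only: powr_powr) simp
  qed simp
  also have "\<dots> \<le> ((norm y)\<^sup>2 + m powr (2 / \<alpha>)) powr (\<alpha> / 2)"
    using assms by (intro powr_mono2) auto
  finally show ?thesis by (simp add: Phi_def)
qed

lemma continuous_on_Phi:
  assumes "0 < \<alpha>" "0 \<le> m"
  shows "continuous_on A (\<lambda>y. Phi m \<alpha> ((norm y)\<^sup>2))"
  unfolding Phi_def using assms by (intro continuous_intros continuous_on_powr') auto

lemma borel_measurable_Phi[measurable]: "Phi m \<alpha> \<in> borel_measurable borel"
  unfolding Phi_def[abs_def] by measurable

lemma bounded_continuous_eq_of_AE:
  fixes f g :: "'a::euclidean_space \<Rightarrow> complex"
  assumes f: "continuous_on UNIV f" "\<And>x. norm (f x) \<le> b" and g: "continuous_on UNIV g" "\<And>x. norm (g x) \<le> b"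
    and eq: "AE x in lborel. f x = g x"
  shows "f z = g z"
proof (rule LIMSEQ_unique)
  have [measurable]: "f \<in> borel_measurable borel" "g \<in> borel_measurable borel"
    using f g by (auto intro: borel_measurable_continuous_onI)
  have c: "isCont f z" "isCont g z" using f g by (auto simp: continuous_on_eq_continuous_at)
  show "(\<lambda>n. LINT x|lborel. of_real (gauss (1 / real (Suc n)) (z - x)) * f x) \<longlonglongrightarrow> f z"
    by (rule gauss_average_tendsto[OF _ f(2) c(1)]) simp
  have "(LINT x|lborel. of_real (gauss (1 / real (Suc n)) (z - x)) * f x) = (LINT x|lborel. of_real (gauss (1 / real (Suc n)) (z - x)) * g x)" for n
    by (rule integral_cong_AE) (use eq in auto)
  then show "(\<lambda>n. LINT x|lborel. of_real (gauss (1 / real (Suc n)) (z - x)) * f x) \<longlonglongrightarrow> g z"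
    using gauss_average_tendsto[OF _ g(2) c(2)] by simp
qed

lemma ft_exp_norm: "ft (\<lambda>x. of_real (exp (- (norm x)\<^sup>2 / 2))) = (\<lambda>y. of_real (exp (- (norm (y :: real ^ 'n::finite))\<^sup>2 / 2)))"
proof
  fix y :: "real ^ 'n"
  define k where "k = (2 * pi) powr (- real CARD('n) / 2)"
  have sq: "(2 * pi) ^ CARD('n) = sqrt (2 * pi) ^ CARD('n) * sqrt (2 * pi) ^ CARD('n)"
    using power_mult_distrib[of "sqrt (2 * pi)" "sqrt (2 * pi)" "CARD('n)"] by simp
  have k: "k = 1 / sqrt (2 * pi) ^ CARD('n)"
  proof (rule power2_eq_imp_eq)
    show "k\<^sup>2 = (1 / sqrt (2 * pi) ^ CARD('n))\<^sup>2"
      unfolding k_def ft_const_sq sq by (simp add: power2_eq_square)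
  qed (auto simp: k_def)
  have "(LINT x|lborel. cis (- (y \<bullet> x)) * of_real (exp (- (norm x)\<^sup>2 / 2))) = of_real ((2 * pi) ^ CARD('n) * gauss 1 y)"
    using gauss_inversion[of 1 "- y"] by (simp add: inner_commute mult.commute)
  then have "ft (\<lambda>x. of_real (exp (- (norm x)\<^sup>2 / 2))) y = of_real (k * ((2 * pi) ^ CARD('n) * gauss 1 y))"
    unfolding ft_def k_def by simp
  also have "k * ((2 * pi) ^ CARD('n) * gauss 1 y) = exp (- (norm y)\<^sup>2 / 2)"
    unfolding sq k by (simp add: gauss_def)
  finally show "ft (\<lambda>x. of_real (exp (- (norm x)\<^sup>2 / 2))) y = of_real (exp (- (norm y)\<^sup>2 / 2))" .
qed

lemma continuous_on_char:
  fixes N :: "'a::euclidean_space measure"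
  assumes N: "finite_measure N" "sets N = sets borel"
  shows "continuous_on UNIV (\<lambda>y. LINT z|N. cis (y \<bullet> z))"
proof -
  interpret finite_measure N by fact
  note [measurable_cong] = N(2)
  show ?thesis
    unfolding continuous_on_sequentially comp_def
  proof (intro ballI allI impI)
    fix u :: "nat \<Rightarrow> 'a" and a assume "(\<forall>n. u n \<in> UNIV) \<and> u \<longlonglongrightarrow> a"
    then have u: "u \<longlonglongrightarrow> a" by simp
    show "(\<lambda>n. LINT z|N. cis (u n \<bullet> z)) \<longlonglongrightarrow> (LINT z|N. cis (a \<bullet> z))"
      by (rule integral_dominated_convergence[where w="\<lambda>_. 1"])
         (auto intro!: AE_I2 tendsto_intros u simp: cis_conv_exp)
  qed
qed

locale relativistic_process =
  fixes m \<alpha> :: real and M :: "'w measure" and X :: "real \<Rightarrow> 'w \<Rightarrow> real ^ 'n::finite"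
  assumes \<alpha>: "0 < \<alpha>" "\<alpha> < 2" and m: "0 \<le> m"
    and gen: "levy_process_generated_by_minus_L m \<alpha> M X"
begin

sublocale prob_space M
  using gen by (simp add: levy_process_generated_by_minus_L_def levy_process_def)

lemma X_measurable[measurable]: "0 \<le> t \<Longrightarrow> X t \<in> borel_measurable M"
  using gen by (simp add: levy_process_generated_by_minus_L_def levy_process_def)

text \<open>The semigroup is tested on the single function \<open>f\<close>, a Gaussian that is its
  own transform. Averaging over the law multiplies the transform by the characteristic function, the
  semigroup multiplies it by \<open>h\<close>. Since \<open>f\<close> has no zeros, the two factors
  agree almost everywhere and, being continuous, everywhere.\<close>

lemma char_X:
  assumes t: "0 \<le> t"
  shows "(LINT \<omega>|M. cis (y \<bullet> X t \<omega>)) = of_real (exp (- t * Phi m \<alpha> ((norm y)\<^sup>2)))"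
proof -
  note [measurable] = X_measurable[OF t]
  define N where "N = distr M borel (X t)"
  have N: "finite_measure N" "sets N = sets borel" "prob_space N"
    unfolding N_def by (auto intro!: prob_space_distr finite_measure_distr)
  interpret N: prob_space N by fact
  note [measurable_cong] = N(2)
  define f where "f x = complex_of_real (exp (- (norm (x::real^'n))\<^sup>2 / 2))" for x
  define h where "h y = exp (- t * Phi m \<alpha> ((norm (y::real^'n))\<^sup>2))" for y
  have h: "0 \<le> h y" "h y \<le> 1" for y
    using Phi_nonneg[OF \<alpha>(1) m, of "(norm y)\<^sup>2"] t by (auto simp: h_def)
  have hc: "continuous_on UNIV (\<lambda>y. complex_of_real (h y))"
    unfolding h_def by (intro continuous_intros continuous_on_Phi \<alpha> m)
  have fc: "continuous_on UNIV f" unfolding f_def by (auto intro!: continuous_intros)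
  then have [measurable]: "f \<in> borel_measurable borel" by (rule borel_measurable_continuous_onI)
  have f1: "norm (f x) \<le> 1" for x by (simp add: f_def)
  have fi: "integrable lborel f"
    unfolding f_def using integrable_exp_norm[of 1, where 'a="real^'n"] by (intro integrable_of_real) simp
  have ftf: "ft f = f" unfolding f_def by (rule ft_exp_norm)
  have ff: "L2_fourier f f"
    using L2_fourier_ft[OF fi bounded_integrable_L2[OF fi f1]] by (simp add: ftf)
  define k where "k y = of_real (h y) * f y" for y
  \<comment> \<open>The hypothesis on the generator speaks only of pairs in the graph of the
    semigroup; Fourier inversion supplies the partner of \<open>f\<close>, with transform
    \<open>k\<close>.\<close>
  have gk: "L2_fourier (\<lambda>x. ft k (- x)) k"
  proof (rule L2_fourier_inversion)
    show "continuous_on UNIV k" unfolding k_def[abs_def] by (intro continuous_intros hc fc)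
    show "norm (k y) \<le> exp (- (norm y)\<^sup>2 / 2)" for y
      using h[of y] by (simp add: k_def f_def norm_mult mult_left_le_one_le del: minus_divide_left)
  qed
  define Pf where "Pf x = (LINT z|N. f (x + z))" for x
  have Pfi: "integrable lborel Pf" unfolding Pf_def by (rule integrable_average[OF N(1,2) fi])
  have "norm (Pf x) \<le> 1" for x
  proof -
    have "norm (Pf x) \<le> (LINT z|N. 1)"
      unfolding Pf_def
      by (rule Bochner_Integration.integral_norm_bound_integral)
         (auto intro!: N.integrable_const_bound[where B=1] f1)
    then show ?thesis by (simp add: N.prob_space)
  qed
  then have PfL: "Pf \<in> L2" by (rule bounded_integrable_L2[OF Pfi])
  have "L_semigroup m \<alpha> t f (\<lambda>x. ft k (- x))"
    unfolding L_semigroup_def fourier_multiplier_def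
    by (intro exI[of _ f] exI[of _ k] conjI ff gk) (simp add: k_def h_def)
  then have "AE x in lborel. (LINT \<omega>|M. f (shifted x X t \<omega>)) = ft k (- x)"
    using gen t unfolding levy_process_generated_by_minus_L_def by blast
  then have "AE x in lborel. Pf x = ft k (- x)"
    by (simp add: Pf_def N_def integral_distr shifted_def)
  from L2_fourier_unique[OF L2_fourier_ft[OF Pfi PfL] gk this]
  have "AE y in lborel. ft Pf y = k y" .
  then have "AE y in lborel. f y * (LINT z|N. cis (y \<bullet> z)) = k y"
    unfolding Pf_def ft_average[OF N(1,2) fi] ftf .
  then have AE: "AE y in lborel. (LINT z|N. cis (y \<bullet> z)) = of_real (h y)"
    by eventually_elim (simp add: k_def f_def)
  have "(LINT z|N. cis (y \<bullet> z)) = of_real (h y)"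
  proof (rule bounded_continuous_eq_of_AE[OF continuous_on_char[OF N(1,2)] _ hc _ AE])
    show "norm (LINT z|N. cis (y \<bullet> z)) \<le> 1" for y
      using integral_norm_bound[of N "\<lambda>z. cis (y \<bullet> z)"] by (simp add: N.prob_space)
    show "norm (complex_of_real (h y)) \<le> 1" for y using h[of y] by simp
  qed
  then show ?thesis by (simp add: N_def integral_distr h_def)
qed

end

section \<open>Right-continuous modification and Markov property\<close>

lemma exp_powr_bound:
  fixes c \<alpha> :: real
  assumes c: "c > 0" and a: "\<alpha> > 0"
  obtains K where "\<And>r. exp (- c * \<bar>r\<bar> powr \<alpha>) \<le> K * inverse (1 + r\<^sup>2)"
proof -
  \<comment> \<open>With \<open>\<alpha> * real k \<ge> 2\<close> the term of order \<open>k\<close>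
    in the exponential series already dominates a multiple of \<open>r\<^sup>2\<close> for large
    \<open>r\<close>, which gives the decay of a Cauchy density.\<close>
  obtain k :: nat where k: "2 / \<alpha> \<le> real k" using real_arch_simple by blast
  then have k': "2 \<le> \<alpha> * real k" using a by (simp add: field_simps)
  define K where "K = 2 * (1 + fact k / c ^ k)"
  have K2: "K \<ge> 2" using c by (simp add: K_def)
  have "exp (- c * \<bar>r\<bar> powr \<alpha>) \<le> K * inverse (1 + r\<^sup>2)" for r
  proof (cases "\<bar>r\<bar> \<le> 1")
    case True
    have "1 + r\<^sup>2 \<le> 2" using True abs_square_le_1 by auto
    have "1 + r\<^sup>2 \<le> K" using \<open>1 + r\<^sup>2 \<le> 2\<close> K2 by linarith
    then have "1 \<le> K * inverse (1 + r\<^sup>2)" by (simp add: field_simps add_pos_nonneg)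
    moreover have "exp (- c * \<bar>r\<bar> powr \<alpha>) \<le> 1" using c by simp
    ultimately show ?thesis by linarith
  next
    case False
    define s where "s = c * \<bar>r\<bar> powr \<alpha>"
    have s: "s > 0" using False c by (auto simp: s_def)
    have "s ^ k / fact k \<le> exp s"
      using sum_le_suminf[OF summable_exp[of s], of "{k}"] s by (simp add: exp_def field_simps)
    then have e: "exp (- s) \<le> fact k / s ^ k"
      using s by (simp add: exp_minus field_simps)
    have "\<bar>r\<bar> powr 2 \<le> \<bar>r\<bar> powr (\<alpha> * real k)" using False k' by (intro powr_mono) auto
    also have "\<dots> = (\<bar>r\<bar> powr \<alpha>) ^ k" using False by (simp add: powr_powr[symmetric] powr_realpow)
    finally have "r\<^sup>2 \<le> (\<bar>r\<bar> powr \<alpha>) ^ k" using False by simp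
    then have "c ^ k * r\<^sup>2 \<le> s ^ k" using c by (simp add: s_def power_mult_distrib)
    then have "fact k / s ^ k \<le> fact k / (c ^ k * r\<^sup>2)"
      using c False s by (intro divide_left_mono) (auto intro!: mult_pos_pos)
    with e have e2: "exp (- s) \<le> fact k / c ^ k * (1 / r\<^sup>2)" by simp
    have r1: "1 \<le> r\<^sup>2" using False one_le_power[of "\<bar>r\<bar>" 2] by simp
    have "2 / (2 * r\<^sup>2) \<le> 2 / (1 + r\<^sup>2)" using r1 by (intro divide_left_mono mult_pos_pos; linarith)
    then have "1 / r\<^sup>2 \<le> 2 * inverse (1 + r\<^sup>2)" by (simp add: inverse_eq_divide)
    then have "fact k / c ^ k * (1 / r\<^sup>2) \<le> fact k / c ^ k * (2 * inverse (1 + r\<^sup>2))"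
      using c by (intro mult_left_mono) auto
    also have "\<dots> \<le> K * inverse (1 + r\<^sup>2)"
      unfolding mult.assoc[symmetric] by (intro mult_right_mono) (auto simp: K_def mult.commute)
    finally show ?thesis using e2 by (simp add: s_def)
  qed
  then show ?thesis by (rule that)
qed

text \<open>Every coordinate is bounded by the norm, so with \<open>d = c / real DIM('a)\<close> the
  function is dominated by a product of one-dimensional functions that decay like a Cauchy
  density.\<close>

lemma integrable_exp_norm_powr:
  assumes c: "c > 0" and a: "\<alpha> > 0"
  shows "integrable lborel (\<lambda>w::'a::euclidean_space. exp (- c * norm w powr \<alpha>))"
proof -
  define d where "d = c / real DIM('a)"
  have d: "d > 0" using c by (simp add: d_def)
  obtain K where K: "\<And>r. exp (- d * \<bar>r\<bar> powr \<alpha>) \<le> K * inverse (1 + r\<^sup>2)"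
    using exp_powr_bound[OF d a] by blast
  have "integrable lborel (\<lambda>r::real. K * inverse (1 + r\<^sup>2))"
    using integrable_inverse_1_plus_square by (simp add: set_integrable_def)
  then have "integrable lborel (\<lambda>w::'a. \<Prod>b\<in>Basis. K * inverse (1 + (w \<bullet> b)\<^sup>2))"
    by (intro integrable_lborel_prod) 
  then show ?thesis
  proof (rule Bochner_Integration.integrable_bound)
    show "AE w in lborel. norm (exp (- c * norm (w::'a) powr \<alpha>)) \<le> norm (\<Prod>b\<in>Basis. K * inverse (1 + (w \<bullet> b)\<^sup>2))"
    proof (intro AE_I2)
      fix w :: 'a
      have "(\<Sum>b\<in>(Basis::'a set). d * \<bar>w \<bullet> b\<bar> powr \<alpha>) \<le> (\<Sum>b\<in>(Basis::'a set). d * norm w powr \<alpha>)"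
        using a d by (intro sum_mono mult_left_mono powr_mono2) (auto simp: Basis_le_norm)
      also have "\<dots> = c * norm w powr \<alpha>" by (simp add: d_def)
      finally have "exp (- c * norm w powr \<alpha>) \<le> exp (\<Sum>b\<in>(Basis::'a set). - d * \<bar>w \<bullet> b\<bar> powr \<alpha>)"
        by (simp add: sum_negf)
      also have "\<dots> = (\<Prod>b\<in>(Basis::'a set). exp (- d * \<bar>w \<bullet> b\<bar> powr \<alpha>))" by (simp add: exp_sum)
      also have "\<dots> \<le> (\<Prod>b\<in>(Basis::'a set). K * inverse (1 + (w \<bullet> b)\<^sup>2))" by (intro prod_mono) (use K in auto)
      finally show "norm (exp (- c * norm w powr \<alpha>)) \<le> norm (\<Prod>b\<in>Basis. K * inverse (1 + (w \<bullet> b)\<^sup>2))" by simp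
    qed
  qed measurable
qed

context relativistic_process
begin

text \<open>The characteristic function decays like \<open>exp (- t * norm w powr \<alpha>)\<close>,
  hence is integrable, and \<open>null_set_of_integrable_char\<close> applies. The consequence used
  later is that spheres and hyperplanes are not charged.\<close>

lemma X_null:
  assumes t: "0 < t" and A[measurable]: "A \<in> sets borel" and A0: "emeasure lborel A = 0"
  shows "emeasure M {\<omega>\<in>space M. X t \<omega> \<in> A} = 0"
proof -
  note [measurable] = X_measurable[OF less_imp_le[OF t]]
  define N where "N = distr M borel (X t)"
  have N: "finite_measure N" "sets N = sets borel"
    unfolding N_def by (auto intro!: finite_measure_distr)
  have ch: "(LINT x|N. cis (- (w \<bullet> x))) = of_real (exp (- t * Phi m \<alpha> ((norm w)\<^sup>2)))" for w
    using char_X[OF less_imp_le[OF t], of "- w"] by (simp add: N_def integral_distr)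
  have "integrable lborel (\<lambda>w::real^'n. complex_of_real (exp (- t * Phi m \<alpha> ((norm w)\<^sup>2))))"
  proof (rule integrable_of_real, rule Bochner_Integration.integrable_bound)
    show "integrable lborel (\<lambda>w::real^'n. exp (t * m) * exp (- t * norm w powr \<alpha>))"
      by (intro integrable_mult_right integrable_exp_norm_powr t \<alpha>)
    show "AE w in lborel. norm (exp (- t * Phi m \<alpha> ((norm (w::real^'n))\<^sup>2))) \<le> norm (exp (t * m) * exp (- t * norm w powr \<alpha>))"
    proof (intro AE_I2)
      fix w :: "real ^ 'n"
      have "t * (norm w powr \<alpha> - m) \<le> t * Phi m \<alpha> ((norm w)\<^sup>2)"
        using t by (intro mult_left_mono Phi_ge \<alpha> m) auto
      then show "norm (exp (- t * Phi m \<alpha> ((norm w)\<^sup>2))) \<le> norm (exp (t * m) * exp (- t * norm w powr \<alpha>))"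
        by (simp add: exp_add[symmetric] algebra_simps)
    qed
  qed measurable
  then have "emeasure N A = 0"
    by (intro null_set_of_integrable_char[OF N _ A A0]) (simp add: ch)
  moreover have "X t -` A \<inter> space M = {\<omega>\<in>space M. X t \<omega> \<in> A}" by auto
  ultimately show ?thesis by (simp add: N_def emeasure_distr)
qed

text \<open>The set of paths that are cadlag and start at 0 need not be measurable, so a measurable
  subset of full measure is selected. The choice by \<open>SOME\<close> depends on \<open>M\<close>
  and \<open>X\<close> alone, which lets \<open>Y\<close> be named for several processes at
  once.\<close>

definition good :: "'w set" where
  "good = (SOME S. S \<in> sets M \<and> (AE \<omega> in M. \<omega> \<in> S) \<and> (\<forall>\<omega>\<in>S. X 0 \<omega> = 0 \<and> cadlag (\<lambda>t. X t \<omega>)))"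

lemma good: "good \<in> sets M" "AE \<omega> in M. \<omega> \<in> good" "\<omega> \<in> good \<Longrightarrow> X 0 \<omega> = 0" "\<omega> \<in> good \<Longrightarrow> cadlag (\<lambda>t. X t \<omega>)"
proof -
  have "AE \<omega> in M. X 0 \<omega> = 0 \<and> cadlag (\<lambda>t. X t \<omega>)"
    using gen unfolding levy_process_generated_by_minus_L_def levy_process_def by auto
  then obtain N where N: "\<And>\<omega>. \<omega> \<in> space M - N \<Longrightarrow> X 0 \<omega> = 0 \<and> cadlag (\<lambda>t. X t \<omega>)" "N \<in> null_sets M"
    by (rule AE_E3) blast
  have "\<exists>S. S \<in> sets M \<and> (AE \<omega> in M. \<omega> \<in> S) \<and> (\<forall>\<omega>\<in>S. X 0 \<omega> = 0 \<and> cadlag (\<lambda>t. X t \<omega>))"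
  proof (intro exI[of _ "space M - N"] conjI ballI N(1))
    show "AE \<omega> in M. \<omega> \<in> space M - N" using AE_not_in[OF N(2)] AE_space by eventually_elim auto
  qed (use N(2) N(1) in auto)
  from someI_ex[OF this, folded good_def]
  show "good \<in> sets M" "AE \<omega> in M. \<omega> \<in> good" "\<omega> \<in> good \<Longrightarrow> X 0 \<omega> = 0" "\<omega> \<in> good \<Longrightarrow> cadlag (\<lambda>t. X t \<omega>)"
    by auto
qed

text \<open>A modification of \<open>X\<close> all of whose paths are right-continuous, so that it is jointly measurable.\<close>

definition Y :: "real \<Rightarrow> 'w \<Rightarrow> real ^ 'n" where
  "Y t \<omega> = (if 0 < t \<and> \<omega> \<in> good then X t \<omega> else 0)"

lemma Y_0[simp]: "t \<le> 0 \<Longrightarrow> Y t \<omega> = 0"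
  by (simp add: Y_def)

lemma Y_eq_X: "\<omega> \<in> good \<Longrightarrow> 0 \<le> t \<Longrightarrow> Y t \<omega> = X t \<omega>"
  using good(3) by (cases "t = 0") (auto simp: Y_def)

lemma AE_Y_eq_X: "AE \<omega> in M. \<forall>t\<ge>0. Y t \<omega> = X t \<omega>"
  using good(2) by eventually_elim (simp add: Y_eq_X)

lemma Y_measurable[measurable]: "Y t \<in> borel_measurable M"
proof (cases "0 < t")
  case True
  note [measurable] = X_measurable[OF less_imp_le[OF True]] good(1)
  show ?thesis unfolding Y_def[abs_def] by measurable
next
  case False
  then have "Y t = (\<lambda>_. 0)" by (auto simp: Y_def)
  then show ?thesis by simp
qed

text \<open>Paths outside \<open>good\<close> are identically 0, and so is every path at negative
  times; hence there are neither exceptional paths nor exceptional times.\<close>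

lemma Y_right_cont: "((\<lambda>s. Y s \<omega>) \<longlongrightarrow> Y t \<omega>) (at_right t)"
proof (cases "t < 0")
  case True
  have "eventually (\<lambda>s. Y s \<omega> = Y t \<omega>) (at_right t)"
    using eventually_at_right_real[OF True] by eventually_elim (use True in auto)
  then show ?thesis by (rule tendsto_eventually)
next
  case False
  show ?thesis
  proof (cases "\<omega> \<in> good")
    case True
    have "((\<lambda>s. X s \<omega>) \<longlongrightarrow> X t \<omega>) (at_right t)"
      using good(4)[OF True] False by (simp add: cadlag_def)
    moreover have "eventually (\<lambda>s. X s \<omega> = Y s \<omega>) (at_right t)"
      using eventually_at_right_less[of t] by eventually_elim (use True False in \<open>simp add: Y_def\<close>)
    ultimately show ?thesis
      using Lim_transform_eventually Y_eq_X[OF True] False by fastforce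
  next
    case False
    then show ?thesis by (simp add: Y_def)
  qed
qed

text \<open>Times are rounded to a grid, which leaves countably many random variables for each mesh,
  and right continuity gives convergence. The \<open>+ 1\<close> in the rounding makes the grid
  point strictly larger than \<open>t\<close>, as a right limit requires.\<close>

lemma Y_joint_measurable: "(\<lambda>(t, \<omega>). Y t \<omega>) \<in> borel_measurable (borel \<Otimes>\<^sub>M M)"
proof -
  let ?q = "\<lambda>n t. (of_int \<lfloor>real (Suc n) * t\<rfloor> + 1) / real (Suc n)"
  have gt: "t < ?q n t" "?q n t \<le> t + 1 / real (Suc n)" for n t
  proof -
    have "real (Suc n) * t < of_int \<lfloor>real (Suc n) * t\<rfloor> + 1" by linarith
    then show "t < ?q n t" by (simp add: field_simps)
    have "of_int \<lfloor>real (Suc n) * t\<rfloor> \<le> real (Suc n) * t" by linarith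
    then have "?q n t \<le> (real (Suc n) * t + 1) / real (Suc n)" by (intro divide_right_mono) auto
    then show "?q n t \<le> t + 1 / real (Suc n)" by (simp add: add_divide_distrib del: of_nat_Suc)
  qed
  have q: "filterlim (\<lambda>n. ?q n t) (at_right t) sequentially" for t
  proof (rule tendsto_imp_filterlim_at_right)
    have "(\<lambda>n. t + 1 / real (Suc n)) \<longlonglongrightarrow> t + 0"
      by (intro tendsto_intros LIMSEQ_Suc lim_1_over_n)
    then have u: "(\<lambda>n. t + 1 / real (Suc n)) \<longlonglongrightarrow> t" by simp
    show "(\<lambda>n. ?q n t) \<longlonglongrightarrow> t"
      by (rule tendsto_sandwich[OF _ _ tendsto_const u])
         (intro always_eventually allI less_imp_le[OF gt(1)] gt(2))+
    show "\<forall>\<^sub>F n in sequentially. t < ?q n t" by (intro always_eventually allI gt(1))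
  qed
  show ?thesis
  proof (rule borel_measurable_LIMSEQ_metric)
    fix n :: nat
    have "(\<lambda>p. (\<lambda>i p. Y ((of_int i + 1) / real (Suc n)) (snd p)) \<lfloor>real (Suc n) * fst p\<rfloor> p) \<in> borel_measurable (borel \<Otimes>\<^sub>M M)"
      by (rule measurable_compose_countable) measurable
    then show "(\<lambda>p. Y (?q n (fst p)) (snd p)) \<in> borel_measurable (borel \<Otimes>\<^sub>M M)" by simp
  next
    fix p :: "real \<times> 'w"
    show "(\<lambda>n. Y (?q n (fst p)) (snd p)) \<longlonglongrightarrow> (case p of (t, \<omega>) \<Rightarrow> Y t \<omega>)"
      using filterlim_compose[OF Y_right_cont q] by (simp add: split_beta)
  qed
qed

lemma Y_joint[measurable (raw)]:
  assumes "f \<in> borel_measurable N" "g \<in> measurable N M"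
  shows "(\<lambda>x. Y (f x) (g x)) \<in> borel_measurable N"
  using measurable_compose[OF measurable_Pair[OF assms] Y_joint_measurable] by simp

section \<open>The Markov property at finitely many fixed times\<close>

lemma nn_integral_X_Y:
  assumes "\<And>\<omega>. \<omega> \<in> good \<Longrightarrow> f \<omega> = g \<omega>"
  shows "(\<integral>\<^sup>+\<omega>. f \<omega> \<partial>M) = (\<integral>\<^sup>+\<omega>. g \<omega> \<partial>M)"
  by (rule nn_integral_cong_AE) (use good(2) assms in auto)

text \<open>The positions up to time \<open>t n\<close> are partial sums of the first
  \<open>n\<close> increments. The next increment is independent of these and, by stationarity, has
  the law of \<open>X (t (Suc n) - t n)\<close>; integrating it out leaves an expectation over a
  fresh copy started from the current position.\<close>

lemma Y_markov_aux:
  fixes f :: "nat \<Rightarrow> real ^ 'n \<Rightarrow> ennreal" and g :: "real ^ 'n \<Rightarrow> ennreal"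
  assumes t: "mono t" "t 0 = 0" and f[measurable]: "\<And>i. f i \<in> borel_measurable borel" and g[measurable]: "g \<in> borel_measurable borel"
  shows "(\<integral>\<^sup>+\<omega>. (\<Prod>i\<le>n. f i (Y (t i) \<omega>)) * g (Y (t (Suc n)) \<omega>) \<partial>M) =
    (\<integral>\<^sup>+\<omega>. (\<Prod>i\<le>n. f i (Y (t i) \<omega>)) * (\<integral>\<^sup>+\<omega>'. g (Y (t n) \<omega> + Y (t (Suc n) - t n) \<omega>') \<partial>M) \<partial>M)"
proof -
  have t0: "0 \<le> t i" for i using monoD[OF t(1), of 0 i] t(2) by simp
  note [measurable] = X_measurable[OF t0]
  define D where "D i \<omega> = X (t (Suc i)) \<omega> - X (t i) \<omega>" for i \<omega>
  define V where "V \<omega> = restrict (\<lambda>i. D i \<omega>) {..<n}" for \<omega>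
  define F where "F v d = (\<Prod>i\<le>n. f i (\<Sum>j<i. v j)) * g ((\<Sum>j<n. v j) + d)" for v :: "nat \<Rightarrow> real ^ 'n" and d
  have ind: "indep_vars (\<lambda>_. borel) D {..<Suc n}"
    using gen t t0 unfolding levy_process_generated_by_minus_L_def levy_process_def D_def by blast
  \<comment> \<open>The last increment is packaged as a family with one member, because
    \<open>indep_var_restrict\<close> compares two restricted families.\<close>
  define W where "W \<omega> = restrict (\<lambda>i. D i \<omega>) {n}" for \<omega>
  have iv: "indep_var (PiM {..<n} (\<lambda>_. borel)) V (PiM {n} (\<lambda>_. borel)) W"
    unfolding V_def W_def by (rule indep_var_restrict[OF ind]) auto
  then have V[measurable]: "V \<in> measurable M (PiM {..<n} (\<lambda>_. borel))" by (blast dest: indep_var_rv1)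
  have W[measurable]: "W \<in> measurable M (PiM {n} (\<lambda>_. borel))" using iv by (blast dest: indep_var_rv2)
  have Wn: "W \<omega> n = D n \<omega>" for \<omega> by (simp add: W_def)
  have D[measurable]: "D i \<in> borel_measurable M" for i unfolding D_def by measurable
  have sm: "(\<lambda>v. \<Sum>j<i. v j) \<in> borel_measurable (PiM {..<n} (\<lambda>_. borel :: (real^'n) measure))" if "i \<le> n" for i
    by (rule borel_measurable_sum) (use that in \<open>auto intro!: measurable_component_singleton\<close>)
  have pf: "(\<lambda>v. \<Prod>i\<le>n. f i (\<Sum>j<i. v j)) \<in> borel_measurable (PiM {..<n} (\<lambda>_. borel))"
    by (rule borel_measurable_prod_ennreal) (auto intro!: measurable_compose[OF sm f])
  have Fm[measurable]: "(\<lambda>(v, d). F v d) \<in> borel_measurable (PiM {..<n} (\<lambda>_. borel) \<Otimes>\<^sub>M borel)"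
    unfolding F_def using sm[of n] pf by measurable
  have Vsum: "(\<Sum>j<i. V \<omega> j) = X (t i) \<omega>" if "i \<le> n" "\<omega> \<in> good" for i \<omega>
  proof -
    have "(\<Sum>j<i. V \<omega> j) = (\<Sum>j<i. D j \<omega>)" using that by (intro sum.cong) (auto simp: V_def)
    also have "\<dots> = X (t i) \<omega> - X (t 0) \<omega>" by (induction i) (auto simp: D_def)
    finally show ?thesis using good(3)[OF that(2)] t(2) by simp
  qed
  have law: "distr M borel (D n) = distr M borel (X (t (Suc n) - t n))"
  proof -
    have "t (Suc n) - t n \<ge> 0" using monoD[OF t(1), of n "Suc n"] by simp
    then have "distr M borel (\<lambda>\<omega>. X (t n + (t (Suc n) - t n)) \<omega> - X (t n) \<omega>) = distr M borel (X (t (Suc n) - t n))"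
      using gen t0[of n] unfolding levy_process_generated_by_minus_L_def levy_process_def by blast
    then show ?thesis by (simp add: D_def[abs_def])
  qed
  have td: "0 \<le> t (Suc n) - t n" using monoD[OF t(1), of n "Suc n"] by simp
  note [measurable] = X_measurable[OF td]
  interpret DV: prob_space "distr M (PiM {..<n} (\<lambda>_. borel)) V" by (rule prob_space_distr) simp
  interpret DD: prob_space "distr M (PiM {n} (\<lambda>_. borel)) W" by (rule prob_space_distr) simp
  have Fm'[measurable]: "(\<lambda>(v, w). F v (w n)) \<in> borel_measurable (PiM {..<n} (\<lambda>_. borel) \<Otimes>\<^sub>M PiM {n} (\<lambda>_. borel))"
    unfolding split_beta
    by (rule measurable_compose[OF _ Fm[unfolded split_beta], of "\<lambda>p. (fst p, snd p n)", simplified])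
       (auto intro!: measurable_Pair measurable_compose[OF measurable_snd measurable_component_singleton])
  have "(\<integral>\<^sup>+\<omega>. (\<Prod>i\<le>n. f i (Y (t i) \<omega>)) * g (Y (t (Suc n)) \<omega>) \<partial>M) = (\<integral>\<^sup>+\<omega>. F (V \<omega>) (D n \<omega>) \<partial>M)"
  proof (rule nn_integral_X_Y)
    fix \<omega> assume "\<omega> \<in> good"
    then show "(\<Prod>i\<le>n. f i (Y (t i) \<omega>)) * g (Y (t (Suc n)) \<omega>) = F (V \<omega>) (D n \<omega>)"
      unfolding F_def by (simp add: Vsum Y_eq_X t0 D_def)
  qed
  also have "\<dots> = (\<integral>\<^sup>+p. (\<lambda>(v, w). F v (w n)) p \<partial>distr M (PiM {..<n} (\<lambda>_. borel) \<Otimes>\<^sub>M PiM {n} (\<lambda>_. borel)) (\<lambda>\<omega>. (V \<omega>, W \<omega>)))"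
    by (subst nn_integral_distr) (auto simp: Wn)
  also have "distr M (PiM {..<n} (\<lambda>_. borel) \<Otimes>\<^sub>M PiM {n} (\<lambda>_. borel)) (\<lambda>\<omega>. (V \<omega>, W \<omega>)) = distr M (PiM {..<n} (\<lambda>_. borel)) V \<Otimes>\<^sub>M distr M (PiM {n} (\<lambda>_. borel)) W"
    using iv unfolding indep_var_distribution_eq by simp
  also have "(\<integral>\<^sup>+p. (\<lambda>(v, w). F v (w n)) p \<partial>(distr M (PiM {..<n} (\<lambda>_. borel)) V \<Otimes>\<^sub>M distr M (PiM {n} (\<lambda>_. borel)) W)) =
     (\<integral>\<^sup>+v. \<integral>\<^sup>+w. F v (w n) \<partial>distr M (PiM {n} (\<lambda>_. borel)) W \<partial>distr M (PiM {..<n} (\<lambda>_. borel)) V)"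
    by (subst DD.nn_integral_fst[symmetric]) auto
  also have "\<dots> = (\<integral>\<^sup>+\<omega>. \<integral>\<^sup>+w. F (V \<omega>) (w n) \<partial>distr M (PiM {n} (\<lambda>_. borel)) W \<partial>M)"
    by (subst nn_integral_distr) (auto intro!: DD.borel_measurable_nn_integral)
  also have "\<dots> = (\<integral>\<^sup>+\<omega>. \<integral>\<^sup>+\<omega>'. F (V \<omega>) (X (t (Suc n) - t n) \<omega>') \<partial>M \<partial>M)"
  proof (intro nn_integral_cong)
    fix \<omega> assume "\<omega> \<in> space M"
    then have "V \<omega> \<in> space (PiM {..<n} (\<lambda>_. borel))" by (rule measurable_space[OF V])
    have c: "(\<lambda>w. w n) \<in> measurable (PiM {n} (\<lambda>_. borel)) (borel :: (real^'n) measure)"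
      by (rule measurable_component_singleton) simp
    from measurable_Pair2[OF Fm \<open>V \<omega> \<in> space (PiM {..<n} (\<lambda>_. borel))\<close>]
    have FV[measurable]: "F (V \<omega>) \<in> borel_measurable borel" by simp
    have "(\<integral>\<^sup>+w. F (V \<omega>) (w n) \<partial>distr M (PiM {n} (\<lambda>_. borel)) W) = (\<integral>\<^sup>+\<omega>'. F (V \<omega>) (W \<omega>' n) \<partial>M)"
      by (rule nn_integral_distr[OF W]) (use measurable_compose[OF c FV] in simp)
    also have "\<dots> = (\<integral>\<^sup>+d. F (V \<omega>) d \<partial>distr M borel (D n))"
      by (subst nn_integral_distr) (auto simp: Wn)
    also have "\<dots> = (\<integral>\<^sup>+\<omega>'. F (V \<omega>) (X (t (Suc n) - t n) \<omega>') \<partial>M)"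
      unfolding law by (subst nn_integral_distr) auto
    finally show "(\<integral>\<^sup>+w. F (V \<omega>) (w n) \<partial>distr M (PiM {n} (\<lambda>_. borel)) W) = (\<integral>\<^sup>+\<omega>'. F (V \<omega>) (X (t (Suc n) - t n) \<omega>') \<partial>M)" .
  qed
  also have "\<dots> = (\<integral>\<^sup>+\<omega>. (\<Prod>i\<le>n. f i (Y (t i) \<omega>)) * (\<integral>\<^sup>+\<omega>'. g (Y (t n) \<omega> + Y (t (Suc n) - t n) \<omega>') \<partial>M) \<partial>M)"
  proof (rule nn_integral_X_Y)
    fix \<omega> assume w: "\<omega> \<in> good"
    have "(\<integral>\<^sup>+\<omega>'. F (V \<omega>) (X (t (Suc n) - t n) \<omega>') \<partial>M) = (\<integral>\<^sup>+\<omega>'. F (V \<omega>) (Y (t (Suc n) - t n) \<omega>') \<partial>M)"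
      by (rule nn_integral_X_Y) (simp add: Y_eq_X[OF _ td])
    also have "\<dots> = (\<integral>\<^sup>+\<omega>'. (\<Prod>i\<le>n. f i (Y (t i) \<omega>)) * g (Y (t n) \<omega> + Y (t (Suc n) - t n) \<omega>') \<partial>M)"
      unfolding F_def using w by (simp add: Vsum Y_eq_X t0)
    finally show "(\<integral>\<^sup>+\<omega>'. F (V \<omega>) (X (t (Suc n) - t n) \<omega>') \<partial>M) = (\<Prod>i\<le>n. f i (Y (t i) \<omega>)) * (\<integral>\<^sup>+\<omega>'. g (Y (t n) \<omega> + Y (t (Suc n) - t n) \<omega>') \<partial>M)"
      by (simp add: nn_integral_cmult)
  qed
  finally show ?thesis .
qed

text \<open>The pointwise counterpart of \<open>L_semigroup\<close> on nonnegative functions: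
  defined for every starting point, with infinite values allowed.\<close>

definition semigroup :: "real \<Rightarrow> (real ^ 'n \<Rightarrow> ennreal) \<Rightarrow> real ^ 'n \<Rightarrow> ennreal" where
  "semigroup t f x = (\<integral>\<^sup>+\<omega>. f (x + Y t \<omega>) \<partial>M)"

lemma semigroup_measurable[measurable (raw)]:
  assumes [measurable]: "f \<in> borel_measurable borel" "t \<in> borel_measurable N" "x \<in> borel_measurable N"
  shows "(\<lambda>p. semigroup (t p) f (x p)) \<in> borel_measurable N"
  unfolding semigroup_def by measurable

lemma Y_markov:
  fixes f :: "nat \<Rightarrow> real ^ 'n \<Rightarrow> ennreal" and g :: "real ^ 'n \<Rightarrow> ennreal"
  assumes t: "mono t" "t 0 = 0" and [measurable]: "\<And>i. f i \<in> borel_measurable borel" "g \<in> borel_measurable borel"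
  shows "(\<integral>\<^sup>+\<omega>. (\<Prod>i\<le>n. f i (x + Y (t i) \<omega>)) * g (x + Y (t (Suc n)) \<omega>) \<partial>M) =
    (\<integral>\<^sup>+\<omega>. (\<Prod>i\<le>n. f i (x + Y (t i) \<omega>)) * semigroup (t (Suc n) - t n) g (x + Y (t n) \<omega>) \<partial>M)"
  using Y_markov_aux[OF t, of "\<lambda>i y. f i (x + y)" "\<lambda>y. g (x + y)" n]
  by (simp add: semigroup_def add.assoc)

end

section \<open>The potential representation of the ground state\<close>

lemma sphere_null: "emeasure lborel (sphere (c::'a::euclidean_space) r) = 0"
proof -
  have "sphere c r \<in> null_sets lebesgue"
    using negligible_sphere[of c r] by (simp add: negligible_iff_null_sets)
  then have "sphere c r \<in> null_sets lborel"
    by (rule null_sets_completion_iff[THEN iffD1, rotated]) simp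
  then show ?thesis by auto
qed

lemma exponential_density_mult_exp:
  fixes lam q :: real
  assumes "0 < lam" "0 \<le> q"
  shows "exponential_density lam s * exp (- s * q) = lam / (lam + q) * exponential_density (lam + q) s"
proof -
  have e: "exp (- s * lam) * exp (- s * q) = exp (- s * (lam + q))"
    by (simp add: exp_add[symmetric] algebra_simps)
  have "lam + q \<noteq> 0" using assms by simp
  then show ?thesis unfolding exponential_density_def using e by (simp add: mult.assoc)
qed

section \<open>The resolvent as an average at an independent exponential time\<close>

context relativistic_process
begin

text \<open>This is \<open>lam\<close> times the inverse of \<open>L + lam\<close>: the expectation
  of \<open>f\<close> at the position reached at an independent exponential time of rate
  \<open>lam\<close>. The normalisation to total mass one is why \<open>lam\<close> multiplies the
  ground state in the identities below.\<close>

definition potential :: "real \<Rightarrow> (real ^ 'n \<Rightarrow> ennreal) \<Rightarrow> real ^ 'n \<Rightarrow> ennreal" where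
  "potential lam f x = (\<integral>\<^sup>+s. ennreal (exponential_density lam s) * semigroup s f x \<partial>lborel)"

text \<open>Law of the position at that exponential time. As \<open>potential lam f\<close> averages
  \<open>f\<close> over its translates, the resolvent comes within reach of
  \<open>ft_average\<close>.\<close>

definition occupation :: "real \<Rightarrow> (real ^ 'n) measure" where
  "occupation lam = distr (density lborel (exponential_density lam) \<Otimes>\<^sub>M M) borel (\<lambda>(s, \<omega>). Y s \<omega>)"

context
  fixes lam :: real assumes lam: "0 < lam"
begin

interpretation kill: prob_space "density lborel (exponential_density lam)"
  by (rule prob_space_exponential_density[OF lam])

interpretation kM: pair_prob_space "density lborel (exponential_density lam)" M ..

lemma occupation: "prob_space (occupation lam)" "finite_measure (occupation lam)" "sets (occupation lam) = sets borel"
proof -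
  show "prob_space (occupation lam)" unfolding occupation_def
    by (rule kM.prob_space_distr) measurable
  then show "finite_measure (occupation lam)" by (rule prob_space.finite_measure)
  show "sets (occupation lam) = sets borel" by (simp add: occupation_def)
qed

lemma nn_integral_occupation:
  assumes [measurable]: "f \<in> borel_measurable borel"
  shows "(\<integral>\<^sup>+z. f (x + z) \<partial>occupation lam) = potential lam f x"
proof -
  have "(\<integral>\<^sup>+z. f (x + z) \<partial>occupation lam) = (\<integral>\<^sup>+p. (case p of (s, \<omega>) \<Rightarrow> f (x + Y s \<omega>)) \<partial>(density lborel (exponential_density lam) \<Otimes>\<^sub>M M))"
    unfolding occupation_def by (subst nn_integral_distr) (auto simp: case_prod_unfold)
  also have "\<dots> = (\<integral>\<^sup>+s. semigroup s f x \<partial>density lborel (exponential_density lam))"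
    unfolding semigroup_def by (subst nn_integral_fst[symmetric]) auto
  also have "\<dots> = potential lam f x"
    unfolding potential_def by (subst nn_integral_density) auto
  finally show ?thesis .
qed

text \<open>The exponential density of rate \<open>lam\<close> times \<open>exp (- s * q)\<close> is
  \<open>lam / (lam + q)\<close> times the exponential density of rate \<open>lam + q\<close>, which
  integrates to one.\<close>

lemma char_occupation:
  "(LINT z|occupation lam. cis (y \<bullet> z)) = of_real (lam / (lam + Phi m \<alpha> ((norm y)\<^sup>2)))"
proof -
  let ?q = "Phi m \<alpha> ((norm y)\<^sup>2)"
  have q: "0 \<le> ?q" by (intro Phi_nonneg \<alpha> m) simp
  have "(LINT z|occupation lam. cis (y \<bullet> z)) = (LINT p|(density lborel (exponential_density lam) \<Otimes>\<^sub>M M). cis (y \<bullet> Y (fst p) (snd p)))"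
    unfolding occupation_def by (subst integral_distr) (auto simp: split_beta)
  also have "\<dots> = (LINT s|density lborel (exponential_density lam). LINT \<omega>|M. cis (y \<bullet> Y s \<omega>))"
    by (subst kM.integral_fst'[symmetric]) (auto intro!: kM.P.integrable_const_bound[where B=1])
  also have "\<dots> = (LINT s|lborel. exponential_density lam s *\<^sub>R (LINT \<omega>|M. cis (y \<bullet> Y s \<omega>)))"
    using lam by (subst integral_density) (auto simp: exponential_density_nonneg)
  also have "\<dots> = (LINT s|lborel. complex_of_real (lam / (lam + ?q) * exponential_density (lam + ?q) s))"
  proof (intro Bochner_Integration.integral_cong refl)
    fix s :: real
    show "exponential_density lam s *\<^sub>R (LINT \<omega>|M. cis (y \<bullet> Y s \<omega>)) = complex_of_real (lam / (lam + ?q) * exponential_density (lam + ?q) s)"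
    proof (cases "0 \<le> s")
      case True
      have "(LINT \<omega>|M. cis (y \<bullet> Y s \<omega>)) = (LINT \<omega>|M. cis (y \<bullet> X s \<omega>))"
        by (rule integral_cong_AE) (use AE_Y_eq_X True X_measurable[OF True] in auto)
      also have "\<dots> = of_real (exp (- s * ?q))" by (rule char_X[OF True])
      finally show ?thesis
        using exponential_density_mult_exp[OF lam q, of s] by (simp add: scaleR_conv_of_real flip: of_real_mult)
    next
      case False then show ?thesis by (simp add: exponential_density_def)
    qed
  qed
  also have "\<dots> = of_real (lam / (lam + ?q) * (LINT s|lborel. exponential_density (lam + ?q) s))"
    by (simp del: of_real_mult of_real_divide)
  also have "(LINT s|lborel. exponential_density (lam + ?q) s) = 1"
  proof -
    have l: "0 < lam + ?q" using lam q by simp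
    interpret p: prob_space "density lborel (exponential_density (lam + ?q))" by (rule prob_space_exponential_density[OF l])
    have "(LINT s|density lborel (exponential_density (lam + ?q)). 1::real) = (LINT s|lborel. exponential_density (lam + ?q) s *\<^sub>R 1)"
      using l by (subst integral_density) (auto simp: exponential_density_nonneg)
    then show ?thesis using p.prob_space by simp
  qed
  finally show ?thesis by simp
qed

lemma semigroup_null:
  assumes s: "0 < s" and [measurable]: "A \<in> sets borel" and A: "emeasure lborel A = 0"
  shows "AE \<omega> in M. x + Y s \<omega> \<notin> A"
proof -
  let ?B = "(\<lambda>z. x + z) -` A"
  have [measurable]: "?B \<in> sets borel" by (rule measurable_sets_borel[of _ borel]) auto
  have "emeasure lborel A = emeasure lborel ?B"
    using nn_integral_lborel_affine[of 1 "indicator A :: real^'n \<Rightarrow> ennreal" x]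
    by (simp add: indicator_vimage[symmetric] comp_def flip: nn_integral_indicator)
  then have "emeasure M {\<omega>\<in>space M. X s \<omega> \<in> ?B} = 0"
    using A by (intro X_null[OF s]) auto
  moreover have "{\<omega>\<in>space M. X s \<omega> \<in> ?B} \<in> sets M"
    using X_measurable[OF less_imp_le[OF s]] by measurable
  ultimately have "AE \<omega> in M. X s \<omega> \<notin> ?B"
    by (subst AE_iff_null) (auto simp: null_sets_def)
  then show ?thesis using AE_Y_eq_X by eventually_elim (use s in auto)
qed

text \<open>At positive times null sets have probability zero, and time 0 has probability zero under
  the exponential law.\<close>

lemma occupation_null:
  assumes A[measurable]: "A \<in> sets borel" and A0: "emeasure lborel A = 0"
  shows "AE z in occupation lam. x + z \<notin> A"
proof -
  note [measurable_cong] = occupation(3)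
  have "AE s in lborel. s \<noteq> (0::real)" by (rule AE_lborel_singleton)
  then have "AE s in lborel. ennreal (exponential_density lam s) * semigroup s (indicator A) x = 0"
  proof eventually_elim
    fix s :: real assume "s \<noteq> 0"
    show "ennreal (exponential_density lam s) * semigroup s (indicator A) x = 0"
    proof (cases "0 < s")
      case True
      have "semigroup s (indicator A) x = (\<integral>\<^sup>+\<omega>. 0 \<partial>M)" unfolding semigroup_def
        by (rule nn_integral_cong_AE) (use semigroup_null[OF True A A0, of x] in auto)
      then show ?thesis by simp
    qed (use \<open>s \<noteq> 0\<close> in \<open>simp add: exponential_density_def\<close>)
  qed
  then have "potential lam (indicator A) x = (\<integral>\<^sup>+(s::real). 0 \<partial>lborel)"
    unfolding potential_def by (rule nn_integral_cong_AE)
  then have "(\<integral>\<^sup>+z. indicator A (x + z) \<partial>occupation lam) = 0"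
    using nn_integral_occupation[of "indicator A" x] by simp
  then have "AE z in occupation lam. indicator A (x + z) = (0::ennreal)"
    by (subst (asm) nn_integral_0_iff_AE) auto
  then show ?thesis by eventually_elim (auto simp: indicator_def split: if_splits)
qed

end

text \<open>On the Fourier side the eigenvalue equation says that \<open>lam + Phi\<close> times
  \<open>F\<close> is \<open>ft gC\<close>, where \<open>gC\<close> stands for \<open>v\<close>
  times the ground state cut off to the ball. Averaging over \<open>occupation lam\<close>
  multiplies by \<open>lam / (lam + Phi)\<close>, so the right-hand side \<open>u\<close> has
  transform \<open>lam * F\<close>, the transform of \<open>lam * \<phi>\<close>.\<close>

lemma ground_state_average:
  assumes gs: "ground_state m \<alpha> a v l (\<phi> :: real ^ 'n \<Rightarrow> real)"
  shows "- l * \<phi> x = (LINT z|occupation (- l). v * indicator (ball 0 a) (x + z) * \<phi> (x + z))"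
proof -
  from gs have l: "0 < - l" and H: "H_op m \<alpha> a v (\<lambda>x. of_real (\<phi> x)) (\<lambda>x. of_real (l * \<phi> x))"
    and c: "continuous_on UNIV \<phi>" and bd: "bounded (range \<phi>)"
    unfolding ground_state_def by auto
  have [measurable]: "\<phi> \<in> borel_measurable borel" using c by (rule borel_measurable_continuous_onI)
  obtain b where b: "\<And>x. norm (\<phi> x) \<le> b" using bd by (auto simp: bounded_iff)
  define lam where "lam = - l"
  have lam: "0 < lam" using l by (simp add: lam_def)
  note O = occupation[OF lam]
  interpret O: prob_space "occupation lam" by (rule O(1))
  note [measurable_cong] = O(3)
  define g where "g x = v * indicator (ball 0 a) x * \<phi> x" for x :: "real ^ 'n"
  have [measurable]: "g \<in> borel_measurable borel" unfolding g_def[abs_def] by measurable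
  have gb: "norm (g x) \<le> \<bar>v\<bar> * b" for x
    using b[of x] order_trans[OF norm_ge_zero b[of x]]
    by (auto simp: g_def abs_mult indicator_def intro!: mult_left_mono)
  define gC where "gC x = complex_of_real (g x)" for x
  have gCi: "integrable lborel gC"
  proof (rule Bochner_Integration.integrable_bound)
    show "integrable lborel (\<lambda>x::real^'n. \<bar>v\<bar> * b * indicator (ball 0 a) x)"
      by (intro integrable_mult_right integrable_real_indicator) (use emeasure_lborel_ball_finite[of "0 :: real^'n" a] in auto)
    show "AE x in lborel. norm (gC x) \<le> norm (\<bar>v\<bar> * b * indicator (ball 0 a) x)"
    proof (intro AE_I2)
      fix x show "norm (gC x) \<le> norm (\<bar>v\<bar> * b * indicator (ball 0 a) x)"
        using gb[of x] unfolding gC_def norm_of_real by (cases "x \<in> ball 0 a") (auto simp: g_def)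
    qed
  qed (simp add: gC_def[abs_def])
  have gCL: "gC \<in> L2" by (rule bounded_integrable_L2[OF gCi, of "\<bar>v\<bar> * b"]) (use gb in \<open>simp add: gC_def\<close>)
  from H obtain h where h: "L_op m \<alpha> (\<lambda>x. complex_of_real (\<phi> x)) h"
    and hg: "AE x in lborel. of_real (l * \<phi> x) = h x - of_real (v * indicator (ball 0 a) x) * of_real (\<phi> x)"
    unfolding H_op_def by blast
  from h obtain F G where F: "L2_fourier (\<lambda>x. complex_of_real (\<phi> x)) F" and G: "L2_fourier h G"
    and GF: "AE y in lborel. G y = of_real (Phi m \<alpha> ((norm y)\<^sup>2)) * F y"
    unfolding L_op_def fourier_multiplier_def by blast
  have "L2_fourier (\<lambda>x. h x + of_real lam * of_real (\<phi> x)) (\<lambda>y. G y + of_real lam * F y)"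
    by (rule L2_fourier_add_cmult[OF G F])
  moreover have "AE x in lborel. h x + of_real lam * of_real (\<phi> x) = gC x"
    using hg by eventually_elim (simp add: gC_def g_def lam_def algebra_simps)
  ultimately have "AE y in lborel. G y + of_real lam * F y = ft gC y"
    using L2_fourier_unique L2_fourier_ft[OF gCi gCL] by blast
  define u where "u x = (LINT z|occupation lam. g (x + z))" for x
  have uC: "complex_of_real (u x) = (LINT z|occupation lam. gC (x + z))" for x
    by (simp add: u_def gC_def)
  have ub: "norm (u x) \<le> \<bar>v\<bar> * b" for x
  proof -
    have "norm (u x) \<le> (LINT z|occupation lam. \<bar>v\<bar> * b)"
      unfolding u_def
      by (rule Bochner_Integration.integral_norm_bound_integral)
         (auto intro!: O.integrable_const_bound[where B="\<bar>v\<bar> * b"] gb[simplified])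
    then show ?thesis by (simp add: O.prob_space)
  qed
  have ui: "integrable lborel (\<lambda>x. complex_of_real (u x))"
    unfolding uC by (rule integrable_average[OF O(2,3) gCi])
  have ftu: "ft (\<lambda>x. complex_of_real (u x)) y = ft gC y * of_real (lam / (lam + Phi m \<alpha> ((norm y)\<^sup>2)))" for y
    unfolding uC ft_average[OF O(2,3) gCi] char_occupation[OF lam] ..
  have uF: "AE y in lborel. ft (\<lambda>x. complex_of_real (u x)) y = of_real lam * F y"
    using GF \<open>AE y in lborel. G y + of_real lam * F y = ft gC y\<close>
  proof eventually_elim
    fix y assume "G y = of_real (Phi m \<alpha> ((norm y)\<^sup>2)) * F y" "G y + of_real lam * F y = ft gC y"
    then have e: "ft gC y = of_real (lam + Phi m \<alpha> ((norm y)\<^sup>2)) * F y" by (simp add: algebra_simps)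
    have "lam + Phi m \<alpha> ((norm y)\<^sup>2) \<noteq> 0" using lam Phi_nonneg[OF \<alpha>(1) m, of "(norm y)\<^sup>2"] by auto
    then show "ft (\<lambda>x. complex_of_real (u x)) y = of_real lam * F y"
      unfolding ftu e by (simp add: field_simps flip: of_real_mult of_real_add)
  qed
  have Lu: "L2_fourier (\<lambda>x. complex_of_real (u x)) (ft (\<lambda>x. complex_of_real (u x)))"
    by (rule L2_fourier_ft[OF ui bounded_integrable_L2[OF ui, of "\<bar>v\<bar> * b"]]) (use ub in simp)
  have [measurable]: "F \<in> borel_measurable borel" using L2_fourier_L2(2)[OF F] by (simp add: L2_iff)
  have [measurable]: "ft (\<lambda>x. complex_of_real (u x)) \<in> borel_measurable borel"
    using L2_fourier_L2(2)[OF Lu] by (simp add: L2_iff)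
  \<comment> \<open>\<open>g\<close> jumps across the sphere of radius \<open>a\<close>, but the
    shifted occupation measure does not charge that sphere, so dominated convergence still
    applies.\<close>
  have uc: "continuous_on UNIV u"
    unfolding continuous_on_sequentially comp_def
  proof (intro ballI allI impI)
    fix w :: "nat \<Rightarrow> real ^ 'n" and x assume "(\<forall>n. w n \<in> UNIV) \<and> w \<longlonglongrightarrow> x"
    then have w: "w \<longlonglongrightarrow> x" by simp
    have g: "isCont g y" if "y \<notin> sphere 0 a" for y
    proof (cases "y \<in> ball 0 a")
      case True
      have ev: "\<forall>\<^sub>F y in nhds y. g y = v * \<phi> y"
        using eventually_nhds_in_open[OF open_ball True] by eventually_elim (simp add: g_def)
      show ?thesis using c
        by (subst isCont_cong[OF ev]) (auto intro!: continuous_intros simp: continuous_on_eq_continuous_at)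
    next
      case False
      then have "y \<in> - cball 0 a" using that by auto
      from eventually_nhds_in_open[OF _ this] have ev: "\<forall>\<^sub>F y in nhds y. g y = 0"
        by (rule eventually_mono) (auto simp: g_def indicator_def)
      show ?thesis by (subst isCont_cong[OF ev]) simp
    qed
    show "(\<lambda>n. u (w n)) \<longlonglongrightarrow> u x"
      unfolding u_def
    proof (rule integral_dominated_convergence[where w="\<lambda>_. \<bar>v\<bar> * b"])
      show "AE z in occupation lam. (\<lambda>n. g (w n + z)) \<longlonglongrightarrow> g (x + z)"
        using occupation_null[OF lam _ sphere_null[of 0 a], of x, simplified]
      proof eventually_elim
        fix z assume "norm (x + z) \<noteq> a"
        then have "isCont g (x + z)" by (intro g) auto
        then show "(\<lambda>n. g (w n + z)) \<longlonglongrightarrow> g (x + z)"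
          by (rule isCont_tendsto_compose) (intro tendsto_intros w)
      qed
    qed (use gb in auto)
  qed
  have "lam * \<phi> x = u x"
  proof (rule gauss_average_inj[OF _ _ uc])
    show "continuous_on UNIV (\<lambda>x. lam * \<phi> x)" by (intro continuous_intros c)
    show "bounded (range (\<lambda>x. lam * \<phi> x))"
      unfolding bounded_iff using b lam by (intro exI[of _ "lam * b"]) (auto simp: abs_mult)
    show "bounded (range u)" unfolding bounded_iff using ub by (intro exI[of _ "\<bar>v\<bar> * b"]) auto
    fix \<epsilon> :: real and z :: "real ^ 'n" assume e: "\<epsilon> > 0"
    define k where "k = complex_of_real ((2 * pi) powr (- real CARD('n) / 2))"
    have "(LINT x|lborel. complex_of_real (gauss \<epsilon> (z - x)) * of_real (u x)) =
      k * (LINT w|lborel. (of_real (exp (- \<epsilon> * (norm w)\<^sup>2 / 2)) * cis (w \<bullet> z)) * ft (\<lambda>x. complex_of_real (u x)) w)"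
      unfolding k_def by (rule L2_fourier_gauss_average[OF e Lu])
    also have "(LINT w|lborel. (of_real (exp (- \<epsilon> * (norm w)\<^sup>2 / 2)) * cis (w \<bullet> z)) * ft (\<lambda>x. complex_of_real (u x)) w)
      = (LINT w|lborel. (of_real (exp (- \<epsilon> * (norm w)\<^sup>2 / 2)) * cis (w \<bullet> z)) * (of_real lam * F w))"
      by (rule integral_cong_AE) (use uF in auto)
    also have "\<dots> = of_real lam * (LINT w|lborel. (of_real (exp (- \<epsilon> * (norm w)\<^sup>2 / 2)) * cis (w \<bullet> z)) * F w)"
      by (subst integral_mult_right_zero[symmetric]) (simp add: mult_ac)
    also have "k * \<dots> = of_real lam * (k * (LINT w|lborel. (of_real (exp (- \<epsilon> * (norm w)\<^sup>2 / 2)) * cis (w \<bullet> z)) * F w))"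
      by simp
    also have "k * (LINT w|lborel. (of_real (exp (- \<epsilon> * (norm w)\<^sup>2 / 2)) * cis (w \<bullet> z)) * F w) = (LINT x|lborel. complex_of_real (gauss \<epsilon> (z - x)) * of_real (\<phi> x))"
      unfolding k_def by (rule L2_fourier_gauss_average[OF e F, symmetric])
    also have "of_real lam * \<dots> = (LINT x|lborel. complex_of_real (gauss \<epsilon> (z - x)) * of_real (lam * \<phi> x))"
      by (subst integral_mult_right_zero[symmetric]) (simp add: mult_ac)
    finally show "(LINT x|lborel. complex_of_real (gauss \<epsilon> (z - x)) * of_real (lam * \<phi> x)) = (LINT x|lborel. of_real (gauss \<epsilon> (z - x)) * of_real (u x))"
      by simp
  qed
  then show ?thesis by (simp add: lam_def u_def g_def)
qed

end

section \<open>Lack of memory and excessive functions\<close>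

lemma sets_cball[measurable]: "cball z r \<in> sets borel"
  by (rule borel_closed[OF closed_cball])

lemma nn_integral_exponential_density:
  assumes "0 < lam"
  shows "(\<integral>\<^sup>+s. ennreal (exponential_density lam s) \<partial>lborel) = 1"
proof -
  interpret prob_space "density lborel (exponential_density lam)" by (rule prob_space_exponential_density[OF assms])
  show ?thesis using emeasure_space_1 by (simp add: emeasure_density)
qed

lemma nn_integral_shift:
  fixes f :: "real \<Rightarrow> ennreal"
  assumes "f \<in> borel_measurable borel"
  shows "(\<integral>\<^sup>+s. f s \<partial>lborel) = (\<integral>\<^sup>+r. f (h + r) \<partial>lborel)"
  using nn_integral_lborel_affine[of 1 f h] assms by simp

text \<open>Lack of memory. The indicator removes \<open>- h \<le> r < 0\<close>, where the shifted
  density is positive while the original one vanishes.\<close>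

lemma exponential_density_add:
  assumes "0 < lam" "0 \<le> h"
  shows "indicator {h..} (h + r) * exponential_density lam (h + r) = exp (- lam * h) * exponential_density lam r"
  using assms by (auto simp: exponential_density_def indicator_def exp_add[symmetric] algebra_simps)

lemma nn_integral_exponential_tail:
  assumes "0 < lam" "0 \<le> h"
  shows "(\<integral>\<^sup>+s. indicator {h..} s * ennreal (exponential_density lam s) \<partial>lborel) = ennreal (exp (- lam * h))"
proof -
  have "(\<integral>\<^sup>+s. indicator {h..} s * ennreal (exponential_density lam s) \<partial>lborel) =
     (\<integral>\<^sup>+r. ennreal (indicator {h..} (h + r) * exponential_density lam (h + r)) \<partial>lborel)"
    by (subst nn_integral_shift[of _ h]) (auto simp: ennreal_mult' ennreal_indicator)
  also have "\<dots> = (\<integral>\<^sup>+r. ennreal (exp (- lam * h)) * ennreal (exponential_density lam r) \<partial>lborel)"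
    unfolding exponential_density_add[OF assms] by (simp add: ennreal_mult')
  finally show ?thesis
    using assms by (simp add: nn_integral_cmult nn_integral_exponential_density)
qed

context relativistic_process
begin

lemma Y_markov_2:
  assumes "0 \<le> s" "0 \<le> t" and [measurable]: "f \<in> borel_measurable borel" "g \<in> borel_measurable borel"
  shows "(\<integral>\<^sup>+\<omega>. f (x + Y t \<omega>) * g (x + Y (t + s) \<omega>) \<partial>M) = (\<integral>\<^sup>+\<omega>. f (x + Y t \<omega>) * semigroup s g (x + Y t \<omega>) \<partial>M)"
proof -
  \<comment> \<open>The times are 0, \<open>t\<close> and \<open>t + s\<close>; the test function
    sits at index 1 and is constantly 1 at the other indices.\<close>
  let ?t = "\<lambda>i::nat. if i = 0 then 0 else if i = 1 then t else t + s"
  have "mono ?t" using assms by (intro monoI) auto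
  from Y_markov[OF this, of "\<lambda>i. if i = 1 then f else (\<lambda>_. 1)" g x 1]
  show ?thesis using assms(3,4) by (simp add: atMost_Suc)
qed

lemma semigroup_mono: "(\<And>y. f y \<le> g y) \<Longrightarrow> semigroup t f x \<le> semigroup t g x"
  unfolding semigroup_def by (intro nn_integral_mono)

lemma potential_mono: "(\<And>y. f y \<le> g y) \<Longrightarrow> potential lam f x \<le> potential lam g x"
  unfolding potential_def by (intro nn_integral_mono mult_left_mono semigroup_mono) auto

lemma potential_measurable[measurable (raw)]:
  assumes [measurable]: "f \<in> borel_measurable borel" "g \<in> borel_measurable N"
  shows "(\<lambda>p. potential lam f (g p)) \<in> borel_measurable N"
  unfolding potential_def by measurable

text \<open>The Markov property at time \<open>h\<close> combined with lack of memory: the potential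
  started from the position at \<open>h\<close>, discounted, is the part of the exponential average
  after \<open>h\<close>. The weight \<open>w\<close> observes the process at time \<open>h\<close>;
  it will be 1 for excessiveness and the indicator of the exterior for the killed process.\<close>

lemma potential_shift:
  assumes lam: "0 < lam" and h: "0 \<le> h" and w[measurable]: "w \<in> borel_measurable borel" and f[measurable]: "f \<in> borel_measurable borel"
  shows "ennreal (exp (- lam * h)) * (\<integral>\<^sup>+\<omega>. w (x + Y h \<omega>) * potential lam f (x + Y h \<omega>) \<partial>M) =
    (\<integral>\<^sup>+s. indicator {h..} s * ennreal (exponential_density lam s) * (\<integral>\<^sup>+\<omega>. w (x + Y h \<omega>) * f (x + Y s \<omega>) \<partial>M) \<partial>lborel)"
proof -
  interpret pair_sigma_finite lborel M ..
  have "(\<integral>\<^sup>+s. indicator {h..} s * ennreal (exponential_density lam s) * (\<integral>\<^sup>+\<omega>. w (x + Y h \<omega>) * f (x + Y s \<omega>) \<partial>M) \<partial>lborel)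
     = (\<integral>\<^sup>+r. ennreal (indicator {h..} (h + r) * exponential_density lam (h + r)) * (\<integral>\<^sup>+\<omega>. w (x + Y h \<omega>) * f (x + Y (h + r) \<omega>) \<partial>M) \<partial>lborel)"
    by (subst nn_integral_shift[of _ h]) (auto simp: ennreal_mult' ennreal_indicator)
  also have "\<dots> = (\<integral>\<^sup>+r. ennreal (exp (- lam * h)) * (ennreal (exponential_density lam r) * (\<integral>\<^sup>+\<omega>. w (x + Y h \<omega>) * semigroup r f (x + Y h \<omega>) \<partial>M)) \<partial>lborel)"
  proof (intro nn_integral_cong)
    fix r :: real
    show "ennreal (indicator {h..} (h + r) * exponential_density lam (h + r)) * (\<integral>\<^sup>+\<omega>. w (x + Y h \<omega>) * f (x + Y (h + r) \<omega>) \<partial>M) =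
      ennreal (exp (- lam * h)) * (ennreal (exponential_density lam r) * (\<integral>\<^sup>+\<omega>. w (x + Y h \<omega>) * semigroup r f (x + Y h \<omega>) \<partial>M))"
    proof (cases "0 \<le> r")
      case True
      then show ?thesis
        unfolding exponential_density_add[OF lam h] by (subst Y_markov_2[OF True h w f]) (simp add: ennreal_mult' mult.assoc)
    qed (simp add: exponential_density_def)
  qed
  also have "\<dots> = ennreal (exp (- lam * h)) * (\<integral>\<^sup>+r. \<integral>\<^sup>+\<omega>. w (x + Y h \<omega>) * (ennreal (exponential_density lam r) * semigroup r f (x + Y h \<omega>)) \<partial>M \<partial>lborel)"
    by (simp add: nn_integral_cmult[symmetric] mult_ac)
  also have "(\<integral>\<^sup>+r. \<integral>\<^sup>+\<omega>. w (x + Y h \<omega>) * (ennreal (exponential_density lam r) * semigroup r f (x + Y h \<omega>)) \<partial>M \<partial>lborel) =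
     (\<integral>\<^sup>+\<omega>. \<integral>\<^sup>+r. w (x + Y h \<omega>) * (ennreal (exponential_density lam r) * semigroup r f (x + Y h \<omega>)) \<partial>lborel \<partial>M)"
    by (rule Fubini'[symmetric]) measurable
  also have "\<dots> = (\<integral>\<^sup>+\<omega>. w (x + Y h \<omega>) * potential lam f (x + Y h \<omega>) \<partial>M)"
    unfolding potential_def by (simp add: nn_integral_cmult)
  finally show ?thesis ..
qed

text \<open>The right-hand side averages over all times, the left-hand side only over those after
  \<open>h\<close>.\<close>

lemma semigroup_potential_le:
  assumes lam: "0 < lam" and h: "0 \<le> h" and [measurable]: "f \<in> borel_measurable borel"
  shows "ennreal (exp (- lam * h)) * semigroup h (potential lam f) x \<le> potential lam f x"
proof -
  have "ennreal (exp (- lam * h)) * semigroup h (potential lam f) x = (\<integral>\<^sup>+s. indicator {h..} s * ennreal (exponential_density lam s) * semigroup s f x \<partial>lborel)"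
    using potential_shift[OF lam h, of "\<lambda>_. 1" f x] by (simp add: semigroup_def)
  also have "\<dots> \<le> potential lam f x"
    unfolding potential_def by (intro nn_integral_mono mult_right_mono) (auto simp: indicator_def)
  finally show ?thesis .
qed

lemma potential_indicator_null:
  assumes lam: "0 < lam" and AB: "A \<in> sets borel" "B \<in> sets borel" "emeasure lborel (A - B \<union> (B - A)) = 0"
    and [measurable]: "f \<in> borel_measurable borel"
  shows "potential lam (\<lambda>y. indicator A y * f y) x = potential lam (\<lambda>y. indicator B y * f y) x"
proof -
  note [measurable] = AB(1,2)
  have AE: "AE z in occupation lam. x + z \<notin> A - B \<union> (B - A)"
    by (rule occupation_null[OF lam _ AB(3)]) measurable
  have "(\<integral>\<^sup>+z. indicator A (x + z) * f (x + z) \<partial>occupation lam) = (\<integral>\<^sup>+z. indicator B (x + z) * f (x + z) \<partial>occupation lam)"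
    by (rule nn_integral_cong_AE) (use AE in eventually_elim, auto simp: indicator_def)
  then show ?thesis
    using nn_integral_occupation[OF lam, of "\<lambda>y. indicator A y * f y" x] nn_integral_occupation[OF lam, of "\<lambda>y. indicator B y * f y" x]
    by simp
qed

end

section \<open>The ground state as a potential, and its upper bound by the entry moment\<close>

locale relativistic_ground_state = relativistic_process m \<alpha> M X
  for m \<alpha> :: real and M :: "'w measure" and X :: "real \<Rightarrow> 'w \<Rightarrow> real ^ 'n::finite" +
  fixes a v l :: real and \<phi> :: "real ^ 'n \<Rightarrow> real"
  assumes a: "0 < a" and v: "0 < v" and gs: "ground_state m \<alpha> a v l \<phi>"
begin

definition lam :: real where "lam = - l"

lemma lam: "0 < lam" "lam < v"
proof -
  have "- v < l \<and> l < 0" using gs unfolding ground_state_def by blast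
  then show "0 < lam" "lam < v" by (auto simp: lam_def)
qed

lemma \<phi>_pos: "0 < \<phi> x" and \<phi>_cont: "continuous_on UNIV \<phi>" and \<phi>_bounded: "bounded (range \<phi>)"
  using gs unfolding ground_state_def by blast+

lemma \<phi>_nonneg[simp]: "0 \<le> \<phi> x"
  using \<phi>_pos[of x] by simp

lemma \<phi>_measurable[measurable]: "\<phi> \<in> borel_measurable borel"
  by (rule borel_measurable_continuous_onI[OF \<phi>_cont])

lemma \<phi>_eq_potential_ball:
  "ennreal (lam * \<phi> x) = ennreal v * potential lam (\<lambda>y. indicator (ball 0 a) y * ennreal (\<phi> y)) x"
proof -
  obtain b where b: "\<And>x. norm (\<phi> x) \<le> b" using \<phi>_bounded by (auto simp: bounded_iff)
  note O = occupation[OF lam(1)]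
  interpret O: prob_space "occupation lam" by (rule O(1))
  note [measurable_cong] = O(3)
  have int: "integrable (occupation lam) (\<lambda>z. v * indicator (ball 0 a) (x + z) * \<phi> (x + z))"
  proof (rule O.integrable_const_bound[where B="v * b"])
    have "v * indicator (ball 0 a) (x + z) * \<phi> (x + z) \<le> v * b" for z
      using b[of "x + z"] v order_trans[OF norm_ge_zero b[of x]] by (auto simp: indicator_def)
    then show "AE z in occupation lam. norm (v * indicator (ball 0 a) (x + z) * \<phi> (x + z)) \<le> v * b"
      using v by (intro AE_I2) simp
  qed measurable
  have "ennreal (lam * \<phi> x) = ennreal (LINT z|occupation lam. v * indicator (ball 0 a) (x + z) * \<phi> (x + z))"
    using ground_state_average[OF gs, of x] by (simp add: lam_def)
  also have "\<dots> = (\<integral>\<^sup>+z. ennreal (v * indicator (ball 0 a) (x + z) * \<phi> (x + z)) \<partial>occupation lam)"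
    using v by (intro nn_integral_eq_integral[symmetric] int) auto
  also have "\<dots> = (\<integral>\<^sup>+z. ennreal v * (indicator (ball 0 a) (x + z) * ennreal (\<phi> (x + z))) \<partial>occupation lam)"
    using v by (intro nn_integral_cong) (auto simp: ennreal_mult' ennreal_indicator mult.assoc indicator_def)
  also have "\<dots> = ennreal v * (\<integral>\<^sup>+z. indicator (ball 0 a) (x + z) * ennreal (\<phi> (x + z)) \<partial>occupation lam)"
    by (rule nn_integral_cmult) measurable
  also have "(\<integral>\<^sup>+z. indicator (ball 0 a) (x + z) * ennreal (\<phi> (x + z)) \<partial>occupation lam) = potential lam (\<lambda>y. indicator (ball 0 a) y * ennreal (\<phi> y)) x"
    by (rule nn_integral_occupation[OF lam(1), of "\<lambda>y. indicator (ball 0 a) y * ennreal (\<phi> y)"]) measurable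
  finally show ?thesis .
qed

text \<open>The two balls differ by a sphere, which the potential does not see. The closed version
  is the one that matches \<open>alive\<close>, whose approximation by grids uses closed
  sets.\<close>

lemma \<phi>_eq_potential_cball:
  "ennreal (lam * \<phi> x) = ennreal v * potential lam (\<lambda>y. indicator (cball 0 a) y * ennreal (\<phi> y)) x"
proof -
  have "potential lam (\<lambda>y. indicator (ball 0 a) y * ennreal (\<phi> y)) x = potential lam (\<lambda>y. indicator (cball 0 a) y * ennreal (\<phi> y)) x"
  proof (rule potential_indicator_null[OF lam(1)])
    have "ball 0 a - cball 0 a \<union> (cball 0 a - ball 0 a) = sphere (0::real^'n) a" by (auto simp: sphere_def)
    then show "emeasure lborel (ball 0 a - cball 0 a \<union> (cball 0 a - ball (0::real^'n) a)) = 0"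
      by (simp add: sphere_null)
  qed auto
  then show ?thesis by (simp add: \<phi>_eq_potential_ball)
qed

lemma \<phi>_excessive:
  assumes h: "0 \<le> h"
  shows "ennreal (exp (- lam * h)) * semigroup h (\<lambda>y. ennreal (\<phi> y)) x \<le> ennreal (\<phi> x)"
proof -
  define f where "f y = indicator (cball 0 a) y * ennreal (\<phi> y)" for y
  have [measurable]: "f \<in> borel_measurable borel" unfolding f_def[abs_def] by measurable
  have eq: "ennreal (\<phi> y) = ennreal (v / lam) * potential lam f y" for y
  proof -
    have "ennreal (\<phi> y) = ennreal (1 / lam) * ennreal (lam * \<phi> y)"
      using lam by (subst ennreal_mult[symmetric]) auto
    also have "\<dots> = (ennreal (1 / lam) * ennreal v) * potential lam f y"
      by (simp only: \<phi>_eq_potential_cball f_def[abs_def] mult.assoc)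
    also have "ennreal (1 / lam) * ennreal v = ennreal (v / lam)"
      using lam v by (subst ennreal_mult[symmetric]) auto
    finally show ?thesis .
  qed
  have "ennreal (exp (- lam * h)) * semigroup h (\<lambda>y. ennreal (\<phi> y)) x = ennreal (v / lam) * (ennreal (exp (- lam * h)) * semigroup h (potential lam f) x)"
  proof -
    have "semigroup h (\<lambda>y. ennreal (\<phi> y)) x = ennreal (v / lam) * semigroup h (potential lam f) x"
      unfolding semigroup_def eq by (rule nn_integral_cmult) measurable
    then show ?thesis by (simp only: mult.left_commute)
  qed
  also have "\<dots> \<le> ennreal (v / lam) * potential lam f x"
    by (intro mult_left_mono semigroup_potential_le lam h) auto
  finally show ?thesis by (simp only: eq)
qed

lemma entry_moment_Y: "entry_moment M X a c x = (\<integral>\<^sup>+\<omega>. exp_ereal (ereal c * entry_time a (shifted x Y) \<omega>) \<partial>M)"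
  unfolding entry_moment_def
proof (rule nn_integral_X_Y)
  fix \<omega> assume "\<omega> \<in> good"
  then have "entry_time a (shifted x X) \<omega> = entry_time a (shifted x Y) \<omega>"
    unfolding entry_time_def shifted_def by (intro arg_cong[where f=Inf] Collect_cong ex_cong1 conj_cong refl) (simp add: Y_eq_X)
  then show "exp_ereal (ereal c * entry_time a (shifted x X) \<omega>) = exp_ereal (ereal c * entry_time a (shifted x Y) \<omega>)" by simp
qed

lemma exit_moment_Y: "exit_moment M X a c x = (\<integral>\<^sup>+\<omega>. exp_ereal (ereal c * exit_time a (shifted x Y) \<omega>) \<partial>M)"
  unfolding exit_moment_def
proof (rule nn_integral_X_Y)
  fix \<omega> assume "\<omega> \<in> good"
  then have "exit_time a (shifted x X) \<omega> = exit_time a (shifted x Y) \<omega>"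
    unfolding exit_time_def shifted_def by (intro arg_cong[where f=Inf] Collect_cong ex_cong1 conj_cong refl) (simp add: Y_eq_X)
  then show "exp_ereal (ereal c * exit_time a (shifted x X) \<omega>) = exp_ereal (ereal c * exit_time a (shifted x Y) \<omega>)" by simp
qed

lemma entry_time_nonneg: "0 \<le> entry_time a Z \<omega>"
  unfolding entry_time_def by (rule Inf_greatest) auto

lemma exit_time_nonneg: "0 \<le> exit_time a Z \<omega>"
  unfolding exit_time_def by (rule Inf_greatest) auto

text \<open>A path contributes nothing before its entry time \<open>T\<close>, and the exponential
  law gives mass \<open>exp (- lam * T)\<close> to the times from \<open>T\<close> on. Time 0, which
  \<open>entry_time\<close> ignores, is a null set.\<close>

lemma potential_ball_le_entry_moment:
  "potential lam (indicator (ball 0 a)) x \<le> entry_moment M X a (- lam) x"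
proof -
  interpret pair_sigma_finite lborel M ..
  have "potential lam (indicator (ball 0 a)) x = (\<integral>\<^sup>+\<omega>. \<integral>\<^sup>+s. ennreal (exponential_density lam s) * indicator (ball 0 a) (x + Y s \<omega>) \<partial>lborel \<partial>M)"
    unfolding potential_def semigroup_def
    by (subst nn_integral_cmult[symmetric]) (auto intro!: Fubini'[symmetric])
  also have "\<dots> \<le> entry_moment M X a (- lam) x"
    unfolding entry_moment_Y
  proof (intro nn_integral_mono)
    fix \<omega>
    define T where "T = entry_time a (shifted x Y) \<omega>"
    have hit: "T \<le> ereal s" if "0 < s" "x + Y s \<omega> \<in> ball 0 a" for s
      unfolding T_def entry_time_def by (rule Inf_lower) (use that in \<open>auto simp: shifted_def\<close>)
    have T0: "0 \<le> T" unfolding T_def by (rule entry_time_nonneg)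
    have ne: "AE s in lborel. s \<noteq> (0::real)" by (rule AE_lborel_singleton)
    show "(\<integral>\<^sup>+s. ennreal (exponential_density lam s) * indicator (ball 0 a) (x + Y s \<omega>) \<partial>lborel) \<le> exp_ereal (ereal (- lam) * entry_time a (shifted x Y) \<omega>)"
    proof (cases T)
      case (real r)
      have "(\<integral>\<^sup>+s. ennreal (exponential_density lam s) * indicator (ball 0 a) (x + Y s \<omega>) \<partial>lborel) \<le> (\<integral>\<^sup>+s. indicator {r..} s * ennreal (exponential_density lam s) \<partial>lborel)"
      proof (rule nn_integral_mono_AE)
        show "AE s in lborel. ennreal (exponential_density lam s) * indicator (ball 0 a) (x + Y s \<omega>) \<le> indicator {r..} s * ennreal (exponential_density lam s)"
          using ne
        proof eventually_elim
          fix s :: real assume "s \<noteq> 0"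
          show "ennreal (exponential_density lam s) * indicator (ball 0 a) (x + Y s \<omega>) \<le> indicator {r..} s * ennreal (exponential_density lam s)"
          proof (cases "0 < s \<and> x + Y s \<omega> \<in> ball 0 a")
            case True then show ?thesis using hit[of s] real by (simp add: indicator_def)
          next
            case False then show ?thesis using \<open>s \<noteq> 0\<close> by (auto simp: exponential_density_def indicator_def)
          qed
        qed
      qed
      also have "\<dots> = ennreal (exp (- lam * r))"
        by (rule nn_integral_exponential_tail) (use lam T0 real in auto)
      finally show ?thesis using real by (simp add: T_def)
    next
      case PInf
      have "(\<integral>\<^sup>+s. ennreal (exponential_density lam s) * indicator (ball 0 a) (x + Y s \<omega>) \<partial>lborel) = (\<integral>\<^sup>+(s::real). 0 \<partial>lborel)"
      proof (rule nn_integral_cong_AE)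
        show "AE s in lborel. ennreal (exponential_density lam s) * indicator (ball 0 a) (x + Y s \<omega>) = 0"
          using ne
        proof eventually_elim
          fix s :: real assume "s \<noteq> 0"
          then show "ennreal (exponential_density lam s) * indicator (ball 0 a) (x + Y s \<omega>) = 0"
            using hit[of s] PInf by (cases "0 < s") (auto simp: exponential_density_def indicator_def)
        qed
      qed
      then show ?thesis by simp
    next
      case MInf then show ?thesis using T0 by simp
    qed
  qed
  finally show ?thesis .
qed

lemma \<phi>_le_entry_moment:
  assumes b: "\<And>y. norm y \<le> a \<Longrightarrow> \<phi> y \<le> b"
  shows "ennreal (\<phi> x) \<le> ennreal (v * b / lam) * entry_moment M X a (- lam) x"
proof -
  have "\<phi> 0 \<le> b" by (rule b) (use a in simp)
  then have b0: "0 \<le> b" using \<phi>_pos[of 0] by linarith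
  have c: "ennreal (v * b / lam) = ennreal (1 / lam) * (ennreal v * ennreal b)"
    using lam v b0 by (simp add: ennreal_mult[symmetric])
  have "ennreal (\<phi> x) = ennreal (1 / lam) * ennreal (lam * \<phi> x)"
    using lam by (simp add: ennreal_mult'[symmetric])
  also have "\<dots> = ennreal (1 / lam) * (ennreal v * potential lam (\<lambda>y. indicator (ball 0 a) y * ennreal (\<phi> y)) x)"
    by (simp add: \<phi>_eq_potential_ball)
  also have "potential lam (\<lambda>y. indicator (ball 0 a) y * ennreal (\<phi> y)) x \<le> potential lam (\<lambda>y. ennreal b * indicator (ball 0 a) y) x"
    using b by (intro potential_mono) (auto simp: indicator_def intro!: ennreal_leI)
  also have "potential lam (\<lambda>y. ennreal b * indicator (ball 0 a) y) x = ennreal b * potential lam (indicator (ball 0 a)) x"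
    unfolding potential_def semigroup_def by (simp add: nn_integral_cmult mult.left_commute)
  also have "potential lam (indicator (ball 0 a)) x \<le> entry_moment M X a (- lam) x"
    by (rule potential_ball_le_entry_moment)
  finally have "ennreal (\<phi> x) \<le> ennreal (1 / lam) * (ennreal v * (ennreal b * entry_moment M X a (- lam) x))"
    by (simp add: mult_left_mono)
  also have "\<dots> = ennreal (v * b / lam) * entry_moment M X a (- lam) x"
    unfolding c by (simp only: mult.assoc)
  finally show ?thesis .
qed

end

section \<open>Entry moments\<close>

context relativistic_ground_state
begin

lemma exp_ereal_infinity[simp]: "exp_ereal (- \<infinity>) = 0" "exp_ereal \<infinity> = \<infinity>"
  using exp_ereal.simps(2,3) by simp_all

text \<open>Optional stopping carried out by hand at the first grid index \<open>k \<ge> 1\<close>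
  inside the ball. The induction step lets excessiveness decrease the last term and then splits it
  according to whether index \<open>Suc n\<close> lies in the ball. Index 0 gets weight 1 because
  \<open>entry_time\<close> disregards time 0.\<close>

lemma hitting_sum_le:
  fixes h :: real and x :: "real ^ 'n"
  assumes h: "0 \<le> h"
  defines "H \<equiv> \<lambda>k \<omega>. \<Prod>i\<le>k. (if i = 0 then 1 else indicator (- ball 0 a) (x + Y (real i * h) \<omega>) :: ennreal)"
  shows "(\<Sum>k<n. ennreal (exp (- lam * (real (Suc k) * h))) * (\<integral>\<^sup>+\<omega>. H k \<omega> * (indicator (ball 0 a) (x + Y (real (Suc k) * h) \<omega>) * ennreal (\<phi> (x + Y (real (Suc k) * h) \<omega>))) \<partial>M))
    + ennreal (exp (- lam * (real n * h))) * (\<integral>\<^sup>+\<omega>. H n \<omega> * ennreal (\<phi> (x + Y (real n * h) \<omega>)) \<partial>M) \<le> ennreal (\<phi> x)"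
proof (induction n)
  case 0
  show ?case by (simp add: H_def emeasure_space_1)
next
  case (Suc n)
  have [measurable]: "H k \<in> borel_measurable M" for k unfolding H_def by measurable
  let ?q = "\<lambda>n \<omega>. ennreal (\<phi> (x + Y (real n * h) \<omega>))"
  let ?i = "\<lambda>\<omega>. indicator (ball 0 a) (x + Y (real (Suc n) * h) \<omega>) :: ennreal"
  have split: "H n \<omega> * ?q (Suc n) \<omega> = H n \<omega> * (?i \<omega> * ?q (Suc n) \<omega>) + H (Suc n) \<omega> * ?q (Suc n) \<omega>" for \<omega>
    by (simp add: H_def indicator_def del: of_nat_Suc)
  have m: "mono (\<lambda>i::nat. real i * h)" using h by (intro monoI mult_right_mono) auto
  have "(\<integral>\<^sup>+\<omega>. H n \<omega> * ?q (Suc n) \<omega> \<partial>M) = (\<integral>\<^sup>+\<omega>. H n \<omega> * semigroup (real (Suc n) * h - real n * h) (\<lambda>y. ennreal (\<phi> y)) (x + Y (real n * h) \<omega>) \<partial>M)"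
    using Y_markov[OF m _ , of "\<lambda>i y. if i = 0 then 1 else indicator (- ball 0 a) y" "\<lambda>y. ennreal (\<phi> y)" x n]
    by (simp add: H_def del: of_nat_Suc)
  also have "real (Suc n) * h - real n * h = h" by (simp add: algebra_simps)
  finally have mk: "(\<integral>\<^sup>+\<omega>. H n \<omega> * ?q (Suc n) \<omega> \<partial>M) = (\<integral>\<^sup>+\<omega>. H n \<omega> * semigroup h (\<lambda>y. ennreal (\<phi> y)) (x + Y (real n * h) \<omega>) \<partial>M)" .
  have e: "ennreal (exp (- lam * (real (Suc n) * h))) = ennreal (exp (- lam * (real n * h))) * ennreal (exp (- lam * h))"
    by (simp add: ennreal_mult'[symmetric] exp_add[symmetric] algebra_simps)
  have "ennreal (exp (- lam * (real (Suc n) * h))) * (\<integral>\<^sup>+\<omega>. H n \<omega> * ?q (Suc n) \<omega> \<partial>M)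
      = ennreal (exp (- lam * (real n * h))) * (\<integral>\<^sup>+\<omega>. H n \<omega> * (ennreal (exp (- lam * h)) * semigroup h (\<lambda>y. ennreal (\<phi> y)) (x + Y (real n * h) \<omega>)) \<partial>M)"
    unfolding mk e mult.assoc by (subst nn_integral_cmult[symmetric]) (auto simp: mult.left_commute)
  also have "\<dots> \<le> ennreal (exp (- lam * (real n * h))) * (\<integral>\<^sup>+\<omega>. H n \<omega> * ?q n \<omega> \<partial>M)"
    by (intro mult_left_mono nn_integral_mono \<phi>_excessive h) auto
  finally have step: "ennreal (exp (- lam * (real (Suc n) * h))) * (\<integral>\<^sup>+\<omega>. H n \<omega> * ?q (Suc n) \<omega> \<partial>M) \<le> ennreal (exp (- lam * (real n * h))) * (\<integral>\<^sup>+\<omega>. H n \<omega> * ?q n \<omega> \<partial>M)" .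
  have PQ: "ennreal (exp (- lam * (real (Suc n) * h))) * (\<integral>\<^sup>+\<omega>. H n \<omega> * (?i \<omega> * ?q (Suc n) \<omega>) \<partial>M) + ennreal (exp (- lam * (real (Suc n) * h))) * (\<integral>\<^sup>+\<omega>. H (Suc n) \<omega> * ?q (Suc n) \<omega> \<partial>M)
     = ennreal (exp (- lam * (real (Suc n) * h))) * (\<integral>\<^sup>+\<omega>. H n \<omega> * ?q (Suc n) \<omega> \<partial>M)"
    unfolding distrib_left[symmetric] split
    by (rule arg_cong2[where f="(*)", OF refl], rule nn_integral_add[symmetric]) measurable
  show ?case
    unfolding sum.lessThan_Suc add.assoc PQ by (rule order_trans[OF add_left_mono[OF step] Suc.IH])
qed

text \<open>The sum of \<open>Z n k\<close> over \<open>k\<close> is the discount factor at the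
  first grid point in the ball for mesh \<open>h n\<close>; since \<open>\<phi> \<ge> b\<close>
  there, its expectation is at most \<open>\<phi> x / b\<close>. As the mesh shrinks, Fatou gives
  the bound for the true entry time, because an open ball once visited is occupied long enough to
  contain a grid point.\<close>

lemma entry_moment_le_\<phi>:
  assumes b: "0 < b" "\<And>y. norm y \<le> a \<Longrightarrow> b \<le> \<phi> y"
  shows "ennreal b * entry_moment M X a (- lam) x \<le> ennreal (\<phi> x)"
proof -
  define h where "h n = 1 / real (Suc n)" for n
  have h: "0 < h n" for n by (simp add: h_def)
  define H where "H n k \<omega> = (\<Prod>i\<le>k. (if i = 0 then 1 else indicator (- ball 0 a) (x + Y (real i * h n) \<omega>) :: ennreal))" for n k \<omega>
  have [measurable]: "H n k \<in> borel_measurable M" for n k unfolding H_def by measurable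
  define Z where "Z n k \<omega> = ennreal (exp (- lam * (real (Suc k) * h n))) * (H n k \<omega> * indicator (ball 0 a) (x + Y (real (Suc k) * h n) \<omega>))" for n k \<omega>
  have [measurable]: "Z n k \<in> borel_measurable M" for n k unfolding Z_def by measurable
  have ib: "indicator (ball 0 a) y * ennreal b \<le> indicator (ball 0 a) y * ennreal (\<phi> y)" for y :: "real ^ 'n"
    by (cases "y \<in> ball 0 a") (auto intro!: ennreal_leI b(2))
  have le: "(\<integral>\<^sup>+\<omega>. (\<Sum>k. Z n k \<omega>) \<partial>M) \<le> ennreal (\<phi> x / b)" for n
  proof -
    have "(\<integral>\<^sup>+\<omega>. ennreal b * (\<Sum>k. Z n k \<omega>) \<partial>M) = (\<Sum>k. ennreal b * (\<integral>\<^sup>+\<omega>. Z n k \<omega> \<partial>M))"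
      by (simp add: nn_integral_cmult nn_integral_suminf)
    also have "\<dots> \<le> ennreal (\<phi> x)"
      unfolding suminf_eq_SUP
    proof (rule SUP_least)
      fix N
      have "(\<Sum>k<N. ennreal b * (\<integral>\<^sup>+\<omega>. Z n k \<omega> \<partial>M)) \<le> (\<Sum>k<N. ennreal (exp (- lam * (real (Suc k) * h n))) * (\<integral>\<^sup>+\<omega>. H n k \<omega> * (indicator (ball 0 a) (x + Y (real (Suc k) * h n) \<omega>) * ennreal (\<phi> (x + Y (real (Suc k) * h n) \<omega>))) \<partial>M))"
      proof (rule sum_mono)
        fix k
        have "ennreal b * (\<integral>\<^sup>+\<omega>. Z n k \<omega> \<partial>M) = ennreal (exp (- lam * (real (Suc k) * h n))) * (\<integral>\<^sup>+\<omega>. H n k \<omega> * (indicator (ball 0 a) (x + Y (real (Suc k) * h n) \<omega>) * ennreal b) \<partial>M)"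
          unfolding Z_def by (simp add: nn_integral_cmult[symmetric] mult_ac del: of_nat_Suc)
        also have "\<dots> \<le> ennreal (exp (- lam * (real (Suc k) * h n))) * (\<integral>\<^sup>+\<omega>. H n k \<omega> * (indicator (ball 0 a) (x + Y (real (Suc k) * h n) \<omega>) * ennreal (\<phi> (x + Y (real (Suc k) * h n) \<omega>))) \<partial>M)"
          by (intro mult_left_mono nn_integral_mono ib) auto
        finally show "ennreal b * (\<integral>\<^sup>+\<omega>. Z n k \<omega> \<partial>M) \<le> \<dots>" .
      qed
      also have "\<dots> \<le> ennreal (\<phi> x)"
        using hitting_sum_le[OF less_imp_le[OF h[of n]], where n=N and x=x, folded H_def] by (rule order_trans[rotated]) simp
      finally show "(\<Sum>k<N. ennreal b * (\<integral>\<^sup>+\<omega>. Z n k \<omega> \<partial>M)) \<le> ennreal (\<phi> x)" .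
    qed
    finally have "ennreal b * (\<integral>\<^sup>+\<omega>. (\<Sum>k. Z n k \<omega>) \<partial>M) \<le> ennreal (\<phi> x)"
      by (subst (asm) nn_integral_cmult) simp_all
    then have "ennreal (1 / b) * (ennreal b * (\<integral>\<^sup>+\<omega>. (\<Sum>k. Z n k \<omega>) \<partial>M)) \<le> ennreal (1 / b) * ennreal (\<phi> x)"
      by (rule mult_left_mono) simp
    moreover have "ennreal (1 / b) * ennreal b = 1" using b(1) by (subst ennreal_mult[symmetric]) auto
    moreover have "ennreal (1 / b) * ennreal (\<phi> x) = ennreal (\<phi> x / b)" using b(1) by (subst ennreal_mult[symmetric]) auto
    ultimately show ?thesis by (simp only: mult.assoc[symmetric] mult_1)
  qed
  \<comment> \<open>A hit at any index \<open>k\<close> suffices: the first hit is no later, so its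
    discount factor is at least as large.\<close>
  have Zge: "ennreal (exp (- lam * (real (Suc k) * h n))) \<le> (\<Sum>k. Z n k \<omega>)" if k: "x + Y (real (Suc k) * h n) \<omega> \<in> ball 0 a" for n k \<omega>
  proof -
    define j where "j = (LEAST k. x + Y (real (Suc k) * h n) \<omega> \<in> ball 0 a)"
    have j: "x + Y (real (Suc j) * h n) \<omega> \<in> ball 0 a" unfolding j_def by (rule LeastI) (rule k)
    have jk: "j \<le> k" unfolding j_def by (rule Least_le) (rule k)
    have "x + Y (real i * h n) \<omega> \<notin> ball 0 a" if "i \<noteq> 0" "i \<le> j" for i
      using not_less_Least[of "i - 1" "\<lambda>k. x + Y (real (Suc k) * h n) \<omega> \<in> ball 0 a"] that unfolding j_def[symmetric] by simp
    then have "H n j \<omega> = 1" unfolding H_def by (intro prod.neutral) auto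
    then have "Z n j \<omega> = ennreal (exp (- lam * (real (Suc j) * h n)))" using j by (simp add: Z_def)
    moreover have z2: "Z n j \<omega> \<le> (\<Sum>k. Z n k \<omega>)" using sum_le_suminf[of "\<lambda>k. Z n k \<omega>" "{j}"] by simp
    moreover have "ennreal (exp (- lam * (real (Suc k) * h n))) \<le> ennreal (exp (- lam * (real (Suc j) * h n)))"
      using jk lam h[of n] by (intro ennreal_leI) (simp add: mult_left_mono mult_right_mono)
    ultimately show ?thesis by (simp only: order_trans)
  qed
  have "entry_moment M X a (- lam) x \<le> ennreal (\<phi> x / b)"
    unfolding entry_moment_Y
  proof (rule nn_integral_le_of_tendsto[OF _ le])
    fix \<omega>
    define T where "T = entry_time a (shifted x Y) \<omega>"
    show "exp_ereal (ereal (- lam) * entry_time a (shifted x Y) \<omega>) \<le> liminf (\<lambda>n. (\<Sum>k. Z n k \<omega>))"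
      unfolding T_def[symmetric]
    proof (cases T)
      case (real r)
      \<comment> \<open>One \<open>\<epsilon>\<close> pays for replacing the infimum by an actual
        visit, the other for moving on to the next grid point.\<close>
      have ev: "ennreal (exp (- lam * (r + 2 * \<epsilon>))) \<le> liminf (\<lambda>n. (\<Sum>k. Z n k \<omega>))" if e: "0 < \<epsilon>" for \<epsilon>
      proof (rule Liminf_bounded)
        have "T < ereal (r + \<epsilon>)" using real e by simp
        then obtain t where t: "0 < t" "x + Y t \<omega> \<in> ball 0 a" "t < r + \<epsilon>"
          unfolding T_def entry_time_def Inf_less_iff by (auto simp: shifted_def)
        have "((\<lambda>s. x + Y s \<omega>) \<longlongrightarrow> x + Y t \<omega>) (at_right t)" by (intro tendsto_intros Y_right_cont)
        then have "eventually (\<lambda>s. x + Y s \<omega> \<in> ball 0 a) (at_right t)"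
          by (rule topological_tendstoD) (use t in auto)
        then obtain d where d: "t < d" "\<And>s. t < s \<Longrightarrow> s < d \<Longrightarrow> x + Y s \<omega> \<in> ball 0 a"
          unfolding eventually_at_right_field by blast
        have "eventually (\<lambda>n. h n < min (d - t) \<epsilon>) sequentially"
          using d(1) e unfolding h_def
          by (intro order_tendstoD(2)[OF LIMSEQ_Suc[OF lim_1_over_n]]) auto
        then show "\<forall>\<^sub>F n in sequentially. ennreal (exp (- lam * (r + 2 * \<epsilon>))) \<le> (\<Sum>k. Z n k \<omega>)"
        proof eventually_elim
          fix n assume n: "h n < min (d - t) \<epsilon>"
          \<comment> \<open>\<open>Suc k\<close> is the first grid index strictly after
            \<open>t\<close>, at distance at most \<open>h n\<close>.\<close>
          define k where "k = nat \<lfloor>t / h n\<rfloor>"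
          have "of_int \<lfloor>t / h n\<rfloor> \<le> t / h n" "t / h n < of_int \<lfloor>t / h n\<rfloor> + 1" by linarith+
          moreover have "real k = of_int \<lfloor>t / h n\<rfloor>" unfolding k_def using t(1) h[of n] by simp
          ultimately have "real k \<le> t / h n" "t / h n < real (Suc k)" unfolding of_nat_Suc by linarith+
          then have k: "real k * h n \<le> t" "t < real (Suc k) * h n"
            by (simp_all only: pos_le_divide_eq[OF h] pos_divide_less_eq[OF h])
          have k2: "real (Suc k) * h n \<le> t + h n" using k(1) by (simp add: algebra_simps)
          have "x + Y (real (Suc k) * h n) \<omega> \<in> ball 0 a" by (rule d(2)[OF k(2)]) (use k2 n in simp)
          from Zge[OF this] have "ennreal (exp (- lam * (real (Suc k) * h n))) \<le> (\<Sum>k. Z n k \<omega>)" .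
          moreover have "ennreal (exp (- lam * (r + 2 * \<epsilon>))) \<le> ennreal (exp (- lam * (real (Suc k) * h n)))"
            using k2 n t(3) lam by (intro ennreal_leI) (simp del: of_nat_Suc)
          ultimately show "ennreal (exp (- lam * (r + 2 * \<epsilon>))) \<le> (\<Sum>k. Z n k \<omega>)"
            by (rule order_trans[rotated])
        qed
      qed
      have "(\<lambda>n. ennreal (exp (- lam * (r + 2 * (1 / real (Suc n)))))) \<longlonglongrightarrow> ennreal (exp (- lam * (r + 2 * 0)))"
        by (intro tendsto_intros LIMSEQ_Suc[OF lim_1_over_n])
      then have "ennreal (exp (- lam * (r + 2 * 0))) \<le> liminf (\<lambda>n. (\<Sum>k. Z n k \<omega>))"
      proof (rule tendsto_upperbound)
        show "\<forall>\<^sub>F n in sequentially. ennreal (exp (- lam * (r + 2 * (1 / real (Suc n))))) \<le> liminf (\<lambda>n. (\<Sum>k. Z n k \<omega>))"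
          by (intro always_eventually allI ev) simp
      qed simp
      then show "exp_ereal (ereal (- lam) * T) \<le> liminf (\<lambda>n. (\<Sum>k. Z n k \<omega>))" using real by simp
    next
      case PInf
      then show "exp_ereal (ereal (- lam) * T) \<le> liminf (\<lambda>n. (\<Sum>k. Z n k \<omega>))" using lam by simp
    next
      case MInf
      then show "exp_ereal (ereal (- lam) * T) \<le> liminf (\<lambda>n. (\<Sum>k. Z n k \<omega>))"
        using entry_time_nonneg[of "shifted x Y" \<omega>] by (simp add: T_def)
    qed
  qed measurable
  then have "ennreal b * entry_moment M X a (- lam) x \<le> ennreal b * ennreal (\<phi> x / b)"
    by (rule mult_left_mono) simp
  also have "\<dots> = ennreal (\<phi> x)" using b(1) by (subst ennreal_mult[symmetric]) auto
  finally show ?thesis .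
qed

end

section \<open>Survival inside the ball\<close>

context relativistic_process
begin

text \<open>The Markov property peels off the grid steps after index \<open>N\<close>, starting from
  the last. Each contributes one step of length \<open>h\<close> killed outside \<open>D\<close>, so
  the whole future becomes a \<open>K\<close>-fold iterate evaluated at the position at time
  \<open>t N\<close>.\<close>

lemma Y_grid_markov:
  fixes f :: "nat \<Rightarrow> real ^ 'n \<Rightarrow> ennreal" and g :: "real ^ 'n \<Rightarrow> ennreal"
  assumes t: "mono t" "t 0 = 0" and h: "0 \<le> h" and th: "\<And>k. t (N + k) = t N + real k * h"
    and [measurable]: "\<And>i. f i \<in> borel_measurable borel" "D \<in> sets borel" "g \<in> borel_measurable borel"
  shows "(\<integral>\<^sup>+\<omega>. (\<Prod>i\<le>N. f i (x + Y (t i) \<omega>)) * ((\<Prod>k\<in>{1..K}. indicator D (x + Y (t (N + k)) \<omega>)) * g (x + Y (t (N + K)) \<omega>)) \<partial>M)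
    = (\<integral>\<^sup>+\<omega>. (\<Prod>i\<le>N. f i (x + Y (t i) \<omega>)) * ((\<lambda>g. semigroup h (\<lambda>y. indicator D y * g y)) ^^ K) g (x + Y (t N) \<omega>) \<partial>M)"
  using assms(7)
proof (induction K arbitrary: g)
  case 0
  then show ?case by simp
next
  case (Suc K)
  note [measurable] = Suc.prems
  let ?V = "\<lambda>g. semigroup h (\<lambda>y. indicator D y * g y)"
  let ?F = "\<lambda>i. if i \<le> N then f i else indicator D"
  have prod: "(\<Prod>i\<le>N + K. ?F i (x + Y (t i) \<omega>)) = (\<Prod>i\<le>N. f i (x + Y (t i) \<omega>)) * (\<Prod>k\<in>{1..K}. indicator D (x + Y (t (N + k)) \<omega>))" for \<omega>
    by (induction K) (auto simp: atMost_Suc mult.commute mult.left_commute prod.atLeast1_atMost_eq)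
  have "(\<integral>\<^sup>+\<omega>. (\<Prod>i\<le>N. f i (x + Y (t i) \<omega>)) * ((\<Prod>k\<in>{1..Suc K}. indicator D (x + Y (t (N + k)) \<omega>)) * g (x + Y (t (N + Suc K)) \<omega>)) \<partial>M)
    = (\<integral>\<^sup>+\<omega>. (\<Prod>i\<le>N + K. ?F i (x + Y (t i) \<omega>)) * (\<lambda>y. indicator D y * g y) (x + Y (t (Suc (N + K))) \<omega>) \<partial>M)"
    unfolding prod by (simp add: prod.atLeast1_atMost_eq mult.assoc)
  also have "\<dots> = (\<integral>\<^sup>+\<omega>. (\<Prod>i\<le>N + K. ?F i (x + Y (t i) \<omega>)) * semigroup (t (Suc (N + K)) - t (N + K)) (\<lambda>y. indicator D y * g y) (x + Y (t (N + K)) \<omega>) \<partial>M)"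
    by (rule Y_markov[OF t]) auto
  also have "t (Suc (N + K)) - t (N + K) = h"
    using th[of "Suc K"] th[of K] by (simp add: algebra_simps)
  also have "(\<integral>\<^sup>+\<omega>. (\<Prod>i\<le>N + K. ?F i (x + Y (t i) \<omega>)) * ?V g (x + Y (t (N + K)) \<omega>) \<partial>M) =
     (\<integral>\<^sup>+\<omega>. (\<Prod>i\<le>N. f i (x + Y (t i) \<omega>)) * ((\<Prod>k\<in>{1..K}. indicator D (x + Y (t (N + k)) \<omega>)) * ?V g (x + Y (t (N + K)) \<omega>)) \<partial>M)"
    unfolding prod by (simp add: mult.assoc)
  also have "\<dots> = (\<integral>\<^sup>+\<omega>. (\<Prod>i\<le>N. f i (x + Y (t i) \<omega>)) * (?V ^^ K) (?V g) (x + Y (t N) \<omega>) \<partial>M)"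
    by (rule Suc.IH) measurable
  also have "(?V ^^ K) (?V g) = (?V ^^ Suc K) g" by (simp only: funpow_Suc_right o_apply)
  finally show ?case .
qed

text \<open>Time 0 is excluded, in agreement with \<open>exit_time\<close>, so the starting point
  itself is not tested.\<close>

definition alive :: "(real ^ 'n) set \<Rightarrow> real ^ 'n \<Rightarrow> real \<Rightarrow> 'w \<Rightarrow> ennreal" where
  "alive D x s \<omega> = (if \<forall>u. 0 < u \<and> u \<le> s \<longrightarrow> x + Y u \<omega> \<in> D then 1 else 0)"

definition alive_grid :: "(real ^ 'n) set \<Rightarrow> nat \<Rightarrow> real ^ 'n \<Rightarrow> real \<Rightarrow> 'w \<Rightarrow> ennreal" where
  "alive_grid D n x s \<omega> = (\<Prod>k\<in>{1..Suc n}. indicator D (x + Y (real k * (s / real (Suc n))) \<omega>))"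

lemma alive_le_1: "alive D x s \<omega> \<le> 1"
  by (simp add: alive_def)

text \<open>Closedness of \<open>D\<close> meets right continuity here; the measurability of
  \<open>alive\<close> and its approximation by grids both rest on this.\<close>

lemma leaves_open:
  assumes D: "closed D" and u: "x + Y u \<omega> \<notin> D"
  obtains d where "u < d" "\<And>s. u \<le> s \<Longrightarrow> s < d \<Longrightarrow> x + Y s \<omega> \<notin> D"
proof -
  have "((\<lambda>s. x + Y s \<omega>) \<longlongrightarrow> x + Y u \<omega>) (at_right u)" by (intro tendsto_intros Y_right_cont)
  then have "eventually (\<lambda>s. x + Y s \<omega> \<in> - D) (at_right u)"
    by (rule topological_tendstoD) (use D u in \<open>auto simp: open_Compl\<close>)
  then obtain d where d: "u < d" "\<And>s. u < s \<Longrightarrow> s < d \<Longrightarrow> x + Y s \<omega> \<in> - D"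
    unfolding eventually_at_right_field by blast
  show ?thesis
  proof (rule that[OF d(1)])
    fix s assume "u \<le> s" "s < d"
    then show "x + Y s \<omega> \<notin> D" using d(2)[of s] u by (cases "u = s") auto
  qed
qed

text \<open>A path that leaves before time \<open>s\<close> is seen outside at a rational time,
  since it stays outside for a while; a departure exactly at \<open>s\<close> is tested
  separately.\<close>

lemma alive_measurable[measurable (raw)]:
  assumes D: "closed D" and [measurable]: "x \<in> borel_measurable N" "s \<in> borel_measurable N" "w \<in> measurable N M"
  shows "(\<lambda>p. alive D (x p) (s p) (w p)) \<in> borel_measurable N"
proof -
  have [measurable]: "D \<in> sets borel" using D by (rule borel_closed)
  have eq: "(\<forall>u. 0 < u \<and> u \<le> s p \<longrightarrow> x p + Y u (w p) \<in> D) \<longleftrightarrow>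
     (\<forall>q::rat. 0 < real_of_rat q \<and> real_of_rat q \<le> s p \<longrightarrow> x p + Y (real_of_rat q) (w p) \<in> D) \<and> (0 < s p \<longrightarrow> x p + Y (s p) (w p) \<in> D)" (is "?L = ?R") for p
  proof
    assume r: ?R
    show ?L
    proof (intro allI impI, rule ccontr)
      fix u assume u: "0 < u \<and> u \<le> s p" and n: "x p + Y u (w p) \<notin> D"
      then have us: "u < s p" using r by (cases "u = s p") auto
      obtain d where d: "u < d" "\<And>s. u \<le> s \<Longrightarrow> s < d \<Longrightarrow> x p + Y s (w p) \<notin> D"
        using leaves_open[OF D n] by blast
      obtain q where q: "u < real_of_rat q" "real_of_rat q < min d (s p)"
        using of_rat_dense[of u "min d (s p)"] d us by auto
      have "x p + Y (real_of_rat q) (w p) \<in> D"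
        by (rule conjunct1[OF r, rule_format]) (use q u in linarith)
      then show False using d(2)[of "real_of_rat q"] q by simp
    qed
  qed auto
  show ?thesis unfolding alive_def eq by measurable
qed

lemma alive_grid_measurable[measurable]:
  assumes [measurable]: "D \<in> sets borel"
  shows "alive_grid D n x s \<in> borel_measurable M"
  unfolding alive_grid_def[abs_def] by measurable

lemma alive_grid_le_1: "alive_grid D n x s \<omega> \<le> 1"
  unfolding alive_grid_def by (intro prod_le_1) (auto simp: indicator_def)

text \<open>A path that is outside at some time \<open>u\<close> stays outside on an interval to the
  right of \<open>u\<close>, where every fine grid has a point. The last grid point is
  \<open>s\<close> itself, so \<open>u = s\<close> is covered as well.\<close>

lemma alive_grid_tendsto:
  assumes D: "closed D" and s: "0 < s"
  shows "(\<lambda>n. alive_grid D n x s \<omega>) \<longlonglongrightarrow> alive D x s \<omega>"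
proof (cases "\<forall>u. 0 < u \<and> u \<le> s \<longrightarrow> x + Y u \<omega> \<in> D")
  case True
  have "alive_grid D n x s \<omega> = 1" for n
    unfolding alive_grid_def
  proof (rule prod.neutral, rule ballI)
    fix k assume k: "k \<in> {1..Suc n}"
    have "real k * (s / real (Suc n)) \<le> real (Suc n) * (s / real (Suc n))"
      using k s by (intro mult_right_mono) auto
    then have "real k * (s / real (Suc n)) \<le> s" by simp
    moreover have "0 < real k * (s / real (Suc n))" using k s by simp
    ultimately show "indicator D (x + Y (real k * (s / real (Suc n))) \<omega>) = (1::ennreal)"
      using True by simp
  qed
  then show ?thesis using True by (simp add: alive_def)
next
  case False
  then obtain u where u: "0 < u" "u \<le> s" "x + Y u \<omega> \<notin> D" by blast
  obtain d where d: "u < d" "\<And>s. u \<le> s \<Longrightarrow> s < d \<Longrightarrow> x + Y s \<omega> \<notin> D"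
    using leaves_open[OF D u(3)] by blast
  have "(\<lambda>n. s * (1 / real (Suc n))) \<longlonglongrightarrow> s * 0" by (intro tendsto_intros LIMSEQ_Suc lim_1_over_n)
  then have "eventually (\<lambda>n. s * (1 / real (Suc n)) < d - u) sequentially"
    by (rule order_tendstoD(2)) (use d in simp)
  then have "eventually (\<lambda>n. alive_grid D n x s \<omega> = 0) sequentially"
  proof eventually_elim
    fix n assume n: "s * (1 / real (Suc n)) < d - u"
    define h where "h = s / real (Suc n)"
    have h: "0 < h" "h < d - u" "real (Suc n) * h = s" using n s by (auto simp: h_def)
    define k where "k = nat \<lceil>u / h\<rceil>"
    have "real k = of_int \<lceil>u / h\<rceil>" unfolding k_def using u(1) h by simp
    then have "u / h \<le> real k" "real k < u / h + 1" by linarith+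
    then have k: "u \<le> real k * h" "real k * h < u + h"
      using h(1) by (simp_all add: field_simps)
    have "1 \<le> k" using k(1) u(1) h(1) by (cases k) auto
    have "u / h \<le> real (Suc n)" using u(2) h by (simp only: pos_divide_le_eq)
    then have "k \<le> Suc n" unfolding k_def by (simp add: nat_le_iff ceiling_le_iff)
    then have "k \<in> {1..Suc n}" using \<open>1 \<le> k\<close> by simp
    moreover have "indicator D (x + Y (real k * (s / real (Suc n))) \<omega>) = (0::ennreal)"
      using d(2)[OF k(1)] k(2) h(2) unfolding h_def[symmetric] by simp
    ultimately show "alive_grid D n x s \<omega> = 0"
      unfolding alive_grid_def by (intro prod_zero) auto
  qed
  then show ?thesis using False by (auto simp: alive_def intro: tendsto_eventually)
qed

definition survival :: "(real ^ 'n) set \<Rightarrow> real \<Rightarrow> real ^ 'n \<Rightarrow> ennreal" where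
  "survival D s x = (\<integral>\<^sup>+\<omega>. alive D x s \<omega> \<partial>M)"

lemma survival_measurable[measurable (raw)]:
  assumes "closed D" and [measurable]: "s \<in> borel_measurable N" "x \<in> borel_measurable N"
  shows "(\<lambda>p. survival D (s p) (x p)) \<in> borel_measurable N"
  unfolding survival_def using assms(1) by measurable

lemma survival_le_1: "survival D s x \<le> 1"
proof -
  have "survival D s x \<le> (\<integral>\<^sup>+\<omega>. 1 \<partial>M)" unfolding survival_def by (intro nn_integral_mono alive_le_1)
  then show ?thesis by (simp add: emeasure_space_1)
qed

text \<open>The grid has \<open>N\<close> steps up to \<open>u\<close> and \<open>N\<close> further
  ones up to \<open>u + r\<close>, so that \<open>u\<close> is a grid point at which
  \<open>Y_grid_markov\<close> factorises. Survival implies survival on every grid, which gives the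
  inequality before the limit; the two factors on the right then converge to \<open>alive\<close>
  and \<open>survival\<close>. This direction is the one that bounds moments from above.\<close>

lemma survival_markov:
  assumes D: "closed D" and u: "0 < u" and r: "0 < r"
  shows "survival D (u + r) x \<le> (\<integral>\<^sup>+\<omega>. alive D x u \<omega> * survival D r (x + Y u \<omega>) \<partial>M)"
proof -
  have [measurable]: "D \<in> sets borel" using D by (rule borel_closed)
  define W where "W n y = (\<integral>\<^sup>+\<omega>. alive_grid D n y r \<omega> \<partial>M)" for n y
  have Wm[measurable]: "W n \<in> borel_measurable borel" for n
    unfolding W_def[abs_def] alive_grid_def by measurable
  have Wlim: "(\<lambda>n. W n y) \<longlonglongrightarrow> survival D r y" for y
    unfolding W_def survival_def
    by (rule nn_integral_dominated_convergence[where w="\<lambda>_. 1"])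
       (use D in \<open>auto intro!: AE_I2 alive_grid_le_1 alive_grid_tendsto r simp: emeasure_space_1\<close>)
  have W1: "W n y \<le> 1" for n y
  proof -
    have "W n y \<le> (\<integral>\<^sup>+\<omega>. 1 \<partial>M)" unfolding W_def by (intro nn_integral_mono alive_grid_le_1)
    then show ?thesis by (simp add: emeasure_space_1)
  qed
  have le: "survival D (u + r) x \<le> (\<integral>\<^sup>+\<omega>. alive_grid D n x u \<omega> * W n (x + Y u \<omega>) \<partial>M)" for n
  proof -
    define N where "N = Suc n"
    have N: "0 < real N" by (simp add: N_def)
    define t where "t i = (if i \<le> N then real i * (u / real N) else u + real (i - N) * (r / real N))" for i
    have tN: "t N = u" using N by (simp add: t_def)
    have tNk: "t (N + k) = t N + real k * (r / real N)" for k
      unfolding tN using N by (cases "k = 0") (auto simp: t_def)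
    have "t i \<le> t (Suc i)" for i
    proof (cases "Suc i \<le> N")
      case True then show ?thesis using u N by (auto simp: t_def divide_simps)
    next
      case False
      then obtain k where k: "i = N + k" by (metis add_leE le_add_diff_inverse not_less_eq_eq)
      have "Suc i = N + Suc k" using k by simp
      moreover have "real k * (r / real N) \<le> real (Suc k) * (r / real N)" using r N by (intro mult_right_mono) auto
      ultimately show ?thesis unfolding k using tNk[of k] tNk[of "Suc k"] by simp
    qed
    then have mt: "mono t" by (simp add: mono_iff_le_Suc)
    have t0: "t 0 = 0" by (simp add: t_def)
    let ?f = "\<lambda>i. if i = 0 then (\<lambda>_. 1) else indicator D :: real ^ 'n \<Rightarrow> ennreal"
    let ?V = "\<lambda>g. semigroup (r / real N) (\<lambda>y. indicator D y * g y)"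
    have prod: "(\<Prod>i\<le>N. ?f i (x + Y (t i) \<omega>)) = alive_grid D n x u \<omega>" for \<omega>
    proof -
      have "(\<Prod>i\<le>N. ?f i (x + Y (t i) \<omega>)) = (\<Prod>i\<in>{1..N}. ?f i (x + Y (t i) \<omega>))"
        by (rule prod.mono_neutral_right) (auto simp: not_less_eq_eq)
      also have "\<dots> = alive_grid D n x u \<omega>"
        unfolding alive_grid_def N_def[symmetric] by (intro prod.cong) (auto simp: t_def)
      finally show ?thesis .
    qed
    \<comment> \<open>The same grid lemma with an empty past identifies the iterated killed step as
      grid survival from \<open>y\<close>.\<close>
    have VW: "(?V ^^ N) (\<lambda>_. 1) y = W n y" for y
    proof -
      have m: "mono (\<lambda>i::nat. real i * (r / real N))" using r N by (intro monoI mult_right_mono) auto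
      have "W n y = (\<integral>\<^sup>+\<omega>. (\<Prod>i\<le>0. (\<lambda>_. 1) (y + Y (real i * (r / real N)) \<omega>)) * ((\<Prod>k\<in>{1..N}. indicator D (y + Y (real (0 + k) * (r / real N)) \<omega>)) * 1) \<partial>M)"
        unfolding W_def alive_grid_def N_def by simp
      also have "\<dots> = (\<integral>\<^sup>+\<omega>. (\<Prod>i\<le>0. (\<lambda>_. 1) (y + Y (real i * (r / real N)) \<omega>)) * (?V ^^ N) (\<lambda>_. 1) (y + Y (real 0 * (r / real N)) \<omega>) \<partial>M)"
        by (rule Y_grid_markov[OF m, where g="\<lambda>_. 1" and f="\<lambda>_ _. 1"]) (use r in auto)
      also have "\<dots> = (?V ^^ N) (\<lambda>_. 1) y" by (simp add: emeasure_space_1)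
      finally show ?thesis ..
    qed
    have "survival D (u + r) x \<le> (\<integral>\<^sup>+\<omega>. (\<Prod>i\<le>N. ?f i (x + Y (t i) \<omega>)) * ((\<Prod>k\<in>{1..N}. indicator D (x + Y (t (N + k)) \<omega>)) * 1) \<partial>M)"
      unfolding survival_def
    proof (intro nn_integral_mono)
      fix \<omega>
      show "alive D x (u + r) \<omega> \<le> (\<Prod>i\<le>N. ?f i (x + Y (t i) \<omega>)) * ((\<Prod>k\<in>{1..N}. indicator D (x + Y (t (N + k)) \<omega>)) * 1)"
      proof (cases "\<forall>s. 0 < s \<and> s \<le> u + r \<longrightarrow> x + Y s \<omega> \<in> D")
        case True
        have D1: "x + Y (t i) \<omega> \<in> D" if "i \<noteq> 0" "i \<le> N + N" for i
        proof -
          have "t i \<le> t (N + N)" using monoD[OF mt that(2)] .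
          also have "\<dots> = u + r" unfolding tNk tN using N by simp
          finally have 1: "t i \<le> u + r" .
          have "t 1 \<le> t i" using monoD[OF mt, of 1 i] that by simp
          moreover have "0 < t 1" using u N by (simp add: t_def N_def)
          ultimately show ?thesis using True 1 by auto
        qed
        have "(\<Prod>i\<le>N. ?f i (x + Y (t i) \<omega>)) = 1" by (rule prod.neutral) (use D1 in auto)
        moreover have "(\<Prod>k\<in>{1..N}. indicator D (x + Y (t (N + k)) \<omega>)) = (1::ennreal)"
          by (rule prod.neutral) (use D1 N in auto)
        ultimately show ?thesis using alive_le_1 by simp
      next
        case False
        then have "alive D x (u + r) \<omega> = 0" unfolding alive_def by (simp only: if_False)
        then show ?thesis by simp
      qed
    qed
    also have "\<dots> = (\<integral>\<^sup>+\<omega>. (\<Prod>i\<le>N. ?f i (x + Y (t i) \<omega>)) * (?V ^^ N) (\<lambda>_. 1) (x + Y (t N) \<omega>) \<partial>M)"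
      by (rule Y_grid_markov[OF mt t0 _ tNk, where g="\<lambda>_. 1"]) (use r N in auto)
    finally show ?thesis unfolding prod VW tN .
  qed
  have "(\<lambda>n. \<integral>\<^sup>+\<omega>. alive_grid D n x u \<omega> * W n (x + Y u \<omega>) \<partial>M) \<longlonglongrightarrow> (\<integral>\<^sup>+\<omega>. alive D x u \<omega> * survival D r (x + Y u \<omega>) \<partial>M)"
  proof (rule nn_integral_dominated_convergence[where w="\<lambda>_. 1"])
    show "AE \<omega> in M. (\<lambda>n. alive_grid D n x u \<omega> * W n (x + Y u \<omega>)) \<longlonglongrightarrow> alive D x u \<omega> * survival D r (x + Y u \<omega>)"
    proof (intro AE_I2 tendsto_mult_ennreal alive_grid_tendsto[OF D u] Wlim)
      fix \<omega>
      have "survival D r (x + Y u \<omega>) \<noteq> top"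
        by (rule less_imp_neq[OF le_less_trans[OF survival_le_1 ennreal_one_less_top]])
      moreover have "alive D x u \<omega> \<noteq> top" by (simp add: alive_def)
      ultimately show "\<not> (alive D x u \<omega> = 0 \<and> survival D r (x + Y u \<omega>) = \<infinity> \<or> alive D x u \<omega> = \<infinity> \<and> survival D r (x + Y u \<omega>) = 0)"
        unfolding infinity_ennreal_def by blast
    qed
    show "AE \<omega> in M. alive_grid D n x u \<omega> * W n (x + Y u \<omega>) \<le> 1" for n
      using mult_mono[OF alive_grid_le_1 W1] by (intro AE_I2) simp
  qed (use D in \<open>auto simp: emeasure_space_1\<close>)
  then show ?thesis by (rule tendsto_lowerbound) (use le in \<open>auto intro!: always_eventually\<close>)
qed

end

text \<open>\<open>exp (- v * s)\<close> and the mass that \<open>exponential_density v\<close>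
  gives to times up to \<open>s\<close> add up to 1; multiplying by
  \<open>lam * exp ((v - lam) * s)\<close> redistributes the exponents. In this form the growing
  weight is built from \<open>exponential_density lam\<close> and the factor \<open>v\<close>, the
  two ingredients of the potential identity for \<open>\<phi>\<close>.\<close>

lemma exp_le_exponential_renewal:
  fixes lam v s :: real
  assumes lam: "0 < lam" and v: "0 < v" and s: "0 < s"
  shows "ennreal (lam * exp ((v - lam) * s)) \<le> ennreal (exponential_density lam s) +
    ennreal v * (\<integral>\<^sup>+u. (if 0 < u \<and> u < s then 1 else 0) * ennreal (exponential_density lam u * exp ((v - lam) * (s - u))) \<partial>lborel)"
proof -
  have ind: "indicator {0<..<s} u = (if 0 < u \<and> u < s then 1 else 0 :: ennreal)" for u by (simp add: indicator_def)
  have AE: "AE u in lborel. u \<noteq> (0::real)" by (rule AE_lborel_singleton)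
  have "1 = (\<integral>\<^sup>+u. ennreal (exponential_density v u) \<partial>lborel)"
    by (rule nn_integral_exponential_density[OF v, symmetric])
  also have "\<dots> \<le> (\<integral>\<^sup>+u. indicator {s..} u * ennreal (exponential_density v u) + indicator {0<..<s} u * ennreal (exponential_density v u) \<partial>lborel)"
    by (rule nn_integral_mono_AE) (use AE in eventually_elim, auto simp: exponential_density_def indicator_def)
  also have "\<dots> = ennreal (exp (- v * s)) + (\<integral>\<^sup>+u. indicator {0<..<s} u * ennreal (exponential_density v u) \<partial>lborel)"
    using nn_integral_exponential_tail[OF v less_imp_le[OF s]] by (subst nn_integral_add) auto
  finally have 1: "1 \<le> ennreal (exp (- v * s)) + (\<integral>\<^sup>+u. indicator {0<..<s} u * ennreal (exponential_density v u) \<partial>lborel)" .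
  have "ennreal (lam * exp ((v - lam) * s)) * 1 \<le> ennreal (lam * exp ((v - lam) * s)) * (ennreal (exp (- v * s)) + (\<integral>\<^sup>+u. indicator {0<..<s} u * ennreal (exponential_density v u) \<partial>lborel))"
    by (rule mult_left_mono[OF 1]) simp
  also have "\<dots> = ennreal (lam * exp ((v - lam) * s)) * ennreal (exp (- v * s)) + (\<integral>\<^sup>+u. ennreal (lam * exp ((v - lam) * s)) * (indicator {0<..<s} u * ennreal (exponential_density v u)) \<partial>lborel)"
    by (simp add: distrib_left nn_integral_cmult)
  also have "ennreal (lam * exp ((v - lam) * s)) * ennreal (exp (- v * s)) = ennreal (exponential_density lam s)"
    using lam s by (simp add: ennreal_mult'[symmetric] exponential_density_def mult.assoc exp_add[symmetric] algebra_simps)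
  also have "(\<integral>\<^sup>+u. ennreal (lam * exp ((v - lam) * s)) * (indicator {0<..<s} u * ennreal (exponential_density v u)) \<partial>lborel)
     = (\<integral>\<^sup>+u. ennreal v * (indicator {0<..<s} u * ennreal (exponential_density lam u * exp ((v - lam) * (s - u)))) \<partial>lborel)"
  proof (intro nn_integral_cong)
    fix u :: real
    show "ennreal (lam * exp ((v - lam) * s)) * (indicator {0<..<s} u * ennreal (exponential_density v u)) = ennreal v * (indicator {0<..<s} u * ennreal (exponential_density lam u * exp ((v - lam) * (s - u))))"
    proof (cases "u \<in> {0<..<s}")
      case True
      have "exp ((v - lam) * s) * exp (- u * v) = exp (- u * lam) * exp ((v - lam) * (s - u))"
        by (simp add: exp_add[symmetric] algebra_simps)
      then have "lam * exp ((v - lam) * s) * (v * exp (- u * v)) = v * (lam * exp (- u * lam) * exp ((v - lam) * (s - u)))"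
        by (simp add: mult_ac)
      then show ?thesis using True lam v by (simp add: ennreal_mult'[symmetric] exponential_density_def)
    qed simp
  qed
  also have "\<dots> = ennreal v * (\<integral>\<^sup>+u. indicator {0<..<s} u * ennreal (exponential_density lam u * exp ((v - lam) * (s - u))) \<partial>lborel)"
    by (rule nn_integral_cmult) measurable
  finally show ?thesis by (simp only: mult_1_right ind)
qed

text \<open>The initial bound \<open>K\<close> may be arbitrarily bad: iteration forgets it
  geometrically and converges to the fixed point of the affine map.\<close>

lemma affine_iteration_bound:
  fixes P :: "real \<Rightarrow> bool"
  assumes t: "0 \<le> t" "t < 1" and K: "P K" and step: "\<And>K. P K \<Longrightarrow> P (A + t * K)"
  obtains S where "\<And>n. P (S n)" "S \<longlonglongrightarrow> A / (1 - t)"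
proof -
  define S where "S n = ((\<lambda>K. A + t * K) ^^ n) K" for n
  have 1: "P (S n)" for n by (induction n) (auto simp: S_def K step)
  have A: "A = A / (1 - t) - t * (A / (1 - t))"
  proof -
    have "A = (1 - t) * (A / (1 - t))" using t by simp
    then show ?thesis by (simp only: left_diff_distrib mult_1)
  qed
  have eq: "S n = A / (1 - t) + t ^ n * (K - A / (1 - t))" for n
  proof (induction n)
    case (Suc n)
    have "S (Suc n) = A + t * S n" by (simp add: S_def)
    also have "\<dots> = (A / (1 - t) - t * (A / (1 - t))) + t * (A / (1 - t) + t ^ n * (K - A / (1 - t)))"
      unfolding Suc.IH using A by simp
    also have "\<dots> = A / (1 - t) + t ^ Suc n * (K - A / (1 - t))" by (simp add: right_diff_distrib distrib_left mult.assoc)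
    finally show ?case .
  qed (simp add: S_def)
  have "(\<lambda>n. A / (1 - t) + t ^ n * (K - A / (1 - t))) \<longlonglongrightarrow> A / (1 - t) + 0 * (K - A / (1 - t))"
    using t by (intro tendsto_intros LIMSEQ_realpow_zero)
  then have "S \<longlonglongrightarrow> A / (1 - t)" by (simp add: eq[abs_def])
  with 1 show ?thesis by (rule that)
qed

section \<open>Contraction of the killed potential and bounds for truncated exponential
  moments\<close>

context relativistic_ground_state
begin

text \<open>A path outside the closed ball at time \<open>t0\<close> adds nothing to the killed
  potential from then on, whereas the full one still earns \<open>lam * \<phi>\<close> at the
  position reached, discounted by \<open>exp (- lam * t0)\<close>. With probability at least
  \<open>p\<close> this position lies in the shell up to radius \<open>R\<close>, where
  \<open>\<phi> \<ge> bR\<close>; this is the loss caused by killing.\<close>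

lemma killed_potential_le:
  fixes t0 R p bR :: real
  assumes t0: "0 < t0" and x: "norm x \<le> a" and p: "0 \<le> p"
    and leave: "ennreal p \<le> emeasure M {\<omega>\<in>space M. a < norm (x + Y t0 \<omega>) \<and> norm (x + Y t0 \<omega>) \<le> R}"
    and bR: "0 < bR" "\<And>y. norm y \<le> R \<Longrightarrow> bR \<le> \<phi> y"
  shows "ennreal v * (\<integral>\<^sup>+s. ennreal (exponential_density lam s) * (\<integral>\<^sup>+\<omega>. alive (cball 0 a) x s \<omega> * ennreal (\<phi> (x + Y s \<omega>)) \<partial>M) \<partial>lborel)
    + ennreal (lam * (exp (- lam * t0) * bR * p)) \<le> ennreal (lam * \<phi> x)"
proof -
  let ?D = "cball 0 a :: (real ^ 'n) set"
  define f where "f y = indicator ?D y * ennreal (\<phi> y)" for y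
  have [measurable]: "f \<in> borel_measurable borel" unfolding f_def[abs_def] by measurable
  define w :: "real ^ 'n \<Rightarrow> ennreal" where "w = indicator (- ?D)"
  have [measurable]: "w \<in> borel_measurable borel" unfolding w_def by measurable
  have AE: "AE s in lborel. s \<noteq> (0::real)" by (rule AE_lborel_singleton)
  let ?e = "\<lambda>s. ennreal (exponential_density lam s)"
  let ?A = "\<lambda>s. \<integral>\<^sup>+\<omega>. alive ?D x s \<omega> * ennreal (\<phi> (x + Y s \<omega>)) \<partial>M"
  let ?B = "\<lambda>s. \<integral>\<^sup>+\<omega>. w (x + Y t0 \<omega>) * f (x + Y s \<omega>) \<partial>M"
  \<comment> \<open>For \<open>s \<ge> t0\<close> the two summands live on disjoint sets of paths:
    being alive at \<open>s\<close> excludes being outside at \<open>t0\<close>.\<close>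
  have pt: "alive ?D x s \<omega> * ennreal (\<phi> (x + Y s \<omega>)) + indicator {t0..} s * (w (x + Y t0 \<omega>) * f (x + Y s \<omega>)) \<le> f (x + Y s \<omega>)" if "0 < s" for s \<omega>
  proof (cases "\<forall>u. 0 < u \<and> u \<le> s \<longrightarrow> x + Y u \<omega> \<in> ?D")
    case True
    then have 1: "alive ?D x s \<omega> = 1" unfolding alive_def by (rule if_P)
    have 2: "x + Y s \<omega> \<in> ?D" using True that by blast
    have 3: "indicator {t0..} s * w (x + Y t0 \<omega>) = 0"
      using True t0 by (auto simp: w_def indicator_def)
    show ?thesis using 1 2 3 by (simp add: f_def mult.assoc[symmetric])
  next
    case False
    then have "alive ?D x s \<omega> = 0" unfolding alive_def by (rule if_not_P)
    then show ?thesis by (auto simp: indicator_def w_def)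
  qed
  have "(\<integral>\<^sup>+s. ?e s * ?A s \<partial>lborel) + (\<integral>\<^sup>+s. indicator {t0..} s * ?e s * ?B s \<partial>lborel) = (\<integral>\<^sup>+s. ?e s * ?A s + indicator {t0..} s * ?e s * ?B s \<partial>lborel)"
    by (rule nn_integral_add[symmetric]) measurable
  also have "\<dots> \<le> potential lam f x"
    unfolding potential_def
  proof (rule nn_integral_mono_AE)
    show "AE s in lborel. ?e s * ?A s + indicator {t0..} s * ?e s * ?B s \<le> ?e s * semigroup s f x"
      using AE
    proof eventually_elim
      fix s :: real assume "s \<noteq> 0"
      show "?e s * ?A s + indicator {t0..} s * ?e s * ?B s \<le> ?e s * semigroup s f x"
      proof (cases "0 < s")
        case True
        have "?A s + indicator {t0..} s * ?B s = (\<integral>\<^sup>+\<omega>. alive ?D x s \<omega> * ennreal (\<phi> (x + Y s \<omega>)) + indicator {t0..} s * (w (x + Y t0 \<omega>) * f (x + Y s \<omega>)) \<partial>M)"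
          by (subst nn_integral_add) (auto simp: nn_integral_cmult)
        also have "\<dots> \<le> semigroup s f x"
          unfolding semigroup_def by (intro nn_integral_mono pt True)
        finally have "?e s * (?A s + indicator {t0..} s * ?B s) \<le> ?e s * semigroup s f x"
          by (rule mult_left_mono) simp
        then show ?thesis by (simp only: distrib_left mult_ac)
      qed (use \<open>s \<noteq> 0\<close> in \<open>simp add: exponential_density_def\<close>)
    qed
  qed
  also have "(\<integral>\<^sup>+s. indicator {t0..} s * ?e s * ?B s \<partial>lborel) = ennreal (exp (- lam * t0)) * (\<integral>\<^sup>+\<omega>. w (x + Y t0 \<omega>) * potential lam f (x + Y t0 \<omega>) \<partial>M)"
    by (rule potential_shift[symmetric]) (use lam t0 in auto)
  finally have "ennreal v * ((\<integral>\<^sup>+s. ?e s * ?A s \<partial>lborel) + ennreal (exp (- lam * t0)) * (\<integral>\<^sup>+\<omega>. w (x + Y t0 \<omega>) * potential lam f (x + Y t0 \<omega>) \<partial>M)) \<le> ennreal v * potential lam f x"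
    by (rule mult_left_mono) simp
  also have "ennreal v * potential lam f x = ennreal (lam * \<phi> x)"
    unfolding f_def[abs_def] by (rule \<phi>_eq_potential_cball[symmetric])
  finally have main: "ennreal v * (\<integral>\<^sup>+s. ?e s * ?A s \<partial>lborel) + ennreal (exp (- lam * t0)) * (\<integral>\<^sup>+\<omega>. w (x + Y t0 \<omega>) * (ennreal v * potential lam f (x + Y t0 \<omega>)) \<partial>M) \<le> ennreal (lam * \<phi> x)"
    by (simp add: distrib_left mult.left_commute nn_integral_cmult)
  have "ennreal (lam * (exp (- lam * t0) * bR * p)) = ennreal (exp (- lam * t0)) * (ennreal (lam * bR) * ennreal p)"
    using lam bR p by (simp add: ennreal_mult[symmetric] mult_ac)
  also have "\<dots> \<le> ennreal (exp (- lam * t0)) * (ennreal (lam * bR) * emeasure M {\<omega>\<in>space M. a < norm (x + Y t0 \<omega>) \<and> norm (x + Y t0 \<omega>) \<le> R})"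
    by (intro mult_left_mono leave) auto
  also have "ennreal (lam * bR) * emeasure M {\<omega>\<in>space M. a < norm (x + Y t0 \<omega>) \<and> norm (x + Y t0 \<omega>) \<le> R} =
      (\<integral>\<^sup>+\<omega>. ennreal (lam * bR) * indicator {\<omega>\<in>space M. a < norm (x + Y t0 \<omega>) \<and> norm (x + Y t0 \<omega>) \<le> R} \<omega> \<partial>M)"
    by (rule nn_integral_cmult_indicator[symmetric]) measurable
  also have "\<dots> \<le> (\<integral>\<^sup>+\<omega>. w (x + Y t0 \<omega>) * (ennreal v * potential lam f (x + Y t0 \<omega>)) \<partial>M)"
  proof (intro nn_integral_mono)
    fix \<omega>
    have "ennreal v * potential lam f (x + Y t0 \<omega>) = ennreal (lam * \<phi> (x + Y t0 \<omega>))"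
      unfolding f_def[abs_def] by (rule \<phi>_eq_potential_cball[symmetric])
    then show "ennreal (lam * bR) * indicator {\<omega>\<in>space M. a < norm (x + Y t0 \<omega>) \<and> norm (x + Y t0 \<omega>) \<le> R} \<omega> \<le> w (x + Y t0 \<omega>) * (ennreal v * potential lam f (x + Y t0 \<omega>))"
      using bR(2)[of "x + Y t0 \<omega>"] lam by (auto simp: indicator_def w_def intro!: ennreal_leI)
  qed
  finally have "ennreal (lam * (exp (- lam * t0) * bR * p)) \<le> ennreal (exp (- lam * t0)) * (\<integral>\<^sup>+\<omega>. w (x + Y t0 \<omega>) * (ennreal v * potential lam f (x + Y t0 \<omega>)) \<partial>M)"
    by (simp add: mult_left_mono)
  with main show ?thesis by (meson add_left_mono order_trans)
qed

text \<open>Cutting at \<open>N\<close> makes the integral finite a priori, which gives the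
  iteration a starting point. Its limit for large \<open>N\<close> controls the exit moment through
  \<open>exp_exit_time_le\<close>.\<close>

definition exp_survival :: "real \<Rightarrow> real ^ 'n \<Rightarrow> ennreal" where
  "exp_survival N x = (\<integral>\<^sup>+s. indicator {0<..N} s * ennreal (exp ((v - lam) * s)) * survival (cball 0 a) s x \<partial>lborel)"

lemma exp_survival_measurable[measurable]: "exp_survival N \<in> borel_measurable borel"
  unfolding exp_survival_def[abs_def] by measurable

lemma exp_survival_finite: "0 \<le> N \<Longrightarrow> exp_survival N x \<le> ennreal (exp ((v - lam) * N) * N)"
proof -
  assume N: "0 \<le> N"
  have "exp_survival N x \<le> (\<integral>\<^sup>+s. ennreal (exp ((v - lam) * N)) * indicator {0<..N} s \<partial>lborel)"
    unfolding exp_survival_def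
  proof (intro nn_integral_mono)
    fix s
    show "indicator {0<..N} s * ennreal (exp ((v - lam) * s)) * survival (cball 0 a) s x \<le> ennreal (exp ((v - lam) * N)) * indicator {0<..N} s"
    proof (cases "s \<in> {0<..N}")
      case True
      have "ennreal (exp ((v - lam) * s)) * survival (cball 0 a) s x \<le> ennreal (exp ((v - lam) * N)) * 1"
        using True lam by (intro mult_mono survival_le_1 ennreal_leI) auto
      then show ?thesis using True by simp
    qed simp
  qed
  also have "\<dots> = ennreal (exp ((v - lam) * N) * N)"
    using N by (simp add: nn_integral_cmult_indicator ennreal_mult')
  finally show ?thesis .
qed

text \<open>\<open>exp_le_exponential_renewal\<close> splits each time \<open>s\<close> at an
  intermediate \<open>u\<close>; after exchanging the integrals, \<open>survival_markov\<close>
  restarts the process at \<open>u\<close>. The remaining time is at most \<open>N - u\<close>, and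
  enlarging this window to \<open>N\<close> makes the same function reappear on the right.\<close>

lemma exp_survival_renewal:
  "ennreal lam * exp_survival N x \<le> 1 + ennreal v * (\<integral>\<^sup>+u. ennreal (exponential_density lam u) * (\<integral>\<^sup>+\<omega>. alive (cball 0 a) x u \<omega> * exp_survival N (x + Y u \<omega>) \<partial>M) \<partial>lborel)"
proof -
  interpret pair_sigma_finite lborel M ..
  let ?D = "cball 0 a :: (real ^ 'n) set"
  let ?e = "\<lambda>s. ennreal (exponential_density lam s)"
  let ?p = "\<lambda>s. survival ?D s x"
  let ?c = "v - lam"
  let ?J = "\<lambda>s u. indicator {0<..N} s * ((if 0 < u \<and> u < s then 1 else 0) * ennreal (exponential_density lam u * exp (?c * (s - u)))) * ?p s"
  have "ennreal lam * exp_survival N x = (\<integral>\<^sup>+s. indicator {0<..N} s * ennreal (lam * exp (?c * s)) * ?p s \<partial>lborel)"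
    unfolding exp_survival_def using lam by (subst nn_integral_cmult[symmetric]) (auto simp: ennreal_mult' mult_ac)
  also have "\<dots> \<le> (\<integral>\<^sup>+s. ?e s + ennreal v * (\<integral>\<^sup>+u. ?J s u \<partial>lborel) \<partial>lborel)"
  proof (intro nn_integral_mono)
    fix s :: real
    show "indicator {0<..N} s * ennreal (lam * exp (?c * s)) * ?p s \<le> ?e s + ennreal v * (\<integral>\<^sup>+u. ?J s u \<partial>lborel)"
    proof (cases "s \<in> {0<..N}")
      case True
      then have s: "0 < s" by simp
      let ?I = "\<integral>\<^sup>+u. (if 0 < u \<and> u < s then 1 else 0) * ennreal (exponential_density lam u * exp (?c * (s - u))) \<partial>lborel"
      have "ennreal (lam * exp (?c * s)) * ?p s \<le> (?e s + ennreal v * ?I) * ?p s"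
        by (intro mult_right_mono exp_le_exponential_renewal lam v s) auto
      also have "\<dots> \<le> ?e s * 1 + ennreal v * (?I * ?p s)"
        unfolding distrib_right mult.assoc by (intro add_mono mult_left_mono survival_le_1) auto
      also have "?I * ?p s = (\<integral>\<^sup>+u. ?J s u \<partial>lborel)"
        using True by (subst nn_integral_multc[symmetric]) auto
      finally show ?thesis using True by simp
    qed simp
  qed
  also have "\<dots> = 1 + ennreal v * (\<integral>\<^sup>+s. \<integral>\<^sup>+u. ?J s u \<partial>lborel \<partial>lborel)"
    using lam by (subst nn_integral_add) (auto simp: nn_integral_cmult nn_integral_exponential_density)
  also have "(\<integral>\<^sup>+s. \<integral>\<^sup>+u. ?J s u \<partial>lborel \<partial>lborel) = (\<integral>\<^sup>+u. \<integral>\<^sup>+s. ?J s u \<partial>lborel \<partial>lborel)"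
    by (rule lborel_pair.Fubini') measurable
  also have "\<dots> \<le> (\<integral>\<^sup>+u. ?e u * (\<integral>\<^sup>+\<omega>. alive ?D x u \<omega> * exp_survival N (x + Y u \<omega>) \<partial>M) \<partial>lborel)"
  proof (intro nn_integral_mono)
    fix u :: real
    show "(\<integral>\<^sup>+s. ?J s u \<partial>lborel) \<le> ?e u * (\<integral>\<^sup>+\<omega>. alive ?D x u \<omega> * exp_survival N (x + Y u \<omega>) \<partial>M)"
    proof (cases "0 < u")
      case True
      have "(\<integral>\<^sup>+s. ?J s u \<partial>lborel) = (\<integral>\<^sup>+r. ?J (u + r) u \<partial>lborel)"
        by (rule nn_integral_shift) measurable
      also have "\<dots> \<le> (\<integral>\<^sup>+r. ?e u * (indicator {0<..N} r * ennreal (exp (?c * r)) * (\<integral>\<^sup>+\<omega>. alive ?D x u \<omega> * survival ?D r (x + Y u \<omega>) \<partial>M)) \<partial>lborel)"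
      proof (intro nn_integral_mono)
        fix r :: real
        show "?J (u + r) u \<le> ?e u * (indicator {0<..N} r * ennreal (exp (?c * r)) * (\<integral>\<^sup>+\<omega>. alive ?D x u \<omega> * survival ?D r (x + Y u \<omega>) \<partial>M))"
        proof (cases "0 < r \<and> u + r \<le> N")
          case r: True
          have "?J (u + r) u = ?e u * ennreal (exp (?c * r)) * survival ?D (u + r) x"
            using r True by (simp add: ennreal_mult'')
          also have "\<dots> \<le> ?e u * ennreal (exp (?c * r)) * (\<integral>\<^sup>+\<omega>. alive ?D x u \<omega> * survival ?D r (x + Y u \<omega>) \<partial>M)"
            using r True by (intro mult_left_mono survival_markov) auto
          also have "\<dots> = ?e u * (indicator {0<..N} r * ennreal (exp (?c * r)) * (\<integral>\<^sup>+\<omega>. alive ?D x u \<omega> * survival ?D r (x + Y u \<omega>) \<partial>M))"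
            using r True by (simp add: mult.assoc)
          finally show ?thesis .
        next
          case False
          then have J0: "?J (u + r) u = 0" by (auto simp: indicator_def)
          show ?thesis by (rule order_trans[OF eq_refl[OF J0] zero_le])
        qed
      qed
      also have "\<dots> = ?e u * (\<integral>\<^sup>+r. \<integral>\<^sup>+\<omega>. alive ?D x u \<omega> * (indicator {0<..N} r * ennreal (exp (?c * r)) * survival ?D r (x + Y u \<omega>)) \<partial>M \<partial>lborel)"
        by (subst nn_integral_cmult) (auto simp: nn_integral_cmult[symmetric] mult_ac)
      also have "(\<integral>\<^sup>+r. \<integral>\<^sup>+\<omega>. alive ?D x u \<omega> * (indicator {0<..N} r * ennreal (exp (?c * r)) * survival ?D r (x + Y u \<omega>)) \<partial>M \<partial>lborel)
        = (\<integral>\<^sup>+\<omega>. \<integral>\<^sup>+r. alive ?D x u \<omega> * (indicator {0<..N} r * ennreal (exp (?c * r)) * survival ?D r (x + Y u \<omega>)) \<partial>lborel \<partial>M)"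
        by (rule Fubini'[symmetric]) measurable
      also have "\<dots> = (\<integral>\<^sup>+\<omega>. alive ?D x u \<omega> * exp_survival N (x + Y u \<omega>) \<partial>M)"
        unfolding exp_survival_def by (intro nn_integral_cong nn_integral_cmult) measurable
      finally show ?thesis .
    next
      case False
      have "(\<integral>\<^sup>+s. ?J s u \<partial>lborel) = (\<integral>\<^sup>+(s::real). 0 \<partial>lborel)"
        by (rule nn_integral_cong) (use False in auto)
      also have "\<dots> = 0" by simp
      finally have J0: "(\<integral>\<^sup>+s. ?J s u \<partial>lborel) = 0" .
      show ?thesis by (rule order_trans[OF eq_refl[OF J0] zero_le])
    qed
  qed
  finally show ?thesis by (simp add: mult_left_mono)
qed

end

context relativistic_ground_state
begin

text \<open>Constants \<open>K\<close> with \<open>exp_survival N \<le> K * \<phi>\<close> on the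
  ball are improved step by step: the renewal inequality turns an admissible \<open>K\<close> into
  \<open>A + \<theta> * K\<close>, with \<open>\<theta> < 1\<close> thanks to
  \<open>killed_potential_le\<close>. Hence the fixed point \<open>A / (1 - \<theta>)\<close>, which
  does not involve \<open>N\<close>, is admissible too.\<close>

lemma exp_survival_bounded:
  fixes t0 R p bR b1 b2 :: real
  assumes t0: "0 < t0" and p: "0 < p"
    and leave: "\<And>x. norm x \<le> a \<Longrightarrow> ennreal p \<le> emeasure M {\<omega>\<in>space M. a < norm (x + Y t0 \<omega>) \<and> norm (x + Y t0 \<omega>) \<le> R}"
    and bR: "0 < bR" "\<And>y. norm y \<le> R \<Longrightarrow> bR \<le> \<phi> y"
    and b: "0 < b1" "\<And>y. norm y \<le> a \<Longrightarrow> b1 \<le> \<phi> y" "\<And>y. norm y \<le> a \<Longrightarrow> \<phi> y \<le> b2"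
    and N: "0 \<le> N" and x: "norm x \<le> a"
  defines "\<delta> \<equiv> exp (- lam * t0) * bR * p"
  shows "exp_survival N x \<le> ennreal (b2 / (lam * b1) * (b2 / \<delta>))"
proof -
  let ?D = "cball 0 a :: (real ^ 'n) set"
  have d: "0 < \<delta>" using p bR by (simp add: \<delta>_def)
  define KP where "KP y = ennreal v * (\<integral>\<^sup>+s. ennreal (exponential_density lam s) * (\<integral>\<^sup>+\<omega>. alive ?D y s \<omega> * ennreal (\<phi> (y + Y s \<omega>)) \<partial>M) \<partial>lborel)" for y
  have kp: "KP y + ennreal (lam * \<delta>) \<le> ennreal (lam * \<phi> y)" if "norm y \<le> a" for y
    unfolding KP_def \<delta>_def
    by (rule killed_potential_le[OF t0 that less_imp_le[OF p] leave[OF that] bR])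
  \<comment> \<open>Discarding the killed potential shows that the loss \<open>\<delta>\<close>
    cannot exceed \<open>\<phi>\<close>, hence not \<open>b2\<close>; this yields
    \<open>0 \<le> \<theta>\<close>.\<close>
  have d\<phi>: "\<delta> \<le> \<phi> y" if "norm y \<le> a" for y
  proof -
    have "ennreal (lam * \<delta>) \<le> ennreal (lam * \<phi> y)" using kp[OF that] by (rule order_trans[rotated]) simp
    then have "lam * \<delta> \<le> lam * \<phi> y" using lam by (subst (asm) ennreal_le_iff) auto
    then show ?thesis using lam by simp
  qed
  have b2: "0 < b2" using b(2,3)[of 0] b(1) a by simp
  have d2: "\<delta> \<le> b2" using d\<phi>[of 0] b(3)[of 0] a by simp
  \<comment> \<open>Makes the subtractive loss multiplicative: since \<open>\<phi> \<le> b2\<close>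
    on the ball, \<open>\<phi> - \<delta>\<close> is at most
    \<open>\<theta> * \<phi>\<close>.\<close>
  define \<theta> where "\<theta> = 1 - \<delta> / b2"
  have \<theta>: "0 \<le> \<theta>" "\<theta> < 1" using d d2 b2 by (auto simp: \<theta>_def)
  have KPle: "KP y \<le> ennreal (lam * \<theta> * \<phi> y)" if y: "norm y \<le> a" for y
  proof -
    have "KP y \<le> ennreal (lam * \<phi> y) - ennreal (lam * \<delta>)"
      using kp[OF y] by (subst ennreal_le_minus_iff) (auto simp: add.commute)
    also have "\<dots> = ennreal (lam * \<phi> y - lam * \<delta>)"
      using d lam by (intro ennreal_minus) simp
    also have "\<dots> \<le> ennreal (lam * \<theta> * \<phi> y)"
    proof (rule ennreal_leI)
      have "\<phi> y / b2 \<le> 1" using b(3)[OF y] b2 by simp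
      then have "\<delta> * (\<phi> y / b2) \<le> \<delta> * 1" using d by (intro mult_left_mono) auto
      then have "\<phi> y - \<delta> \<le> \<theta> * \<phi> y" by (simp add: \<theta>_def left_diff_distrib)
      then have "lam * (\<phi> y - \<delta>) \<le> lam * (\<theta> * \<phi> y)" using lam by (intro mult_left_mono) auto
      then show "lam * \<phi> y - lam * \<delta> \<le> lam * \<theta> * \<phi> y" by (simp add: right_diff_distrib mult.assoc)
    qed
    finally show ?thesis .
  qed
  \<comment> \<open>Absorbs the constant 1 of the renewal inequality:
    \<open>1 / lam \<le> A * \<phi>\<close> on the ball, because \<open>\<phi> \<ge> b1\<close>
    there.\<close>
  define A where "A = 1 / (lam * b1)"
  have A: "0 < A" using lam b by (simp add: A_def)
  define Q where "Q K \<longleftrightarrow> 0 \<le> K \<and> (\<forall>y. norm y \<le> a \<longrightarrow> exp_survival N y \<le> ennreal (K * \<phi> y))" for K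
  \<comment> \<open>This initial constant grows with \<open>N\<close>; only its finiteness
    counts.\<close>
  have Q0: "Q (exp ((v - lam) * N) * N / b1)"
    unfolding Q_def
  proof (intro conjI allI impI)
    show "0 \<le> exp ((v - lam) * N) * N / b1" using N b by simp
    fix y :: "real ^ 'n" assume y: "norm y \<le> a"
    have "exp ((v - lam) * N) * N * 1 \<le> exp ((v - lam) * N) * N * (\<phi> y / b1)"
      using b(1) b(2)[OF y] N by (intro mult_left_mono) auto
    then have "exp ((v - lam) * N) * N \<le> exp ((v - lam) * N) * N / b1 * \<phi> y" by simp
    then show "exp_survival N y \<le> ennreal (exp ((v - lam) * N) * N / b1 * \<phi> y)"
      by (intro order_trans[OF exp_survival_finite[OF N]] ennreal_leI)
  qed
  have step: "Q (A + \<theta> * K)" if K: "Q K" for K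
    unfolding Q_def
  proof (intro conjI allI impI)
    have K0: "0 \<le> K" using K by (simp add: Q_def)
    show "0 \<le> A + \<theta> * K" using A \<theta> K0 by simp
    fix y :: "real ^ 'n" assume y: "norm y \<le> a"
    let ?R = "\<integral>\<^sup>+u. ennreal (exponential_density lam u) * (\<integral>\<^sup>+\<omega>. alive ?D y u \<omega> * exp_survival N (y + Y u \<omega>) \<partial>M) \<partial>lborel"
    have AE: "AE s in lborel. s \<noteq> (0::real)" by (rule AE_lborel_singleton)
    have "?R \<le> (\<integral>\<^sup>+u. ennreal K * (ennreal (exponential_density lam u) * (\<integral>\<^sup>+\<omega>. alive ?D y u \<omega> * ennreal (\<phi> (y + Y u \<omega>)) \<partial>M)) \<partial>lborel)"
    proof (rule nn_integral_mono_AE)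
      show "AE u in lborel. ennreal (exponential_density lam u) * (\<integral>\<^sup>+\<omega>. alive ?D y u \<omega> * exp_survival N (y + Y u \<omega>) \<partial>M) \<le> ennreal K * (ennreal (exponential_density lam u) * (\<integral>\<^sup>+\<omega>. alive ?D y u \<omega> * ennreal (\<phi> (y + Y u \<omega>)) \<partial>M))"
        using AE
      proof eventually_elim
        fix u :: real assume "u \<noteq> 0"
        show "ennreal (exponential_density lam u) * (\<integral>\<^sup>+\<omega>. alive ?D y u \<omega> * exp_survival N (y + Y u \<omega>) \<partial>M) \<le> ennreal K * (ennreal (exponential_density lam u) * (\<integral>\<^sup>+\<omega>. alive ?D y u \<omega> * ennreal (\<phi> (y + Y u \<omega>)) \<partial>M))"
        proof (cases "0 < u")
          case True
          have "(\<integral>\<^sup>+\<omega>. alive ?D y u \<omega> * exp_survival N (y + Y u \<omega>) \<partial>M) \<le> (\<integral>\<^sup>+\<omega>. ennreal K * (alive ?D y u \<omega> * ennreal (\<phi> (y + Y u \<omega>))) \<partial>M)"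
          proof (intro nn_integral_mono)
            fix \<omega>
            show "alive ?D y u \<omega> * exp_survival N (y + Y u \<omega>) \<le> ennreal K * (alive ?D y u \<omega> * ennreal (\<phi> (y + Y u \<omega>)))"
            proof (cases "\<forall>r. 0 < r \<and> r \<le> u \<longrightarrow> y + Y r \<omega> \<in> ?D")
              case al: True
              then have "norm (y + Y u \<omega>) \<le> a" using True by auto
              then have "exp_survival N (y + Y u \<omega>) \<le> ennreal (K * \<phi> (y + Y u \<omega>))" using K by (simp add: Q_def)
              moreover have "alive ?D y u \<omega> = 1" unfolding alive_def by (rule if_P[OF al])
              ultimately show ?thesis using K0 by (simp add: ennreal_mult)
            next
              case False
              have "alive ?D y u \<omega> = 0" unfolding alive_def by (rule if_not_P[OF False])
              then show ?thesis by simp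
            qed
          qed
          also have "\<dots> = ennreal K * (\<integral>\<^sup>+\<omega>. alive ?D y u \<omega> * ennreal (\<phi> (y + Y u \<omega>)) \<partial>M)"
            by (rule nn_integral_cmult) measurable
          finally show ?thesis by (subst mult.left_commute) (rule mult_left_mono, auto)
        qed (use \<open>u \<noteq> 0\<close> in \<open>simp add: exponential_density_def\<close>)
      qed
    qed
    also have "\<dots> = ennreal K * (\<integral>\<^sup>+s. ennreal (exponential_density lam s) * (\<integral>\<^sup>+\<omega>. alive ?D y s \<omega> * ennreal (\<phi> (y + Y s \<omega>)) \<partial>M) \<partial>lborel)"
      by (rule nn_integral_cmult) measurable
    finally have "ennreal v * ?R \<le> ennreal K * KP y"
      unfolding KP_def by (subst mult.left_commute) (rule mult_left_mono, auto)
    also have "\<dots> \<le> ennreal K * ennreal (lam * \<theta> * \<phi> y)" by (intro mult_left_mono KPle[OF y]) simp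
    finally have vR: "ennreal v * ?R \<le> ennreal (K * (lam * \<theta> * \<phi> y))" using K0 by (simp add: ennreal_mult')
    have "ennreal lam * exp_survival N y \<le> 1 + ennreal v * ?R" by (rule exp_survival_renewal)
    also have "\<dots> \<le> 1 + ennreal (K * (lam * \<theta> * \<phi> y))" by (rule add_left_mono[OF vR])
    also have "\<dots> = ennreal (1 + K * (lam * \<theta> * \<phi> y))"
      using K0 lam \<theta> by (subst ennreal_plus) (auto intro!: mult_nonneg_nonneg)
    finally have "ennreal (1 / lam) * (ennreal lam * exp_survival N y) \<le> ennreal (1 / lam) * ennreal (1 + K * (lam * \<theta> * \<phi> y))"
      by (rule mult_left_mono) simp
    moreover have "ennreal (1 / lam) * ennreal lam = 1" using lam by (subst ennreal_mult[symmetric]) auto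
    ultimately have "exp_survival N y \<le> ennreal (1 / lam) * ennreal (1 + K * (lam * \<theta> * \<phi> y))"
      by (simp only: mult.assoc[symmetric] mult_1)
    also have "\<dots> = ennreal (1 / lam * (1 + K * (lam * \<theta> * \<phi> y)))"
      using lam by (subst ennreal_mult') auto
    also have "\<dots> \<le> ennreal ((A + \<theta> * K) * \<phi> y)"
    proof (rule ennreal_leI)
      have "1 / lam * 1 \<le> 1 / lam * (\<phi> y / b1)" using b(1) b(2)[OF y] lam by (intro mult_left_mono) auto
      moreover have "1 / lam * (K * (lam * \<theta> * \<phi> y)) = \<theta> * K * \<phi> y" using lam by simp
      ultimately show "1 / lam * (1 + K * (lam * \<theta> * \<phi> y)) \<le> (A + \<theta> * K) * \<phi> y"
        by (simp only: distrib_left distrib_right A_def) (simp add: field_simps)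
    qed
    finally show "exp_survival N y \<le> ennreal ((A + \<theta> * K) * \<phi> y)" .
  qed
  obtain S where S: "\<And>n. Q (S n)" "S \<longlonglongrightarrow> A / (1 - \<theta>)"
    using affine_iteration_bound[of \<theta> Q, OF \<theta> Q0 step] by blast
  have "(\<lambda>n. ennreal (S n * \<phi> x)) \<longlonglongrightarrow> ennreal (A / (1 - \<theta>) * \<phi> x)"
    by (intro tendsto_intros S)
  then have "exp_survival N x \<le> ennreal (A / (1 - \<theta>) * \<phi> x)"
    by (rule tendsto_lowerbound) (use S(1) x in \<open>auto simp: Q_def intro!: always_eventually\<close>)
  also have "\<dots> \<le> ennreal (b2 / (lam * b1) * (b2 / \<delta>))"
  proof (rule ennreal_leI)
    have "A / (1 - \<theta>) * \<phi> x \<le> A / (1 - \<theta>) * b2" using A \<theta> b(3)[OF x] by (intro mult_left_mono) auto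
    also have "\<dots> = b2 / (lam * b1) * (b2 / \<delta>)" by (simp add: A_def \<theta>_def)
    finally show "A / (1 - \<theta>) * \<phi> x \<le> b2 / (lam * b1) * (b2 / \<delta>)" .
  qed
  finally show ?thesis .
qed

section \<open>From truncated survival integrals to the exit moment\<close>

lemma nn_integral_exp_Ioo:
  assumes c: "0 < c" and r: "0 \<le> r"
  shows "(\<integral>\<^sup>+s. indicator {0<..<r} s * ennreal (exp (c * s)) \<partial>lborel) = ennreal ((exp (c * r) - 1) / c)"
proof -
  have "(\<integral>\<^sup>+s. indicator {0<..<r} s * ennreal (exp (c * s)) \<partial>lborel) = (\<integral>\<^sup>+s. ennreal (exp (c * s)) * indicator {0..r} s \<partial>lborel)"
  proof (rule nn_integral_cong_AE)
    show "AE s in lborel. indicator {0<..<r} s * ennreal (exp (c * s)) = ennreal (exp (c * s)) * indicator {0..r} s"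
      using AE_lborel_singleton[of 0] AE_lborel_singleton[of r] by eventually_elim (auto simp: indicator_def)
  qed
  also have "\<dots> = ennreal (exp (c * r) / c - exp (c * 0) / c)"
    using c r by (intro nn_integral_FTC_Icc) (auto intro!: derivative_eq_intros)
  finally show ?thesis by (simp add: diff_divide_distrib)
qed

text \<open>For a finite exit time \<open>T\<close>, \<open>exp (c * T)\<close> is 1 plus
  \<open>c\<close> times the integral of \<open>exp (c * s)\<close> up to \<open>T\<close>, and
  strictly before leaving the open ball the path is alive in the closed one. For infinite
  \<open>T\<close> the integral on the right diverges.\<close>

lemma exp_exit_time_le:
  assumes c: "0 < c"
  shows "exp_ereal (ereal c * exit_time a (shifted x Y) \<omega>) \<le> 1 + ennreal c * (\<integral>\<^sup>+s. indicator {0<..} s * ennreal (exp (c * s)) * alive (cball 0 a) x s \<omega> \<partial>lborel)"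
proof -
  define T where "T = exit_time a (shifted x Y) \<omega>"
  let ?I = "\<integral>\<^sup>+s. indicator {0<..} s * ennreal (exp (c * s)) * alive (cball 0 a) x s \<omega> \<partial>lborel"
  have T0: "0 \<le> T" unfolding T_def by (rule exit_time_nonneg)
  have al: "alive (cball 0 a) x s \<omega> = 1" if "ereal s < T" for s
  proof -
    have "x + Y u \<omega> \<in> cball 0 a" if u: "0 < u \<and> u \<le> s" for u
    proof (rule ccontr)
      assume "x + Y u \<omega> \<notin> cball 0 a"
      then have "T \<le> ereal u" unfolding T_def exit_time_def
        using u by (intro Inf_lower) (auto simp: shifted_def)
      then have "T \<le> ereal s" using u by (simp add: order_trans)
      then show False using \<open>ereal s < T\<close> by simp
    qed
    then show ?thesis by (simp add: alive_def)
  qed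
  have low: "ennreal ((exp (c * r) - 1) / c) \<le> ?I" if r: "0 \<le> r" "ereal r \<le> T" for r
  proof -
    have "ennreal ((exp (c * r) - 1) / c) = (\<integral>\<^sup>+s. indicator {0<..<r} s * ennreal (exp (c * s)) \<partial>lborel)"
      by (rule nn_integral_exp_Ioo[OF c r(1), symmetric])
    also have "\<dots> \<le> ?I"
    proof (intro nn_integral_mono)
      fix s
      show "indicator {0<..<r} s * ennreal (exp (c * s)) \<le> indicator {0<..} s * ennreal (exp (c * s)) * alive (cball 0 a) x s \<omega>"
      proof (cases "s \<in> {0<..<r}")
        case True
        then have "ereal s < T" using r(2) by (meson greaterThanLessThan_iff less_ereal.simps(1) order_less_le_trans)
        then show ?thesis using True al by simp
      qed simp
    qed
    finally show ?thesis .
  qed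
  show ?thesis
    unfolding T_def[symmetric]
  proof (cases T)
    case (real r)
    then have r: "0 \<le> r" "ereal r \<le> T" using T0 by auto
    have "exp_ereal (ereal c * T) = ennreal (1 + c * ((exp (c * r) - 1) / c))" using real c by simp
    also have "\<dots> = 1 + ennreal c * ennreal ((exp (c * r) - 1) / c)"
      using c r by (subst ennreal_plus) (auto simp: ennreal_mult[symmetric])
    also have "\<dots> \<le> 1 + ennreal c * ?I" by (intro add_left_mono mult_left_mono low r) simp
    finally show "exp_ereal (ereal c * T) \<le> 1 + ennreal c * ?I" .
  next
    case PInf
    have "ennreal (real n) \<le> ?I" for n
    proof -
      have "1 + c * real n \<le> exp (c * real n)" by (rule exp_ge_add_one_self)
      then have "real n \<le> (exp (c * real n) - 1) / c" using c by (simp add: field_simps)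
      then have "ennreal (real n) \<le> ennreal ((exp (c * real n) - 1) / c)" by (rule ennreal_leI)
      also have "\<dots> \<le> ?I" by (rule low) (use PInf in auto)
      finally show ?thesis .
    qed
    have "?I = top"
    proof (rule ccontr)
      assume "?I \<noteq> top"
      then obtain q where q: "0 \<le> q" "?I = ennreal q" by (cases ?I) auto
      obtain n where "q < real n" using reals_Archimedean2 by blast
      with \<open>ennreal (real n) \<le> ?I\<close> q show False by simp
    qed
    then have "ennreal c * ?I = top" using c by (simp add: ennreal_mult_top)
    then show "exp_ereal (ereal c * T) \<le> 1 + ennreal c * ?I" by simp
  next
    case MInf then show "exp_ereal (ereal c * T) \<le> 1 + ennreal c * ?I" using T0 by simp
  qed
qed

text \<open>Fatou removes the truncation at \<open>N\<close>, and exchanging expectation and time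
  integral in \<open>exp_exit_time_le\<close> produces \<open>survival\<close>.\<close>

lemma exit_moment_le:
  assumes "\<And>N. 0 \<le> N \<Longrightarrow> exp_survival N x \<le> ennreal K" and K: "0 \<le> K"
  shows "exit_moment M X a (v - lam) x \<le> ennreal (1 + (v - lam) * K)"
proof -
  interpret pair_sigma_finite lborel M ..
  have c: "0 < v - lam" using lam by simp
  have "(\<integral>\<^sup>+s. indicator {0<..} s * ennreal (exp ((v - lam) * s)) * survival (cball 0 a) s x \<partial>lborel) \<le> ennreal K"
  proof (rule nn_integral_le_of_tendsto)
    fix n :: nat
    show "(\<integral>\<^sup>+s. indicator {0<..real n} s * ennreal (exp ((v - lam) * s)) * survival (cball 0 a) s x \<partial>lborel) \<le> ennreal K"
      using assms(1)[of "real n"] by (simp add: exp_survival_def)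
    show "(\<lambda>s. indicator {0<..real n} s * ennreal (exp ((v - lam) * s)) * survival (cball 0 a) s x) \<in> borel_measurable lborel"
      by measurable
  next
    fix s :: real
    show "indicator {0<..} s * ennreal (exp ((v - lam) * s)) * survival (cball 0 a) s x \<le> liminf (\<lambda>n. indicator {0<..real n} s * ennreal (exp ((v - lam) * s)) * survival (cball 0 a) s x)"
    proof (rule Liminf_bounded)
      obtain N where "s \<le> real N" using real_arch_simple by blast
      then show "\<forall>\<^sub>F n in sequentially. indicator {0<..} s * ennreal (exp ((v - lam) * s)) * survival (cball 0 a) s x \<le> indicator {0<..real n} s * ennreal (exp ((v - lam) * s)) * survival (cball 0 a) s x"
        by (intro eventually_sequentiallyI[of N] mult_right_mono) (auto simp: indicator_def)
    qed
  qed
  then have I: "(\<integral>\<^sup>+s. indicator {0<..} s * ennreal (exp ((v - lam) * s)) * survival (cball 0 a) s x \<partial>lborel) \<le> ennreal K" .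
  have "exit_moment M X a (v - lam) x \<le> (\<integral>\<^sup>+\<omega>. 1 + ennreal (v - lam) * (\<integral>\<^sup>+s. indicator {0<..} s * ennreal (exp ((v - lam) * s)) * alive (cball 0 a) x s \<omega> \<partial>lborel) \<partial>M)"
    unfolding exit_moment_Y by (intro nn_integral_mono exp_exit_time_le c)
  also have "\<dots> = 1 + ennreal (v - lam) * (\<integral>\<^sup>+\<omega>. \<integral>\<^sup>+s. indicator {0<..} s * ennreal (exp ((v - lam) * s)) * alive (cball 0 a) x s \<omega> \<partial>lborel \<partial>M)"
    by (subst nn_integral_add) (auto simp: nn_integral_cmult emeasure_space_1)
  also have "(\<integral>\<^sup>+\<omega>. \<integral>\<^sup>+s. indicator {0<..} s * ennreal (exp ((v - lam) * s)) * alive (cball 0 a) x s \<omega> \<partial>lborel \<partial>M) =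
      (\<integral>\<^sup>+s. \<integral>\<^sup>+\<omega>. indicator {0<..} s * ennreal (exp ((v - lam) * s)) * alive (cball 0 a) x s \<omega> \<partial>M \<partial>lborel)"
    by (rule Fubini') measurable
  also have "\<dots> = (\<integral>\<^sup>+s. indicator {0<..} s * ennreal (exp ((v - lam) * s)) * survival (cball 0 a) s x \<partial>lborel)"
    unfolding survival_def by (intro nn_integral_cong nn_integral_cmult) measurable
  also have "1 + ennreal (v - lam) * \<dots> \<le> 1 + ennreal (v - lam) * ennreal K"
    by (intro add_left_mono mult_left_mono I) simp
  also have "\<dots> = ennreal (1 + (v - lam) * K)"
    using c K by (subst ennreal_plus) (auto simp: ennreal_mult')
  finally show ?thesis .
qed

lemma exit_moment_ge_1: "1 \<le> exit_moment M X a (v - lam) x"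
proof -
  have "(\<integral>\<^sup>+\<omega>. 1 \<partial>M) \<le> exit_moment M X a (v - lam) x"
    unfolding exit_moment_def
  proof (intro nn_integral_mono)
    fix \<omega>
    show "1 \<le> exp_ereal (ereal (v - lam) * exit_time a (shifted x X) \<omega>)"
      using exit_time_nonneg[of "shifted x X" \<omega>] lam
      by (cases "exit_time a (shifted x X) \<omega>") (auto simp: ennreal_1[symmetric] simp del: ennreal_1 intro!: ennreal_leI)
  qed
  then show ?thesis by (simp add: emeasure_space_1)
qed

end

section \<open>Full support and uniqueness of the ground state\<close>

text \<open>Diagonal map, used with entries 1 and -1. These reflections are the symmetries of the
  law on which the support argument relies; they act on each coordinate separately.\<close>

definition coord_signs :: "('a::euclidean_space \<Rightarrow> real) \<Rightarrow> 'a \<Rightarrow> 'a" where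
  "coord_signs c z = (\<Sum>j\<in>Basis. (c j * (z \<bullet> j)) *\<^sub>R j)"

lemma coord_signs_inner: "b \<in> Basis \<Longrightarrow> coord_signs c z \<bullet> b = c b * (z \<bullet> b)"
  by (simp add: coord_signs_def)

lemma
  assumes c: "\<And>j. \<bar>c j\<bar> = 1"
  shows norm_coord_signs: "norm (coord_signs c (z::'a::euclidean_space)) = norm z"
    and integral_coord_signs: "f \<in> borel_measurable borel \<Longrightarrow> (LINT w|lborel. f (coord_signs c w)) = (LINT w|lborel. (f (w::'a) :: complex))"
proof -
  have c2: "(c j)\<^sup>2 = 1" for j using c[of j] power2_abs[of "c j"] by simp
  have "(norm (coord_signs c z))\<^sup>2 = (norm z)\<^sup>2"
    unfolding norm_sq_eq_sum by (intro sum.cong) (auto simp: coord_signs_inner power_mult_distrib c2)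
  then show "norm (coord_signs c z) = norm z" by simp
  assume [measurable]: "f \<in> borel_measurable borel"
  have [measurable]: "coord_signs c \<in> borel_measurable (borel :: 'a measure)" unfolding coord_signs_def[abs_def] by measurable
  have "c j \<noteq> 0" for j using c[of j] by auto
  from lborel_affine_euclidean[of c 0, OF this]
  have "lborel = density (distr lborel borel (coord_signs c :: 'a \<Rightarrow> 'a)) (\<lambda>_. 1)"
    using c by (simp add: coord_signs_def[abs_def])
  then have l: "lborel = distr lborel borel (coord_signs c :: 'a \<Rightarrow> 'a)" by (simp add: density_1)
  show "(LINT w|lborel. f (coord_signs c w)) = (LINT w|lborel. f w)"
    by (subst (2) l) (simp add: integral_distr)
qed

text \<open>This is the expectation of
  \<open>exp (- (norm (z - X t \<omega>))\<^sup>2 / (2 * \<epsilon>))\<close> written through the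
  symbol alone, hence visibly the same for all processes with this generator. The power of
  \<open>sqrt (2 * pi * \<epsilon>)\<close> undoes the normalisation of \<open>gauss\<close>; the
  power of \<open>2 * pi\<close> comes from Fourier inversion.\<close>

definition gauss_transform :: "real \<Rightarrow> real \<Rightarrow> real \<Rightarrow> real \<Rightarrow> real ^ 'n::finite \<Rightarrow> real" where
  "gauss_transform m \<alpha> t \<epsilon> z = sqrt (2 * pi * \<epsilon>) ^ CARD('n) / (2 * pi) ^ CARD('n) *
     Re (LINT w|lborel. (of_real (exp (- \<epsilon> * (norm w)\<^sup>2 / 2)) * cis (w \<bullet> z)) * of_real (exp (- t * Phi m \<alpha> ((norm w)\<^sup>2))))"

lemma gauss_transform_coord_signs:
  assumes c: "\<And>j. \<bar>c j\<bar> = 1"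
  shows "gauss_transform m \<alpha> t \<epsilon> (coord_signs c z) = gauss_transform m \<alpha> t \<epsilon> z"
proof -
  have i: "w \<bullet> coord_signs c z = coord_signs c w \<bullet> z" for w
  proof -
    have "w \<bullet> coord_signs c z = (\<Sum>b\<in>Basis. (w \<bullet> b) * (coord_signs c z \<bullet> b))" by (rule euclidean_inner)
    also have "\<dots> = (\<Sum>b\<in>Basis. (coord_signs c w \<bullet> b) * (z \<bullet> b))"
      by (intro sum.cong) (auto simp: coord_signs_inner)
    also have "\<dots> = coord_signs c w \<bullet> z" by (rule euclidean_inner[symmetric])
    finally show ?thesis .
  qed
  let ?f = "\<lambda>w. (complex_of_real (exp (- \<epsilon> * (norm w)\<^sup>2 / 2)) * cis (w \<bullet> z)) * of_real (exp (- t * Phi m \<alpha> ((norm w)\<^sup>2)))"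
  have "(LINT w|lborel. (complex_of_real (exp (- \<epsilon> * (norm w)\<^sup>2 / 2)) * cis (w \<bullet> coord_signs c z)) * of_real (exp (- t * Phi m \<alpha> ((norm w)\<^sup>2)))) = (LINT w|lborel. ?f (coord_signs c w))"
    unfolding i by (simp add: norm_coord_signs[OF c])
  also have "\<dots> = (LINT w|lborel. ?f w)" by (rule integral_coord_signs[OF c]) measurable
  finally show ?thesis by (simp add: gauss_transform_def)
qed

section \<open>Ball probabilities compared with Gaussian expectations\<close>

context relativistic_process
begin

lemma expectation_gauss:
  assumes e: "0 < \<epsilon>" and t: "0 \<le> t"
  shows "(LINT \<omega>|M. exp (- (norm (z - Y t \<omega>))\<^sup>2 / (2 * \<epsilon>))) = gauss_transform m \<alpha> t \<epsilon> z"
proof -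
  define N where "N = distr M borel (Y t)"
  have N: "prob_space N" "sets N = sets borel" unfolding N_def by (auto intro!: prob_space_distr)
  interpret N: prob_space N by fact
  have ch: "(LINT x|N. cis (- (w \<bullet> x)) * 1) = of_real (exp (- t * Phi m \<alpha> ((norm w)\<^sup>2)))" for w
  proof -
    have "(LINT x|N. cis (- (w \<bullet> x)) * 1) = (LINT \<omega>|M. cis (- w \<bullet> X t \<omega>))"
      unfolding N_def using AE_Y_eq_X t X_measurable[OF t] by (subst integral_distr) (auto intro!: integral_cong_AE)
    then show ?thesis using char_X[OF t, of "- w"] by simp
  qed
  have "complex_of_real ((2 * pi) ^ CARD('n) * (LINT x|N. gauss \<epsilon> (z - x))) = of_real ((2 * pi) ^ DIM(real^'n)) * (LINT x|N. of_real (gauss \<epsilon> (z - x)) * 1)"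
    by simp
  also have "\<dots> = (LINT w|lborel. (of_real (exp (- \<epsilon> * (norm w)\<^sup>2 / 2)) * cis (w \<bullet> z)) * (LINT x|N. cis (- (w \<bullet> x)) * 1))"
    by (rule gauss_smoothing[symmetric, OF e _ N(2)]) (auto intro: N.sigma_finite_measure_axioms)
  finally have "complex_of_real ((2 * pi) ^ CARD('n) * (LINT x|N. gauss \<epsilon> (z - x))) = (LINT w|lborel. (of_real (exp (- \<epsilon> * (norm w)\<^sup>2 / 2)) * cis (w \<bullet> z)) * of_real (exp (- t * Phi m \<alpha> ((norm w)\<^sup>2))))"
    unfolding ch .
  from arg_cong[OF this, of Re]
  have Re: "(2 * pi) ^ CARD('n) * (LINT x|N. gauss \<epsilon> (z - x)) = Re (LINT w|lborel. (of_real (exp (- \<epsilon> * (norm w)\<^sup>2 / 2)) * cis (w \<bullet> z)) * of_real (exp (- t * Phi m \<alpha> ((norm w)\<^sup>2))))"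
    by (simp only: Re_complex_of_real)
  have "gauss_transform m \<alpha> t \<epsilon> z = sqrt (2 * pi * \<epsilon>) ^ CARD('n) * (LINT x|N. gauss \<epsilon> (z - x))"
    unfolding gauss_transform_def Re[symmetric] by simp
  also have "\<dots> = (LINT x|N. exp (- (norm (z - x))\<^sup>2 / (2 * \<epsilon>)))"
    using e by (subst integral_mult_right_zero[symmetric]) (simp add: gauss_def)
  also have "\<dots> = (LINT \<omega>|M. exp (- (norm (z - Y t \<omega>))\<^sup>2 / (2 * \<epsilon>)))"
    unfolding N_def by (subst integral_distr) auto
  finally show ?thesis ..
qed

text \<open>The Gaussian bump is at most 1 on the ball and at most
  \<open>exp (- r\<^sup>2 / (2 * \<epsilon>))\<close> off it; the companion lower bound keeps only
  the ball.\<close>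

lemma gauss_transform_upper:
  assumes e: "0 < \<epsilon>" and t: "0 \<le> t" and r: "0 < r"
  shows "gauss_transform m \<alpha> t \<epsilon> z \<le> prob {\<omega>\<in>space M. norm (z - Y t \<omega>) < r} + exp (- r\<^sup>2 / (2 * \<epsilon>))"
proof -
  let ?A = "{\<omega>\<in>space M. norm (z - Y t \<omega>) < r}"
  have [measurable]: "?A \<in> sets M" by measurable
  have "(LINT \<omega>|M. exp (- (norm (z - Y t \<omega>))\<^sup>2 / (2 * \<epsilon>))) \<le> (LINT \<omega>|M. indicator ?A \<omega> + exp (- r\<^sup>2 / (2 * \<epsilon>)))"
  proof (rule integral_mono)
    show "integrable M (\<lambda>\<omega>. exp (- (norm (z - Y t \<omega>))\<^sup>2 / (2 * \<epsilon>)))"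
      by (rule integrable_const_bound[where B=1]) (use e in auto)
    show "integrable M (\<lambda>\<omega>. indicator ?A \<omega> + exp (- r\<^sup>2 / (2 * \<epsilon>)))"
      by (intro Bochner_Integration.integrable_add integrable_real_indicator) (auto simp: less_top[symmetric])
    fix \<omega> assume "\<omega> \<in> space M"
    show "exp (- (norm (z - Y t \<omega>))\<^sup>2 / (2 * \<epsilon>)) \<le> indicator ?A \<omega> + exp (- r\<^sup>2 / (2 * \<epsilon>))"
    proof (cases "\<omega> \<in> ?A")
      case True then show ?thesis using e by (simp add: add_increasing2)
    next
      case False
      then have "r\<^sup>2 \<le> (norm (z - Y t \<omega>))\<^sup>2" using r \<open>\<omega> \<in> space M\<close> by (intro power_mono) auto
      then have "exp (- (norm (z - Y t \<omega>))\<^sup>2 / (2 * \<epsilon>)) \<le> exp (- r\<^sup>2 / (2 * \<epsilon>))" using e by (simp add: divide_right_mono)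
      moreover have "indicator ?A \<omega> = (0::real)" using False by (rule indicator_simps(2))
      ultimately show ?thesis by linarith
    qed
  qed
  also have "\<dots> = prob ?A + exp (- r\<^sup>2 / (2 * \<epsilon>))"
    by (subst Bochner_Integration.integral_add) (auto simp: prob_space less_top[symmetric] intro!: integrable_real_indicator)
  finally show ?thesis unfolding expectation_gauss[OF e t] .
qed

lemma gauss_transform_lower:
  assumes e: "0 < \<epsilon>" and t: "0 \<le> t" and r: "0 < r"
  shows "prob {\<omega>\<in>space M. norm (z - Y t \<omega>) < r} * exp (- r\<^sup>2 / (2 * \<epsilon>)) \<le> gauss_transform m \<alpha> t \<epsilon> z"
proof -
  let ?A = "{\<omega>\<in>space M. norm (z - Y t \<omega>) < r}"
  have [measurable]: "?A \<in> sets M" by measurable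
  have "prob ?A * exp (- r\<^sup>2 / (2 * \<epsilon>)) = (LINT \<omega>|M. indicator ?A \<omega> * exp (- r\<^sup>2 / (2 * \<epsilon>)))"
    by (simp)
  also have "\<dots> \<le> (LINT \<omega>|M. exp (- (norm (z - Y t \<omega>))\<^sup>2 / (2 * \<epsilon>)))"
  proof (rule integral_mono)
    show "integrable M (\<lambda>\<omega>. exp (- (norm (z - Y t \<omega>))\<^sup>2 / (2 * \<epsilon>)))"
      by (rule integrable_const_bound[where B=1]) (use e in auto)
    show "integrable M (\<lambda>\<omega>. indicator ?A \<omega> * exp (- r\<^sup>2 / (2 * \<epsilon>)))"
      by (intro integrable_mult_left integrable_real_indicator) (auto simp: less_top[symmetric])
    fix \<omega> assume "\<omega> \<in> space M"
    show "indicator ?A \<omega> * exp (- r\<^sup>2 / (2 * \<epsilon>)) \<le> exp (- (norm (z - Y t \<omega>))\<^sup>2 / (2 * \<epsilon>))"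
    proof (cases "\<omega> \<in> ?A")
      case True
      then have "(norm (z - Y t \<omega>))\<^sup>2 \<le> r\<^sup>2" by (intro power_mono) auto
      then have "exp (- r\<^sup>2 / (2 * \<epsilon>)) \<le> exp (- (norm (z - Y t \<omega>))\<^sup>2 / (2 * \<epsilon>))" using e by (simp add: divide_right_mono)
      moreover have "indicator ?A \<omega> = (1::real)" using True by (rule indicator_simps(1))
      ultimately show ?thesis by simp
    next
      case False
      then have "indicator ?A \<omega> = (0::real)" by (rule indicator_simps(2))
      then show ?thesis by simp
    qed
  qed
  finally show ?thesis unfolding expectation_gauss[OF e t] .
qed

end

text \<open>The lower bound at radius \<open>r\<close> for one process meets the upper bound at
  radius \<open>r'\<close> for another at the same \<open>\<epsilon>\<close>. For a narrow Gaussian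
  the error \<open>exp (- r'\<^sup>2 / (2 * \<epsilon>))\<close> is at most half of what the lower
  bound guarantees, so a probability \<open>\<delta>\<close> common to all processes is left. The
  price is the larger radius.\<close>

lemma gauss_transform_ball_transfer:
  fixes z z' :: "real ^ 'n::finite"
  assumes P: "relativistic_process m \<alpha> M X" and t: "0 \<le> t"
    and eq: "\<And>\<epsilon>. 0 < \<epsilon> \<Longrightarrow> gauss_transform m \<alpha> t \<epsilon> z' = gauss_transform m \<alpha> t \<epsilon> z"
    and pos: "0 < measure M {\<omega>\<in>space M. norm (z - relativistic_process.Y M X t \<omega>) < r}" and r: "0 < r" "r < r'"
  obtains \<delta> where "0 < \<delta>"
    "\<And>(M' :: 'w measure) X'. relativistic_process m \<alpha> M' X' \<Longrightarrow> \<delta> \<le> measure M' {\<omega>\<in>space M'. norm (z' - relativistic_process.Y M' X' t \<omega>) < r'}"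
proof -
  define p where "p = measure M {\<omega>\<in>space M. norm (z - relativistic_process.Y M X t \<omega>) < r}"
  have p: "0 < p" using pos by (simp add: p_def)
  \<comment> \<open>\<open>\<epsilon>\<close> is chosen to make
    \<open>(r'\<^sup>2 - r\<^sup>2) / (2 * \<epsilon>)\<close> equal to
    \<open>L \<ge> ln (2 / p)\<close>, so that the two exponentials have ratio at most
    \<open>p / 2\<close>; the maximum with 1 ensures \<open>L > 0\<close> at once.\<close>
  define L where "L = max 1 (ln (2 / p))"
  define \<epsilon> where "\<epsilon> = (r'\<^sup>2 - r\<^sup>2) / (2 * L)"
  have L: "0 < L" "ln (2 / p) \<le> L" by (auto simp: L_def)
  have rr: "r\<^sup>2 < r'\<^sup>2" using r by (intro power_strict_mono) auto
  have e: "0 < \<epsilon>" using rr L by (simp add: \<epsilon>_def)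
  have "2 * \<epsilon> = 2 * (r'\<^sup>2 - r\<^sup>2) / (2 * L)" by (simp only: \<epsilon>_def times_divide_eq_right)
  also have "\<dots> = (r'\<^sup>2 - r\<^sup>2) / L" by (rule mult_divide_mult_cancel_left) simp
  finally have "2 * \<epsilon> = (r'\<^sup>2 - r\<^sup>2) / L" .
  then have "(r'\<^sup>2 - r\<^sup>2) / (2 * \<epsilon>) = L" using rr L by simp
  then have "- r'\<^sup>2 / (2 * \<epsilon>) = - r\<^sup>2 / (2 * \<epsilon>) - L" by (simp add: diff_divide_distrib)
  then have "exp (- r'\<^sup>2 / (2 * \<epsilon>)) = exp (- r\<^sup>2 / (2 * \<epsilon>)) * exp (- L)" by (simp only: diff_conv_add_uminus exp_add)
  also have "exp (- L) \<le> exp (- ln (2 / p))" using L by simp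
  also have "exp (- ln (2 / p)) = p / 2" using p by (simp add: exp_minus)
  finally have x: "exp (- r'\<^sup>2 / (2 * \<epsilon>)) \<le> exp (- r\<^sup>2 / (2 * \<epsilon>)) * (p / 2)" by simp
  show ?thesis
  proof (rule that[of "exp (- r\<^sup>2 / (2 * \<epsilon>)) * (p / 2)"])
    show "0 < exp (- r\<^sup>2 / (2 * \<epsilon>)) * (p / 2)" using p by simp
    fix M' :: "'w measure" and X' :: "real \<Rightarrow> 'w \<Rightarrow> real ^ 'n" assume P': "relativistic_process m \<alpha> M' X'"
    have "p * exp (- r\<^sup>2 / (2 * \<epsilon>)) \<le> gauss_transform m \<alpha> t \<epsilon> z"
      unfolding p_def by (rule relativistic_process.gauss_transform_lower[OF P e t r(1)])
    also have "\<dots> = gauss_transform m \<alpha> t \<epsilon> z'" using eq[OF e] by simp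
    also have "\<dots> \<le> measure M' {\<omega>\<in>space M'. norm (z' - relativistic_process.Y M' X' t \<omega>) < r'} + exp (- r'\<^sup>2 / (2 * \<epsilon>))"
      by (rule relativistic_process.gauss_transform_upper[OF P' e t]) (use r in simp)
    finally show "exp (- r\<^sup>2 / (2 * \<epsilon>)) * (p / 2) \<le> measure M' {\<omega>\<in>space M'. norm (z' - relativistic_process.Y M' X' t \<omega>) < r'}"
      using x by (simp add: field_simps)
  qed
qed

section \<open>Points approached with positive probability\<close>

context relativistic_process
begin

text \<open>The time may depend on the radius. This is weaker than membership in the support of the
  law at one fixed time, but it is stable under limits and sums.\<close>

definition reach :: "real ^ 'n \<Rightarrow> bool" where
  "reach z \<longleftrightarrow> (\<forall>r>0. \<exists>t>0. 0 < prob {\<omega>\<in>space M. norm (z - Y t \<omega>) < r})"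

lemma reach_closed:
  assumes "\<And>r. 0 < r \<Longrightarrow> \<exists>z'. reach z' \<and> norm (z - z') < r"
  shows "reach z"
  unfolding reach_def
proof (intro allI impI)
  fix r :: real assume r: "0 < r"
  obtain z' where z': "reach z'" "norm (z - z') < r / 2" using assms[of "r / 2"] r by auto
  then obtain t where t: "0 < t" "0 < prob {\<omega>\<in>space M. norm (z' - Y t \<omega>) < r / 2}"
    using r unfolding reach_def by (meson half_gt_zero)
  have "prob {\<omega>\<in>space M. norm (z' - Y t \<omega>) < r / 2} \<le> prob {\<omega>\<in>space M. norm (z - Y t \<omega>) < r}"
  proof (rule finite_measure_mono)
    show "{\<omega>\<in>space M. norm (z' - Y t \<omega>) < r / 2} \<subseteq> {\<omega>\<in>space M. norm (z - Y t \<omega>) < r}"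
    proof safe
      fix \<omega> assume "norm (z' - Y t \<omega>) < r / 2"
      then show "norm (z - Y t \<omega>) < r" using z'(2) norm_triangle_ineq[of "z - z'" "z' - Y t \<omega>"] by simp
    qed
  qed measurable
  then show "\<exists>t>0. 0 < prob {\<omega>\<in>space M. norm (z - Y t \<omega>) < r}" using t by (intro exI[of _ t]) auto
qed

text \<open>A visit near \<open>z\<close> at time \<open>t\<close> is followed by an independent
  displacement near \<open>z'\<close> during a further time \<open>s\<close>; each gets half of the
  radius.\<close>

lemma reach_add:
  assumes z: "reach z" and z': "reach z'"
  shows "reach (z + z')"
  unfolding reach_def
proof (intro allI impI)
  fix r :: real assume r: "0 < r"
  obtain t where t: "0 < t" "0 < prob {\<omega>\<in>space M. norm (z - Y t \<omega>) < r / 2}" using z r unfolding reach_def by (meson half_gt_zero)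
  obtain s where s: "0 < s" "0 < prob {\<omega>\<in>space M. norm (z' - Y s \<omega>) < r / 2}" using z' r unfolding reach_def by (meson half_gt_zero)
  let ?p = "\<lambda>z t r. emeasure M {\<omega>\<in>space M. norm (z - Y t \<omega>) < r}"
  define f :: "real ^ 'n \<Rightarrow> ennreal" where "f y = indicator (ball z (r / 2)) y" for y
  define g :: "real ^ 'n \<Rightarrow> ennreal" where "g y = indicator (ball (z + z') r) y" for y
  have [measurable]: "f \<in> borel_measurable borel" "g \<in> borel_measurable borel" unfolding f_def[abs_def] g_def[abs_def] by auto
  have ind: "emeasure M {\<omega>\<in>space M. norm (y - Y u \<omega>) < q} = (\<integral>\<^sup>+\<omega>. indicator (ball y q) (Y u \<omega>) \<partial>M)" for y u q
  proof -
    have "(\<integral>\<^sup>+\<omega>. indicator (ball y q) (Y u \<omega>) \<partial>M) = (\<integral>\<^sup>+\<omega>. indicator {\<omega>\<in>space M. norm (y - Y u \<omega>) < q} \<omega> \<partial>M)"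
      by (intro nn_integral_cong) (auto simp: indicator_def dist_norm)
    also have "\<dots> = emeasure M {\<omega>\<in>space M. norm (y - Y u \<omega>) < q}" by (rule nn_integral_indicator) measurable
    finally show ?thesis ..
  qed
  have "?p z t (r / 2) * ?p z' s (r / 2) = (\<integral>\<^sup>+\<omega>. f (0 + Y t \<omega>) * ?p z' s (r / 2) \<partial>M)"
    unfolding ind[of z] f_def by (subst nn_integral_multc) auto
  also have "\<dots> \<le> (\<integral>\<^sup>+\<omega>. f (0 + Y t \<omega>) * semigroup s g (0 + Y t \<omega>) \<partial>M)"
  proof (intro nn_integral_mono)
    fix \<omega>
    show "f (0 + Y t \<omega>) * ?p z' s (r / 2) \<le> f (0 + Y t \<omega>) * semigroup s g (0 + Y t \<omega>)"
    proof (cases "Y t \<omega> \<in> ball z (r / 2)")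
      case True
      have "?p z' s (r / 2) \<le> semigroup s g (0 + Y t \<omega>)"
        unfolding ind semigroup_def
      proof (intro nn_integral_mono)
        fix \<omega>'
        show "indicator (ball z' (r / 2)) (Y s \<omega>') \<le> g (0 + Y t \<omega> + Y s \<omega>')"
        proof (cases "Y s \<omega>' \<in> ball z' (r / 2)")
          case t': True
          have "norm ((z + z') - (Y t \<omega> + Y s \<omega>')) \<le> norm (z - Y t \<omega>) + norm (z' - Y s \<omega>')"
            using norm_triangle_ineq[of "z - Y t \<omega>" "z' - Y s \<omega>'"] by (simp add: algebra_simps)
          then have "Y t \<omega> + Y s \<omega>' \<in> ball (z + z') r" using True t' by (simp add: dist_norm)
          then show ?thesis by (simp add: g_def indicator_def)
        qed (simp add: indicator_def)
      qed
      then show ?thesis by (rule mult_left_mono) simp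
    qed (simp add: f_def)
  qed
  also have "\<dots> = (\<integral>\<^sup>+\<omega>. f (0 + Y t \<omega>) * g (0 + Y (t + s) \<omega>) \<partial>M)"
    using t s by (intro Y_markov_2[symmetric]) auto
  also have "\<dots> \<le> ?p (z + z') (t + s) r"
    unfolding ind by (intro nn_integral_mono) (auto simp: f_def g_def indicator_def)
  finally have "?p z t (r / 2) * ?p z' s (r / 2) \<le> ?p (z + z') (t + s) r" .
  then have "prob {\<omega>\<in>space M. norm (z - Y t \<omega>) < r / 2} * prob {\<omega>\<in>space M. norm (z' - Y s \<omega>) < r / 2} \<le> prob {\<omega>\<in>space M. norm (z + z' - Y (t + s) \<omega>) < r}"
    by (simp add: emeasure_eq_measure ennreal_mult'[symmetric])
  moreover have "0 < prob {\<omega>\<in>space M. norm (z - Y t \<omega>) < r / 2} * prob {\<omega>\<in>space M. norm (z' - Y s \<omega>) < r / 2}"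
    using t s by simp
  ultimately have "0 < prob {\<omega>\<in>space M. norm (z + z' - Y (t + s) \<omega>) < r}" by (rule less_le_trans[rotated])
  then show "\<exists>t>0. 0 < prob {\<omega>\<in>space M. norm (z + z' - Y t \<omega>) < r}"
    using t(1) s(1) by (intro exI[of _ "t + s"] conjI) auto
qed

text \<open>Reflection invariance is read off \<open>gauss_transform\<close>;
  \<open>gauss_transform_ball_transfer\<close>, with the given process on both sides, turns it into
  a positive probability for the reflected ball.\<close>

lemma reach_coord_signs:
  assumes z: "reach z" and c: "\<And>j. \<bar>c j\<bar> = 1"
  shows "reach (coord_signs c z)"
  unfolding reach_def
proof (intro allI impI)
  fix r :: real assume r: "0 < r"
  obtain t where t: "0 < t" "0 < prob {\<omega>\<in>space M. norm (z - Y t \<omega>) < r / 2}" using z r unfolding reach_def by (meson half_gt_zero)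
  have eq: "gauss_transform m \<alpha> t \<epsilon> (coord_signs c z) = gauss_transform m \<alpha> t \<epsilon> z" for \<epsilon>
    by (rule gauss_transform_coord_signs[OF c])
  obtain \<delta> where "0 < \<delta>" "\<And>(M' :: 'w measure) X'. relativistic_process m \<alpha> M' X' \<Longrightarrow> \<delta> \<le> measure M' {\<omega>\<in>space M'. norm (coord_signs c z - relativistic_process.Y M' X' t \<omega>) < r}"
    by (rule gauss_transform_ball_transfer[OF relativistic_process_axioms less_imp_le[OF t(1)] eq t(2)]) (use r in auto)
  then show "\<exists>t>0. 0 < prob {\<omega>\<in>space M. norm (coord_signs c z - Y t \<omega>) < r}"
    using t relativistic_process_axioms by (intro exI[of _ t]) (auto intro: less_le_trans)
qed


text \<open>At a small positive time the process is still near 0 with positive probability, and it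
  almost surely avoids the hyperplane orthogonal to \<open>b\<close>; so its law has a support point
  in the ball and off the hyperplane.\<close>

lemma reach_small:
  assumes b: "b \<in> Basis" and e: "0 < e"
  obtains z where "reach z" "norm z < e" "z \<bullet> b \<noteq> 0"
proof -
  have "(\<lambda>n. (LINT \<omega>|M. indicator (ball 0 e) (Y (1 / real (Suc n)) \<omega>) :: real)) \<longlonglongrightarrow> (LINT \<omega>|M. 1)"
  proof (rule integral_dominated_convergence[where w="\<lambda>_. 1"])
    show "AE \<omega> in M. (\<lambda>n. indicator (ball 0 e) (Y (1 / real (Suc n)) \<omega>) :: real) \<longlonglongrightarrow> 1"
    proof (intro AE_I2 tendsto_eventually)
      fix \<omega>
      have "eventually (\<lambda>s. Y s \<omega> \<in> ball 0 e) (at_right 0)"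
        using Y_right_cont[of \<omega> 0] by (rule topological_tendstoD) (use e in auto)
      moreover have "filterlim (\<lambda>n. 1 / real (Suc n)) (at_right 0) sequentially"
        by (intro tendsto_imp_filterlim_at_right LIMSEQ_Suc[OF lim_1_over_n]) auto
      ultimately have "eventually (\<lambda>n. Y (1 / real (Suc n)) \<omega> \<in> ball 0 e) sequentially"
        by (rule eventually_compose_filterlim)
      then show "\<forall>\<^sub>F n in sequentially. indicator (ball 0 e) (Y (1 / real (Suc n)) \<omega>) = (1::real)"
        by eventually_elim simp
    qed
    show "AE \<omega> in M. norm (indicator (ball 0 e) (Y (1 / real (Suc n)) \<omega>) :: real) \<le> 1" for n
      by (intro AE_I2) (simp add: indicator_def)
    show "(\<lambda>\<omega>. indicator (ball 0 e) (Y (1 / real (Suc n)) \<omega>) :: real) \<in> borel_measurable M" for n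
      by measurable
  qed simp_all
  then have "eventually (\<lambda>n. 0 < (LINT \<omega>|M. indicator (ball 0 e) (Y (1 / real (Suc n)) \<omega>) :: real)) sequentially"
    by (rule order_tendstoD(1)) (simp add: prob_space)
  then obtain n where n: "0 < (LINT \<omega>|M. indicator (ball 0 e) (Y (1 / real (Suc n)) \<omega>) :: real)"
    by (auto dest: eventually_happens)
  define t where "t = 1 / real (Suc n)"
  have t: "0 < t" by (simp add: t_def)
  define U where "U = ball 0 e \<inter> {y :: real ^ 'n. y \<bullet> b \<noteq> 0}"
  have "\<exists>z. reach z \<and> norm z < e \<and> z \<bullet> b \<noteq> 0"
  proof (rule ccontr)
    assume no: "\<not> (\<exists>z. reach z \<and> norm z < e \<and> z \<bullet> b \<noteq> 0)"
    have bad: "\<exists>r>0. emeasure M {\<omega>\<in>space M. norm (z - Y t \<omega>) < r} = 0" if z: "z \<in> U" for z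
    proof (rule ccontr)
      assume nb: "\<not> (\<exists>r>0. emeasure M {\<omega>\<in>space M. norm (z - Y t \<omega>) < r} = 0)"
      have "reach z" unfolding reach_def
      proof (intro allI impI exI[of _ t] conjI t)
        fix r :: real assume "0 < r"
        then have "emeasure M {\<omega>\<in>space M. norm (z - Y t \<omega>) < r} \<noteq> 0" using nb by blast
        then show "0 < prob {\<omega>\<in>space M. norm (z - Y t \<omega>) < r}"
          by (simp add: emeasure_eq_measure zero_less_measure_iff)
      qed
      then show False using z no by (auto simp: U_def)
    qed
    \<comment> \<open>If every point of \<open>U\<close> had a neighbourhood of probability zero,
      countably many of these would cover \<open>U\<close> by Lindelof's theorem, and
      \<open>U\<close> itself would have probability zero.\<close>
    define F where "F = {ball z r | z r. z \<in> U \<and> 0 < r \<and> emeasure M {\<omega>\<in>space M. norm (z - Y t \<omega>) < r} = 0}"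
    have "open S" if "S \<in> F" for S using that by (auto simp: F_def)
    then obtain F' where F': "F' \<subseteq> F" "countable F'" "\<Union>F' = \<Union>F"
      using Lindelof[of F] by blast
    have UF: "U \<subseteq> \<Union>F"
    proof
      fix y assume y: "y \<in> U"
      then obtain r where r: "0 < r" "emeasure M {\<omega>\<in>space M. norm (y - Y t \<omega>) < r} = 0" using bad by blast
      then have "ball y r \<in> F" unfolding F_def using y by blast
      then show "y \<in> \<Union>F" by (rule UnionI) (use r(1) in simp)
    qed
    have AE1: "AE \<omega> in M. \<forall>S\<in>F'. Y t \<omega> \<notin> S"
    proof (subst AE_ball_countable[OF F'(2)], rule ballI)
      fix S assume "S \<in> F'"
      then have "S \<in> F" using F'(1) by blast
      then obtain z r where S: "S = ball z r" "emeasure M {\<omega>\<in>space M. norm (z - Y t \<omega>) < r} = 0" unfolding F_def by blast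
      have "{\<omega>\<in>space M. norm (z - Y t \<omega>) < r} \<in> null_sets M" using S(2) by (intro null_setsI) measurable
      from AE_not_in[OF this] show "AE \<omega> in M. Y t \<omega> \<notin> S"
        using AE_space by eventually_elim (auto simp: S dist_norm)
    qed
    have AE2: "AE \<omega> in M. 0 + Y t \<omega> \<notin> {y. y \<bullet> b = 0}"
    proof (rule semigroup_null[OF _ t])
      show "0 < (1::real)" by simp
      show "{y. y \<bullet> b = 0} \<in> sets (borel :: (real ^ 'n) measure)" by measurable
      have "AE y in lborel. y \<bullet> b \<noteq> 0" by (rule AE_lborel_inner_neq[OF b])
      then show "emeasure lborel {y. y \<bullet> b = 0} = 0"
        using AE_iff_measurable[of "{y. y \<bullet> b = 0}" lborel "\<lambda>y. y \<bullet> b \<noteq> 0"] by simp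
    qed
    have "AE \<omega> in M. (indicator (ball 0 e) (Y t \<omega>) :: real) = 0"
      using AE1 AE2
    proof eventually_elim
      fix \<omega> assume 1: "\<forall>S\<in>F'. Y t \<omega> \<notin> S" and 2: "0 + Y t \<omega> \<notin> {y. y \<bullet> b = 0}"
      then have "Y t \<omega> \<notin> U" using UF F'(3) by blast
      then show "(indicator (ball 0 e) (Y t \<omega>) :: real) = 0" using 2 by (auto simp: U_def indicator_def)
    qed
    then have "(LINT \<omega>|M. indicator (ball 0 e) (Y t \<omega>) :: real) = (LINT \<omega>|M. 0)"
      by (intro integral_cong_AE) auto
    then show False using n by (simp add: t_def)
  qed
  then show ?thesis using that by blast
qed

text \<open>Reachable points form a closed set, stable under sums and coordinate reflections. Adding
  to a small reachable point its reflection in all coordinates but one leaves a short nonzero vector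
  along an axis; multiples of such vectors are dense on each axis, and sums of axis points fill the
  space.\<close>

lemma reach_all: "reach z"
proof -
  have small: "\<exists>s. 0 < \<bar>s\<bar> \<and> \<bar>s\<bar> < e \<and> reach (s *\<^sub>R b) \<and> reach (- s *\<^sub>R b)" if b: "b \<in> Basis" and e: "0 < e" for b e
  proof -
    obtain z where z: "reach z" "norm z < e / 2" "z \<bullet> b \<noteq> 0" using reach_small[OF b, of "e / 2"] e by auto
    define s where "s = 2 * (z \<bullet> b)"
    define c where "c j = (if j = b then 1 else - 1 :: real)" for j
    have "z + coord_signs c z = s *\<^sub>R b"
    proof (rule euclidean_eqI)
      fix j :: "real ^ 'n" assume j: "j \<in> Basis"
      show "(z + coord_signs c z) \<bullet> j = (s *\<^sub>R b) \<bullet> j"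
        using b j by (cases "j = b") (simp_all add: inner_add_left coord_signs_inner c_def s_def inner_not_same_Basis)
    qed
    moreover have "reach (z + coord_signs c z)"
      by (intro reach_add reach_coord_signs z(1)) (simp add: c_def)
    ultimately have 1: "reach (s *\<^sub>R b)" by simp
    have "coord_signs (\<lambda>_. - 1) (s *\<^sub>R b) = - s *\<^sub>R b"
      by (rule euclidean_eqI) (simp add: coord_signs_inner)
    moreover have "reach (coord_signs (\<lambda>_. - 1) (s *\<^sub>R b))" by (rule reach_coord_signs[OF 1]) simp
    ultimately have 2: "reach (- s *\<^sub>R b)" by simp
    have "\<bar>s\<bar> < e" using Basis_le_norm[OF b, of z] z(2) by (simp add: s_def)
    moreover have "0 < \<bar>s\<bar>" using z(3) by (simp add: s_def)
    ultimately show ?thesis using 1 2 by blast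
  qed
  have mult: "reach (real (Suc n) *\<^sub>R y)" if "reach y" for n y
  proof (induction n)
    case (Suc n)
    have "real (Suc (Suc n)) *\<^sub>R y = real (Suc n) *\<^sub>R y + y"
      by (simp only: of_nat_Suc[of "Suc n"] scaleR_left_distrib scaleR_one) (rule add.commute)
    then show ?case using reach_add[OF Suc that] by simp
  qed (use that in simp)
  have axis: "reach (q *\<^sub>R b)" if b: "b \<in> Basis" for q b
  proof (rule reach_closed)
    fix r :: real assume r: "0 < r"
    obtain s where s: "0 < \<bar>s\<bar>" "\<bar>s\<bar> < r" "reach (s *\<^sub>R b)" "reach (- s *\<^sub>R b)" using small[OF b r] by blast
    define s' where "s' = (if 0 \<le> q then \<bar>s\<bar> else - \<bar>s\<bar>)"
    have s': "reach (s' *\<^sub>R b)" using s by (auto simp: s'_def abs_if)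
    define n where "n = nat \<lfloor>\<bar>q\<bar> / \<bar>s\<bar>\<rfloor>"
    have rn: "real n = of_int \<lfloor>\<bar>q\<bar> / \<bar>s\<bar>\<rfloor>" by (simp add: n_def)
    then have "real n \<le> \<bar>q\<bar> / \<bar>s\<bar>" "\<bar>q\<bar> / \<bar>s\<bar> < real n + 1" by linarith+
    then have "real n * \<bar>s\<bar> \<le> \<bar>q\<bar>" "\<bar>q\<bar> < (real n + 1) * \<bar>s\<bar>"
      by (simp_all only: pos_le_divide_eq[OF s(1)] pos_divide_less_eq[OF s(1)])
    then have "\<bar>q - real n * s'\<bar> < \<bar>s\<bar>" by (auto simp: s'_def algebra_simps)
    then have "norm (q *\<^sub>R b - (real n * s') *\<^sub>R b) < r"
      using s b by (simp add: scaleR_left_diff_distrib[symmetric])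
    moreover have "reach ((real n * s') *\<^sub>R b)"
    proof (cases n)
      \<comment> \<open>\<open>mult\<close> yields positive multiples only; 0 is reached by a step
        forth and a step back.\<close>
      case 0
      have "s *\<^sub>R b + - s *\<^sub>R b = 0" by simp
      then show ?thesis using reach_add[OF s(3,4)] 0 by simp
    next
      case (Suc k) then show ?thesis using mult[OF s', of k] by simp
    qed
    ultimately show "\<exists>z'. reach z' \<and> norm (q *\<^sub>R b - z') < r" by blast
  qed
  have "reach (\<Sum>b\<in>S. (z \<bullet> b) *\<^sub>R b)" if "finite S" "S \<subseteq> Basis" for S
    using that
  proof (induction S)
    case empty
    obtain b :: "real ^ 'n" where "b \<in> Basis" using nonempty_Basis by blast
    from axis[OF this, of 0] show ?case by simp
  next
    case (insert b S)
    then show ?case using reach_add[OF axis[of b "z \<bullet> b"]] by simp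
  qed
  from this[OF finite_Basis subset_refl] show ?thesis by (simp add: euclidean_representation)
qed

end

section \<open>Uniqueness of the ground state\<close>

context relativistic_ground_state
begin

text \<open>A minimum principle: with \<open>\<kappa>\<close> the minimum of
  \<open>\<phi> / \<psi>\<close> over the closed ball, \<open>w = \<phi> - \<kappa> * \<psi>\<close>
  is nonnegative there, hence everywhere by the potential identity, and vanishes at the minimiser
  \<open>x0\<close>. A nonnegative potential that is zero at one point is zero wherever the process
  goes. The normalisation then forces \<open>\<kappa> = 1\<close>.\<close>

lemma ground_state_unique:
  assumes gs': "ground_state m \<alpha> a v l (\<psi> :: real ^ 'n \<Rightarrow> real)"
  shows "\<psi> = \<phi>"
proof -
  interpret P: relativistic_ground_state m \<alpha> M X a v l \<psi>
    by unfold_locales (rule a v gs')+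
  let ?D = "cball 0 a :: (real ^ 'n) set"
  have "continuous_on ?D (\<lambda>y. \<phi> y / \<psi> y)"
  proof (intro continuous_on_divide ballI)
    show "continuous_on ?D \<phi>" by (rule continuous_on_subset[OF \<phi>_cont subset_UNIV])
    show "continuous_on ?D \<psi>" by (rule continuous_on_subset[OF P.\<phi>_cont subset_UNIV])
    show "\<psi> y \<noteq> 0" for y using P.\<phi>_pos[of y] by simp
  qed
  moreover have "?D \<noteq> {}" using a by simp
  ultimately obtain x0 where x0: "x0 \<in> ?D" "\<And>y. y \<in> ?D \<Longrightarrow> \<phi> x0 / \<psi> x0 \<le> \<phi> y / \<psi> y"
    using continuous_attains_inf[OF compact_cball] by blast
  define \<kappa> where "\<kappa> = \<phi> x0 / \<psi> x0"
  have \<kappa>: "0 < \<kappa>" using \<phi>_pos P.\<phi>_pos by (simp add: \<kappa>_def)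
  define w where "w y = \<phi> y - \<kappa> * \<psi> y" for y
  have wD: "0 \<le> w y" if "y \<in> ?D" for y
    using x0(2)[OF that] P.\<phi>_pos[of y] by (simp add: w_def \<kappa>_def[symmetric] pos_le_divide_eq)
  have w0: "w x0 = 0" using P.\<phi>_pos[of x0] by (simp add: w_def \<kappa>_def)
  have wm[measurable]: "w \<in> borel_measurable borel" unfolding w_def[abs_def] by measurable
  define f where "f y = indicator ?D y * ennreal (w y)" for y
  have fm[measurable]: "f \<in> borel_measurable borel" unfolding f_def[abs_def] by measurable
  \<comment> \<open>The identity is kept additive, since the sign of \<open>w\<close> outside the
    ball is known only after \<open>wpot\<close>, and \<open>ennreal\<close> could not represent a
    negative difference.\<close>
  have eq: "ennreal (lam * \<phi> x) = ennreal (\<kappa> * (lam * \<psi> x)) + ennreal v * potential lam f x" for x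
  proof -
    define g where "g y = indicator ?D y * ennreal (\<psi> y)" for y
    have gm[measurable]: "g \<in> borel_measurable borel" unfolding g_def[abs_def] by measurable
    have split: "indicator ?D y * ennreal (\<phi> y) = ennreal \<kappa> * g y + f y" for y
    proof (cases "y \<in> ?D")
      case True
      have "ennreal (\<phi> y) = ennreal (\<kappa> * \<psi> y + w y)" by (simp add: w_def)
      also have "\<dots> = ennreal (\<kappa> * \<psi> y) + ennreal (w y)" using \<kappa> wD[OF True] by (intro ennreal_plus) auto
      finally show ?thesis using True \<kappa> by (simp add: f_def g_def ennreal_mult)
    qed (simp add: f_def g_def)
    have s: "semigroup s (\<lambda>y. ennreal \<kappa> * g y + f y) x = ennreal \<kappa> * semigroup s g x + semigroup s f x" for s
      unfolding semigroup_def by (subst nn_integral_add) (auto simp: nn_integral_cmult)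
    have "potential lam (\<lambda>y. ennreal \<kappa> * g y + f y) x = (\<integral>\<^sup>+s. ennreal \<kappa> * (ennreal (exponential_density lam s) * semigroup s g x) + ennreal (exponential_density lam s) * semigroup s f x \<partial>lborel)"
      unfolding potential_def s by (simp only: distrib_left mult.left_commute)
    also have "\<dots> = ennreal \<kappa> * potential lam g x + potential lam f x"
      unfolding potential_def by (subst nn_integral_add) (auto simp: nn_integral_cmult)
    finally have "ennreal (lam * \<phi> x) = ennreal v * (ennreal \<kappa> * potential lam g x + potential lam f x)"
      unfolding \<phi>_eq_potential_cball split by simp
    also have "\<dots> = ennreal \<kappa> * (ennreal v * potential lam g x) + ennreal v * potential lam f x"
      by (simp only: distrib_left mult.left_commute)
    also have "ennreal v * potential lam g x = ennreal (lam * \<psi> x)"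
      unfolding g_def[abs_def] by (rule P.\<phi>_eq_potential_cball[symmetric])
    also have "ennreal \<kappa> * ennreal (lam * \<psi> x) = ennreal (\<kappa> * (lam * \<psi> x))"
      using \<kappa> by (simp add: ennreal_mult')
    finally show ?thesis .
  qed
  have wpot: "0 \<le> w x \<and> ennreal (lam * w x) = ennreal v * potential lam f x" for x
  proof -
    define q where "q = ennreal v * potential lam f x"
    have e: "ennreal (lam * \<phi> x) = ennreal (\<kappa> * (lam * \<psi> x)) + q" using eq[of x] by (simp add: q_def)
    have "q \<le> ennreal (lam * \<phi> x)" unfolding e by simp
    then obtain r where r: "0 \<le> r" "q = ennreal r" by (cases q) (auto simp: top_unique)
    have "ennreal (lam * \<phi> x) = ennreal (\<kappa> * (lam * \<psi> x) + r)"
      unfolding e r(2) using \<kappa> lam r(1) by (intro ennreal_plus[symmetric]) auto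
    then have "lam * \<phi> x = \<kappa> * (lam * \<psi> x) + r"
      using \<kappa> lam r(1) by (subst (asm) ennreal_inj) auto
    then have r': "r = lam * w x" by (simp add: w_def algebra_simps)
    then have "0 \<le> w x" using r(1) lam by (simp add: zero_le_mult_iff)
    then show ?thesis using r(2) r' by (simp add: q_def)
  qed
  have pot0: "potential lam f x0 = 0"
    using wpot[of x0] v by (simp add: w0)
  have w_zero: "w z = 0" for z
  proof (rule ccontr)
    assume "w z \<noteq> 0"
    then have wz: "0 < w z" using wpot[of z] by linarith
    have "isCont w z" unfolding w_def
      using \<phi>_cont P.\<phi>_cont by (auto intro!: continuous_intros simp: continuous_on_eq_continuous_at)
    then have "eventually (\<lambda>y. 0 < w y) (at z)" using wz unfolding isCont_def by (rule order_tendstoD(1))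
    then obtain r where r: "0 < r" "\<And>y. y \<noteq> z \<Longrightarrow> dist y z < r \<Longrightarrow> 0 < w y"
      unfolding eventually_at by blast
    have rw: "0 < w y" if "dist y z < r" for y using r(2)[of y] that wz by (cases "y = z") auto
    obtain t where t: "0 < t" "0 < prob {\<omega>\<in>space M. norm ((z - x0) - Y t \<omega>) < r}"
      using reach_all[of "z - x0"] r(1) unfolding reach_def by blast
    \<comment> \<open>Excessiveness carries the zero from \<open>x0\<close> to almost every position
      at time \<open>t\<close>, which contradicts the positive probability of being near
      \<open>z\<close>.\<close>
    have "ennreal (exp (- lam * t)) * semigroup t (potential lam f) x0 \<le> potential lam f x0"
      by (rule semigroup_potential_le) (use lam t in auto)
    then have "semigroup t (potential lam f) x0 = 0" by (simp add: pot0)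
    then have "AE \<omega> in M. potential lam f (x0 + Y t \<omega>) = 0"
      unfolding semigroup_def by (subst (asm) nn_integral_0_iff_AE) auto
    then have "AE \<omega> in M. \<not> norm ((z - x0) - Y t \<omega>) < r"
    proof eventually_elim
      fix \<omega> assume "potential lam f (x0 + Y t \<omega>) = 0"
      then have "ennreal (lam * w (x0 + Y t \<omega>)) = 0" using wpot[of "x0 + Y t \<omega>"] by simp
      then have "\<not> 0 < w (x0 + Y t \<omega>)" using lam by (simp add: ennreal_eq_0_iff mult_le_0_iff not_less)
      then have "\<not> dist (x0 + Y t \<omega>) z < r" using rw by blast
      then show "\<not> norm ((z - x0) - Y t \<omega>) < r" by (simp add: dist_norm norm_minus_commute algebra_simps)
    qed
    then have "prob {\<omega>\<in>space M. norm ((z - x0) - Y t \<omega>) < r} = 0"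
      by (subst (asm) AE_iff_measurable[OF _ refl]) (auto simp: measure_def)
    then show False using t by simp
  qed
  then have \<phi>\<psi>: "\<phi> y = \<kappa> * \<psi> y" for y by (simp add: w_def)
  have n: "L2_norm (\<lambda>x. complex_of_real (\<phi> x)) = 1" "L2_norm (\<lambda>x. complex_of_real (\<psi> x)) = 1"
    using gs gs' unfolding ground_state_def by blast+
  have "L2_norm (\<lambda>x. complex_of_real (\<phi> x)) = \<kappa> * L2_norm (\<lambda>x. complex_of_real (\<psi> x))"
  proof -
    have "(norm (complex_of_real (\<kappa> * \<psi> x)))\<^sup>2 = \<kappa>\<^sup>2 * (norm (complex_of_real (\<psi> x)))\<^sup>2" for x
      by (simp add: norm_mult power_mult_distrib)
    then show ?thesis using \<kappa> unfolding L2_norm_def \<phi>\<psi> by (simp add: real_sqrt_mult)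
  qed
  then have "\<kappa> = 1" unfolding n by simp
  then show ?thesis using \<phi>\<psi> by auto
qed

lemma compact_bounds:
  obtains b1 b2 where "0 < b1" "\<And>y. norm y \<le> r \<Longrightarrow> b1 \<le> \<phi> y" "\<And>y. norm y \<le> r \<Longrightarrow> \<phi> y \<le> b2"
proof -
  obtain b where b: "\<And>x. norm (\<phi> x) \<le> b" using \<phi>_bounded by (auto simp: bounded_iff)
  have ub: "\<phi> y \<le> b" for y using b[of y] by simp
  show ?thesis
  proof (cases "0 \<le> r")
    case True
    then have "cball (0 :: real ^ 'n) r \<noteq> {}" by simp
    from continuous_attains_inf[OF compact_cball this continuous_on_subset[OF \<phi>_cont subset_UNIV]]
    obtain x where "\<And>y. y \<in> cball 0 r \<Longrightarrow> \<phi> x \<le> \<phi> y" by blast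
    then show ?thesis using \<phi>_pos ub by (intro that[of "\<phi> x" b]) auto
  next
    case False
    have "\<not> norm y \<le> r" for y :: "real ^ 'n" using False norm_ge_zero[of y] by linarith
    then show ?thesis by (intro that[of 1 b]) auto
  qed
qed

end

text \<open>Without any ground state and process the claim is empty. Otherwise one such pair fixes
  all constants: \<open>b1\<close>, \<open>b2\<close> and \<open>bR\<close> belong to the unique
  ground state, and the exit probability \<open>p\<close> is transferred to every other process at
  the price of doubling the radius from \<open>a / 2\<close> to \<open>a\<close>.\<close>

theorem theorem5p1:
  fixes m \<alpha> a v l :: real
  assumes "0 < \<alpha>" and "\<alpha> < 2" and "0 \<le> m" and "0 < a" and "0 < v"
  shows "\<exists>C\<ge>1. \<forall>(k::'n::finite) (\<phi> :: real ^ 'n \<Rightarrow> real) (M :: 'w measure) X.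
           ground_state m \<alpha> a v l \<phi> \<longrightarrow> levy_process_generated_by_minus_L m \<alpha> M X \<longrightarrow>
           (\<forall>x. norm x \<le> a \<longrightarrow>
              ennreal (1 / C * \<phi> (axis k a)) * exit_moment M X a (v - \<bar>l\<bar>) x \<le> ennreal (\<phi> x) \<and>
              ennreal (\<phi> x) \<le> ennreal (C * \<phi> (axis k a)) * exit_moment M X a (v - \<bar>l\<bar>) x) \<and>
           (\<forall>x. a \<le> norm x \<longrightarrow>
              ennreal (1 / C * \<phi> (axis k a)) * entry_moment M X a (- \<bar>l\<bar>) x \<le> ennreal (\<phi> x) \<and>
              ennreal (\<phi> x) \<le> ennreal (C * \<phi> (axis k a)) * entry_moment M X a (- \<bar>l\<bar>) x)"
proof (cases "\<exists>(\<phi> :: real ^ 'n \<Rightarrow> real) (M :: 'w measure) X. ground_state m \<alpha> a v l \<phi> \<and> levy_process_generated_by_minus_L m \<alpha> M (X :: real \<Rightarrow> 'w \<Rightarrow> real ^ 'n)")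
  case False
  then show ?thesis by (intro exI[of _ 1]) blast
next
  case True
  then obtain \<phi>0 :: "real ^ 'n \<Rightarrow> real" and M0 :: "'w measure" and X0 :: "real \<Rightarrow> 'w \<Rightarrow> real ^ 'n"
    where gs0: "ground_state m \<alpha> a v l \<phi>0" and L0: "levy_process_generated_by_minus_L m \<alpha> M0 X0" by blast
  interpret R: relativistic_ground_state m \<alpha> M0 X0 a v l \<phi>0
    by unfold_locales (rule assms gs0 L0)+
  obtain b1 b2 where b: "0 < b1" "\<And>y. norm y \<le> a \<Longrightarrow> b1 \<le> \<phi>0 y" "\<And>y. norm y \<le> a \<Longrightarrow> \<phi>0 y \<le> b2"
    by (rule R.compact_bounds[where r=a]) blast
  obtain bR where bR: "0 < bR" "\<And>y. norm y \<le> 6 * a \<Longrightarrow> bR \<le> \<phi>0 y"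
    by (rule R.compact_bounds[where r="6 * a"]) blast
  have b12: "b1 \<le> b2" using b(2)[of 0] b(3)[of 0] assms(4) by simp
  obtain e0 :: "real ^ 'n" where e0: "e0 \<in> Basis" using nonempty_Basis by blast
  \<comment> \<open>A displacement within \<open>a\<close> of a vector of length
    \<open>4 * a\<close> carries any start in the ball to a point of norm between
    \<open>2 * a\<close> and \<open>6 * a\<close>: out of the ball, yet within the region where
    \<open>bR\<close> bounds the ground state from below.\<close>
  define z where "z = (4 * a) *\<^sub>R e0"
  have nz: "norm z = 4 * a" using e0 assms(4) by (simp add: z_def)
  obtain t0 where t0: "0 < t0" "0 < R.prob {\<omega>\<in>space M0. norm (z - R.Y t0 \<omega>) < a / 2}"
    using R.reach_all[of z] assms(4) unfolding R.reach_def by (meson half_gt_zero)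
  obtain p where p: "0 < p" "\<And>(M' :: 'w measure) X'. relativistic_process m \<alpha> M' X' \<Longrightarrow> p \<le> measure M' {\<omega>\<in>space M'. norm (z - relativistic_process.Y M' X' t0 \<omega>) < a}"
    by (rule gauss_transform_ball_transfer[OF R.relativistic_process_axioms less_imp_le[OF t0(1)] refl t0(2)]) (use assms(4) in auto)
  \<comment> \<open>\<open>\<delta>\<close> is the loss in \<open>killed_potential_le\<close>
    divided by \<open>lam\<close>, \<open>K\<close> the resulting bound on
    \<open>exp_survival\<close>, and \<open>E\<close> the bound on the exit moment.\<close>
  define \<delta> where "\<delta> = exp (- R.lam * t0) * bR * p"
  have d: "0 < \<delta>" using bR p by (simp add: \<delta>_def)
  define K where "K = b2 / (R.lam * b1) * (b2 / \<delta>)"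
  have K: "0 \<le> K" using d b b12 R.lam by (simp add: K_def)
  define E where "E = 1 + (v - R.lam) * K"
  have E: "1 \<le> E" using K R.lam by (simp add: E_def)
  \<comment> \<open>\<open>b2 / b1\<close> compares values of the ground state on the closed ball,
    which contains \<open>axis k a\<close>; \<open>1 + v / R.lam\<close> absorbs the factor of
    \<open>\<phi>_le_entry_moment\<close>, and \<open>E\<close> the exit moment. Each factor is at
    least 1, so the product dominates all partial products.\<close>
  define C where "C = b2 / b1 * (1 + v / R.lam) * E"
  have q: "1 \<le> b2 / b1" "0 < 1 + v / R.lam" "1 \<le> 1 + v / R.lam" using b b12 R.lam assms(5) by (auto intro: add_pos_pos)
  have C1: "b2 / b1 \<le> C" "v * b2 / (R.lam * b1) \<le> C" "b2 / b1 * E \<le> C" "1 \<le> C"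
  proof -
    have i1: "b2 / b1 * 1 \<le> b2 / b1 * E" using E q by (intro mult_left_mono) auto
    have "0 \<le> b2 / b1 * E" using i1 q(1) by linarith
    from mult_left_mono[OF q(3) this]
    have "b2 / b1 * E * 1 \<le> b2 / b1 * E * (1 + v / R.lam)" .
    then show i2: "b2 / b1 * E \<le> C" by (simp add: C_def mult_ac)
    then show "b2 / b1 \<le> C" using i1 by simp
    then show "1 \<le> C" using q by simp
    have "v * b2 / (R.lam * b1) = b2 / b1 * (v / R.lam) * 1" by (simp add: mult.commute)
    also have "\<dots> \<le> b2 / b1 * (1 + v / R.lam) * E"
    proof (rule mult_mono[OF _ E])
      have b0: "0 \<le> b2 / b1" using q(1) by linarith
      show "b2 / b1 * (v / R.lam) \<le> b2 / b1 * (1 + v / R.lam)" by (rule mult_left_mono[OF _ b0]) simp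
      show "0 \<le> b2 / b1 * (1 + v / R.lam)" using b0 q(2) by (intro mult_nonneg_nonneg) linarith+
    qed simp
    finally show "v * b2 / (R.lam * b1) \<le> C" by (simp add: C_def)
  qed
  have labs: "\<bar>l\<bar> = R.lam" using R.lam by (simp add: R.lam_def)
  show ?thesis
  proof (intro exI[of _ C] conjI C1 allI impI)
    fix k :: 'n and \<phi> :: "real ^ 'n \<Rightarrow> real" and M :: "'w measure" and X :: "real \<Rightarrow> 'w \<Rightarrow> real ^ 'n"
    assume gs: "ground_state m \<alpha> a v l \<phi>" and L: "levy_process_generated_by_minus_L m \<alpha> M X"
    have eq: "\<phi> = \<phi>0" by (rule R.ground_state_unique[OF gs])
    interpret Q: relativistic_ground_state m \<alpha> M X a v l \<phi>0
      by unfold_locales (rule assms gs0 L)+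
    have ax: "b1 \<le> \<phi>0 (axis k a)" "\<phi>0 (axis k a) \<le> b2"
      using b(2,3)[of "axis k a"] assms(4) by (simp_all add: norm_eq_sqrt_inner inner_axis_axis)
    have le1: "1 / C * \<phi>0 (axis k a) \<le> b1 / E"
    proof -
      have "\<phi>0 (axis k a) * E \<le> b2 * E" using ax E by (intro mult_right_mono) auto
      also have "\<dots> = b1 * (b2 / b1 * E)" using b by simp
      also have "\<dots> \<le> b1 * C" using C1(3) b by (intro mult_left_mono) auto
      finally show ?thesis using C1(4) E by (simp add: field_simps)
    qed
    have le2: "1 / C * \<phi>0 (axis k a) \<le> b1"
    proof -
      have "b1 / E \<le> b1 / 1" using E b(1) by (intro divide_left_mono) auto
      then show ?thesis using le1 by simp
    qed
    have le3: "b1 * C \<le> C * \<phi>0 (axis k a)" using ax C1(4) by (simp add: mult.commute mult_left_mono)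
    have leave: "ennreal p \<le> emeasure M {\<omega>\<in>space M. a < norm (x + Q.Y t0 \<omega>) \<and> norm (x + Q.Y t0 \<omega>) \<le> 6 * a}" if x: "norm x \<le> a" for x
    proof -
      have "p \<le> measure M {\<omega>\<in>space M. norm (z - Q.Y t0 \<omega>) < a}" by (rule p(2)[OF Q.relativistic_process_axioms])
      also have "\<dots> \<le> measure M {\<omega>\<in>space M. a < norm (x + Q.Y t0 \<omega>) \<and> norm (x + Q.Y t0 \<omega>) \<le> 6 * a}"
      proof (rule Q.finite_measure_mono)
        show "{\<omega>\<in>space M. norm (z - Q.Y t0 \<omega>) < a} \<subseteq> {\<omega>\<in>space M. a < norm (x + Q.Y t0 \<omega>) \<and> norm (x + Q.Y t0 \<omega>) \<le> 6 * a}"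
        proof (intro Collect_mono impI, elim conjE, intro conjI)
          fix \<omega> assume zY: "norm (z - Q.Y t0 \<omega>) < a"
          have "norm z \<le> norm (z - Q.Y t0 \<omega>) + norm (x + Q.Y t0 \<omega>) + norm x"
            using norm_triangle_ineq[of "z - Q.Y t0 \<omega>" "x + Q.Y t0 \<omega>"] norm_triangle_ineq4[of "z + x" x] by simp
          then show "a < norm (x + Q.Y t0 \<omega>)" using zY x nz assms(4) by linarith
          have "norm (x + Q.Y t0 \<omega>) \<le> norm (x + z) + norm (z - Q.Y t0 \<omega>)"
            using norm_triangle_ineq4[of "x + z" "z - Q.Y t0 \<omega>"] by simp
          then show "norm (x + Q.Y t0 \<omega>) \<le> 6 * a" using norm_triangle_ineq[of x z] zY x nz by linarith
        qed
      qed measurable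
      finally show ?thesis by (simp add: Q.emeasure_eq_measure ennreal_leI)
    qed
    have exit: "exit_moment M X a (v - R.lam) x \<le> ennreal E" if x: "norm x \<le> a" for x
      unfolding E_def
    proof (rule Q.exit_moment_le[OF _ K])
      fix N :: real assume N: "0 \<le> N"
      show "Q.exp_survival N x \<le> ennreal K"
        unfolding K_def \<delta>_def
        by (rule Q.exp_survival_bounded[OF t0(1) p(1) leave bR b N x])
    qed
    show "ennreal (1 / C * \<phi> (axis k a)) * exit_moment M X a (v - \<bar>l\<bar>) x \<le> ennreal (\<phi> x)" if x: "norm x \<le> a" for x
    proof -
      have "ennreal (1 / C * \<phi> (axis k a)) * exit_moment M X a (v - \<bar>l\<bar>) x \<le> ennreal (b1 / E) * ennreal E"
        unfolding eq labs by (intro mult_mono ennreal_leI le1 exit x) auto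
      also have "\<dots> = ennreal b1" using b E by (simp add: ennreal_mult'[symmetric])
      also have "\<dots> \<le> ennreal (\<phi> x)" unfolding eq by (intro ennreal_leI b x)
      finally show ?thesis .
    qed
    show "ennreal (\<phi> x) \<le> ennreal (C * \<phi> (axis k a)) * exit_moment M X a (v - \<bar>l\<bar>) x" if x: "norm x \<le> a" for x
    proof -
      have "\<phi>0 x \<le> b1 * (b2 / b1)" using b(3)[OF x] b(1) by simp
      also have "\<dots> \<le> b1 * C" using C1(1) b(1) by (intro mult_left_mono) auto
      also note le3
      finally have "ennreal (\<phi>0 x) * 1 \<le> ennreal (C * \<phi>0 (axis k a)) * exit_moment M X a (v - R.lam) x"
        by (intro mult_mono ennreal_leI Q.exit_moment_ge_1) auto
      then show ?thesis unfolding eq labs by simp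
    qed
    show "ennreal (1 / C * \<phi> (axis k a)) * entry_moment M X a (- \<bar>l\<bar>) x \<le> ennreal (\<phi> x)" for x
    proof -
      have "ennreal (1 / C * \<phi> (axis k a)) * entry_moment M X a (- \<bar>l\<bar>) x \<le> ennreal b1 * entry_moment M X a (- R.lam) x"
        unfolding eq labs by (intro mult_right_mono ennreal_leI le2) simp
      also have "\<dots> \<le> ennreal (\<phi> x)" unfolding eq by (rule Q.entry_moment_le_\<phi>[OF b(1,2)])
      finally show ?thesis .
    qed
    show "ennreal (\<phi> x) \<le> ennreal (C * \<phi> (axis k a)) * entry_moment M X a (- \<bar>l\<bar>) x" for x
    proof -
      have "ennreal (\<phi>0 x) \<le> ennreal (v * b2 / R.lam) * entry_moment M X a (- R.lam) x"
        by (rule Q.\<phi>_le_entry_moment[OF b(3)])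
      also have "\<dots> \<le> ennreal (C * \<phi>0 (axis k a)) * entry_moment M X a (- R.lam) x"
      proof (intro mult_right_mono ennreal_leI)
        have "v * b2 / R.lam = b1 * (v * b2 / (R.lam * b1))" using b(1) by simp
        also have "\<dots> \<le> b1 * C" using C1(2) b(1) by (intro mult_left_mono) auto
        also note le3
        finally show "v * b2 / R.lam \<le> C * \<phi>0 (axis k a)" .
      qed simp
      finally show ?thesis unfolding eq labs .
    qed
  qed
qed

end
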